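(* Let $Q=(u,u-r)$ with integers $u>r\ge2$. The table $\mathcal T(Q)=\{P_{k,\ell}\mid 1\le k\le r-1,\ 1\le\ell\le u-r\}$ defined in the context contains all the partitions in $\mathfrak Q^{-1}(Q)$.
   Context: Fix an infinite field $\mathsf k$. For a partition $P$ of $n$, $J_P$ denotes the $n\times n$ nilpotent Jordan matrix whose Jordan blocks have sizes the parts of $P$; the Jordan type of a nilpotent matrix is the partition of its Jordan block sizes. For $B=J_P$ let $\mathcal N_B$ be the (irreducible) variety of nilpotent matrices in $\mathrm{Mat}_n(\mathsf k)$ commuting with $B$. $\mathfrak Q(P)$ is the Jordan type of a generic element of $\mathcal N_B$, i.e. the common Jordan type of all elements of some nonempty Zariski-open subset of $\mathcal N_B$. $\mathfrak Q^{-1}(Q)$ is the set of partitions $P$ with $\mathfrak Q(P)=Q$. Notation for partitions. For $1\le k\le n$, $[n]^k$ is the unique partition of $n$ with exactly $k$ parts whose largest and smallest parts differ by at most 1. $s^k$ means $k$ parts equal to $s$. Listing several partitions between parentheses denotes the partition whose multiset of parts is the union of theirs. The table $\mathcal T(Q)$ for $Q=(u,u-r)$, $u>r\ge 2$. Put $t_{\max}=\min\{u-r,\lfloor\frac{r-1}{2}\rfloor\}$, $T=t_{\max}+1$, $k_0=1$. If $r\ge3$, for $1\le t\le t_{\max}$ put $q_t=\lceil\frac{u-r}{t}\rceil$, $d_t=t\,q_t-(u-r)$, $k_t=\lceil\frac{u+1-t+d_t}{q_t+1}\rceil$, and $c_t=k_t$ if $d_t=0$, $c_t=\lceil\frac{u-2t+d_t}{q_t}\rceil$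 if $d_t>0$. For $1\le t\le t_{\max}$ let $A_t=\{(k,\ell): k_{t-1}\le k<k_t,\ t\le\ell\le u-r\}$, $C_t=\{(k,t): k_t\le k<c_t\}$, $B_t=\{(k,t): c_t\le k\le r-t\}\cup\{(r-t,\ell): t<\ell\le u-r\}$; and let $A_T=\{(k,\ell): k=k_{t_{\max}}=r-T,\ T\le\ell\le u-r\}$. Each pair $(k,\ell)$ with $1\le k\le r-1$, $1\le\ell\le u-r$ lies in exactly one of these sets, and - $P_{k,\ell}=([u]^k,[u-r]^\ell)$ if $(k,\ell)\in A_t$, $1\le t\le T$; - $P_{k,\ell}=([u-r+2t]^t,[u-2t]^{k+\ell-t})$ if $(k,\ell)\in B_t$; - $P_{k,\ell}=([u-r+2t]^t,[u-2t-d_t(q_t-1)]^{k-d_t},(q_t-1)^{d_t})$ if $(k,\ell)\in C_t$. $\mathcal T(Q)$ is the $(r-1)\times(u-r)$ array with entries $P_{k,\ell}$. *)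

theory Defs
  imports Complex_Main "HOL-Library.Multiset" "Jordan_Normal_Form.Jordan_Normal_Form"
begin

section \<open>Partitions and nilpotent matrices\<close>

text \<open>A partition of n is the multiset of its (positive) parts; n is \<open>sum_mset P\<close>.
  The union of several partitions is multiset sum.\<close>

definition is_partition :: "nat multiset \<Rightarrow> bool" where
  "is_partition P \<longleftrightarrow> 0 \<notin># P"

definition nilpotent_blocks :: "nat multiset \<Rightarrow> (nat \<times> 'a::zero) list" where
  "nilpotent_blocks P = map (\<lambda>s. (s, 0)) (rev (sorted_list_of_multiset P))"

definition J :: "nat multiset \<Rightarrow> 'a::{zero,one} mat" where
  "J P = jordan_matrix (nilpotent_blocks P)"

definition has_jordan_type :: "'a::semiring_1 mat \<Rightarrow> nat multiset \<Rightarrow> bool" where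
  "has_jordan_type A P \<longleftrightarrow> jordan_nf A (nilpotent_blocks P)"

definition nilpotent_commutator :: "nat \<Rightarrow> 'a::semiring_1 mat \<Rightarrow> 'a mat set" where
  "nilpotent_commutator n B =
     {A \<in> carrier_mat n n. A * B = B * A \<and> (\<exists>m. A ^\<^sub>m m = 0\<^sub>m n n)}"

section \<open>Zariski topology on n by n matrices\<close>

inductive_set mat_polys :: "nat \<Rightarrow> ('a::comm_ring_1 mat \<Rightarrow> 'a) set" for n :: nat where
  const: "(\<lambda>A. c) \<in> mat_polys n"
| coord: "i < n \<Longrightarrow> j < n \<Longrightarrow> (\<lambda>A. A $$ (i, j)) \<in> mat_polys n"
| add: "f \<in> mat_polys n \<Longrightarrow> g \<in> mat_polys n \<Longrightarrow> (\<lambda>A. f A + g A) \<in> mat_polys n"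
| mult: "f \<in> mat_polys n \<Longrightarrow> g \<in> mat_polys n \<Longrightarrow> (\<lambda>A. f A * g A) \<in> mat_polys n"

text \<open>\<open>U\<close> is open in the subspace \<open>X\<close>: it is the complement in \<open>X\<close> of the common zero set
  of some set of polynomial functions in the matrix entries.\<close>

definition zariski_open_in :: "nat \<Rightarrow> 'a::comm_ring_1 mat set \<Rightarrow> 'a mat set \<Rightarrow> bool" where
  "zariski_open_in n X U \<longleftrightarrow>
     (\<exists>F \<subseteq> mat_polys n. U = X - {A. \<forall>f\<in>F. f A = 0})"

section \<open>The generic Jordan type and its fibres\<close>

text \<open>\<open>generic_jordan_type TYPE('a) P Q\<close> is the relation \<open>\<QQ>(P) = Q\<close> over the field \<open>'a\<close>.
  It is functional in \<open>Q\<close> because the nilpotent commutator of \<open>J P\<close> is irreducible when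
  the field is infinite.\<close>

definition generic_jordan_type ::
    "'a::field itself \<Rightarrow> nat multiset \<Rightarrow> nat multiset \<Rightarrow> bool" where
  "generic_jordan_type _ P Q \<longleftrightarrow>
     (\<exists>U :: 'a mat set. U \<noteq> {} \<and>
        zariski_open_in (sum_mset P) (nilpotent_commutator (sum_mset P) (J P)) U \<and>
        (\<forall>A\<in>U. has_jordan_type A Q))"

definition Q_inv :: "'a::field itself \<Rightarrow> nat multiset \<Rightarrow> nat multiset set" where
  "Q_inv K Q = {P. is_partition P \<and> generic_jordan_type K P Q}"

section \<open>The table of (u, u - r)\<close>

text \<open>The partition \<open>[n]\<^sup>k\<close>, meaningful for \<open>1 \<le> k \<le> n\<close>.  All uses below are in this
  range, and no natural number subtraction below truncates, for the arguments
  \<open>u > r \<ge> 2\<close> and the index ranges of the table.\<close>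

definition almost_rect :: "nat \<Rightarrow> nat \<Rightarrow> nat multiset" where
  "almost_rect n k =
     replicate_mset (n mod k) (n div k + 1) + replicate_mset (k - n mod k) (n div k)"

definition tmax :: "nat \<Rightarrow> nat \<Rightarrow> nat" where
  "tmax u r = min (u - r) ((r - 1) div 2)"

definition qt :: "nat \<Rightarrow> nat \<Rightarrow> nat \<Rightarrow> nat" where
  "qt u r t = nat \<lceil>real (u - r) / real t\<rceil>"

definition dt :: "nat \<Rightarrow> nat \<Rightarrow> nat \<Rightarrow> nat" where
  "dt u r t = t * qt u r t - (u - r)"

definition kt :: "nat \<Rightarrow> nat \<Rightarrow> nat \<Rightarrow> nat" where
  "kt u r t = (if t = 0 then 1
     else nat \<lceil>real (u + 1 - t + dt u r t) / real (qt u r t + 1)\<rceil>)"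

definition ct :: "nat \<Rightarrow> nat \<Rightarrow> nat \<Rightarrow> nat" where
  "ct u r t = (if dt u r t = 0 then kt u r t
     else nat \<lceil>real (u - 2 * t + dt u r t) / real (qt u r t)\<rceil>)"

text \<open>The index sets; \<open>A_set u r t\<close> is used for \<open>1 \<le> t \<le> tmax u r + 1\<close>, the other two are
  empty for \<open>t\<close> outside \<open>1 \<le> t \<le> tmax u r\<close>.  The last A-set is empty unless
  \<open>kt u r (tmax u r) = r - (tmax u r + 1)\<close>.\<close>

definition A_set :: "nat \<Rightarrow> nat \<Rightarrow> nat \<Rightarrow> (nat \<times> nat) set" where
  "A_set u r t =
     (if t \<le> tmax u r
      then {(k, l). kt u r (t - 1) \<le> k \<and> k < kt u r t \<and> t \<le> l \<and> l \<le> u - r}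
      else {(k, l). k = kt u r (tmax u r) \<and> k = r - t \<and> t \<le> l \<and> l \<le> u - r})"

definition B_set :: "nat \<Rightarrow> nat \<Rightarrow> nat \<Rightarrow> (nat \<times> nat) set" where
  "B_set u r t =
     (if 1 \<le> t \<and> t \<le> tmax u r
      then {(k, l). l = t \<and> ct u r t \<le> k \<and> k \<le> r - t} \<union>
           {(k, l). k = r - t \<and> t < l \<and> l \<le> u - r}
      else {})"

definition C_set :: "nat \<Rightarrow> nat \<Rightarrow> nat \<Rightarrow> (nat \<times> nat) set" where
  "C_set u r t =
     (if 1 \<le> t \<and> t \<le> tmax u r
      then {(k, l). l = t \<and> kt u r t \<le> k \<and> k < ct u r t}
      else {})"

text \<open>Each \<open>(k, l)\<close> with \<open>1 \<le> k \<le> r - 1\<close> and \<open>1 \<le> l \<le> u - r\<close> lies in exactly one of the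
  sets, so the description below determines the entry uniquely.\<close>

definition table_entry :: "nat \<Rightarrow> nat \<Rightarrow> nat \<Rightarrow> nat \<Rightarrow> nat multiset" where
  "table_entry u r k l = (THE P. \<exists>t. 1 \<le> t \<and> t \<le> tmax u r + 1 \<and>
     ((k, l) \<in> A_set u r t \<and> P = almost_rect u k + almost_rect (u - r) l \<or>
      (k, l) \<in> B_set u r t \<and>
        P = almost_rect (u - r + 2 * t) t + almost_rect (u - 2 * t) (k + l - t) \<or>
      (k, l) \<in> C_set u r t \<and>
        P = almost_rect (u - r + 2 * t) t
            + almost_rect (u - 2 * t - dt u r t * (qt u r t - 1)) (k - dt u r t)
            + replicate_mset (dt u r t) (qt u r t - 1)))"

definition table :: "nat \<Rightarrow> nat \<Rightarrow> nat multiset set" where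
  "table u r = {table_entry u r k l | k l. 1 \<le> k \<and> k \<le> r - 1 \<and> 1 \<le> l \<and> l \<le> u - r}"

end

theory Submission
  imports Defs
begin

text \<open>Let \<open>B\<close> be the Jordan matrix of a partition \<open>P\<close>.  Every matrix of the nilpotent commutator of \<open>B\<close> is
  conjugate, under the commutant of \<open>B\<close>, to one whose nonzero entries strictly decrease a partial order
  on the Jordan basis of \<open>B\<close>.  Chains of this order bound the nilpotency index from above, and
  antichains bound the nullity from below.  Since the matrices of that shape form a linear space, over
  an infinite field a generic one attains the bound given by the longest U-chain of \<open>P\<close>.  Hence if the
  generic Jordan type is \<open>(u, u - r)\<close>, then the longest U-chain of \<open>P\<close> has length \<open>u\<close> and no three parts
  of \<open>P\<close> differ pairwise by 2 or more.  These two properties leave only the partitions in the table.\<close>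

section \<open>Triangularization of nilpotent matrices\<close>

text \<open>A chain takes all vectors of the blocks of its two sizes and two from every larger
  block. Removing a longest chain from \<open>P\<close> leaves the parts below it and the parts
  above it lowered by 2. Under the two conditions these remaining parts are almost equal: if there
  are j of them they form [u-r]^j, that is, j - d_j parts q_j and d_j parts q_j - 1. This is where
  q_t and d_t come from. The thresholds k_t and c_t compare the longest chain with chains through
  neighbouring sizes; when the sizes involved are consecutive, each threshold is exactly an
  inequality between two chain lengths. Ties are broken in favour of a chain with no part above it,
  and this strictness is the +1 in k_t. On the matrix side the obstacle is cancellation: an entry of
  a power is a sum over paths, and many paths may have the maximal length. The matrix attaining the
  bound is therefore built one block size at a time, with a free scalar marking the step that
  distinguishes the intended path.\<close>

lemma mult_index:
  assumes "A \<in> carrier_mat n n" "B \<in> carrier_mat n n" "x < n" "y < n"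
  shows "(A * B) $$ (x, y) = (\<Sum>z<n. A $$ (x, z) * B $$ (z, y))"
  using assms by (simp add: scalar_prod_def lessThan_atLeast0)

lemma mult_index_neq_0:
  fixes A :: "'a::semiring_1 mat"
  assumes "A \<in> carrier_mat n n" "B \<in> carrier_mat n n" "x < n" "y < n" "(A * B) $$ (x, y) \<noteq> 0"
  obtains z where "z < n" "A $$ (x, z) \<noteq> 0" "B $$ (z, y) \<noteq> 0"
proof -
  have "(\<Sum>z<n. A $$ (x, z) * B $$ (z, y)) \<noteq> 0"
    using assms(5) unfolding mult_index[OF assms(1-4)] .
  then obtain z where "z \<in> {..<n}" "A $$ (x, z) * B $$ (z, y) \<noteq> 0" by (rule sum.not_neutral_contains_not_neutral)
  hence "z < n" "A $$ (x, z) \<noteq> 0" "B $$ (z, y) \<noteq> 0" by auto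
  thus thesis by (rule that)
qed

lemma pow_mat_Suc_left:
  fixes A :: "'a::semiring_1 mat"
  assumes "A \<in> carrier_mat n n"
  shows "A ^\<^sub>m Suc k = A * A ^\<^sub>m k"
proof (induct k)
  case 0
  show ?case using assms by simp
next
  case (Suc k)
  have "A ^\<^sub>m Suc (Suc k) = (A * A ^\<^sub>m k) * A" using Suc by simp
  also have "\<dots> = A * (A ^\<^sub>m k * A)"
    by (rule assoc_mult_mat[of _ n n _ n _ n]) (use assms in auto)
  finally show ?case by simp
qed

lemma nilpotent_det_0:
  fixes N :: "'a::field mat"
  assumes N: "N \<in> carrier_mat n n" "N ^\<^sub>m k = 0\<^sub>m n n" and n: "0 < n"
  shows "det N = 0"
proof -
  have "det (N ^\<^sub>m j) = det N ^ j" for j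
  proof (induct j)
    case (Suc j)
    thus ?case using det_mult[of "N ^\<^sub>m j" n N] N(1) by (simp add: mult.commute)
  qed (use N in simp)
  moreover have "det (0\<^sub>m n n :: 'a mat) = 0" using n by simp
  ultimately have "det N ^ k = 0" using N(2) by metis
  thus ?thesis by simp
qed

text \<open>Some coordinate i of \<open>v\<close> is nonzero, so \<open>v\<close> may replace the
  i-th unit vector of the standard basis (matrix \<open>M\<close>, with explicit inverse
  \<open>M'\<close>); a swap then moves it to the front.\<close>

lemma exists_first_column:
  fixes v :: "'a::field vec"
  assumes v: "v \<in> carrier_vec n" "v \<noteq> 0\<^sub>v n"
  obtains P Q where "P \<in> carrier_mat n n" "Q \<in> carrier_mat n n" "P * Q = 1\<^sub>m n" "Q * P = 1\<^sub>m n"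
    "col P 0 = v"
proof -
  obtain i where i: "i < n" "v $ i \<noteq> 0"
    using v by (metis carrier_vecD eq_vecI index_zero_vec(1,2))
  define M where "M = mat n n (\<lambda>(x, y). if y = i then v $ x else if x = y then 1 else 0)"
  define M' where "M' = mat n n (\<lambda>(x, y). if y = i then (if x = i then 1 / v $ i else - v $ x / v $ i)
     else if x = y then 1 else 0)"
  define S where "S = (swaprows_mat n 0 i :: 'a mat)"
  have c: "M \<in> carrier_mat n n" "M' \<in> carrier_mat n n" "S \<in> carrier_mat n n"
    by (auto simp: M_def M'_def S_def)
  have n: "0 < n" using i by auto
  have MM': "M * M' = 1\<^sub>m n"
  proof (rule eq_matI)
    fix x y assume "x < dim_row (1\<^sub>m n :: 'a mat)" "y < dim_col (1\<^sub>m n :: 'a mat)"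
    hence xy: "x < n" "y < n" by auto
    have "(M * M') $$ (x, y) = (\<Sum>z<n. M $$ (x, z) * M' $$ (z, y))" by (rule mult_index[OF c(1,2) xy])
    also have "\<dots> = (\<Sum>z<n. (if z = i then v $ x * M' $$ (i, y) else 0)
        + (if z = x then (if x = i then 0 else M' $$ (x, y)) else 0))"
      by (rule sum.cong) (use xy in \<open>auto simp: M_def\<close>)
    also have "\<dots> = v $ x * M' $$ (i, y) + (if x = i then 0 else M' $$ (x, y))"
      using xy i by (simp add: sum.distrib)
    also have "\<dots> = 1\<^sub>m n $$ (x, y)" using xy i by (auto simp: M'_def)
    finally show "(M * M') $$ (x, y) = 1\<^sub>m n $$ (x, y)" .
  qed (use c in auto)
  have M'M: "M' * M = 1\<^sub>m n" by (rule mat_mult_left_right_inverse[OF c(1,2) MM'])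
  have SS: "S * S = 1\<^sub>m n"
    unfolding S_def using swaprows_mat_inv[OF n i(1)] swaprows_mat_inv[OF i(1) n] by simp
  have "M * S * (S * M') = M * (S * (S * M'))" by (rule assoc_mult_mat[of _ n n _ n _ n]) (use c in auto)
  also have "S * (S * M') = S * S * M'" by (rule assoc_mult_mat[of _ n n _ n _ n, symmetric]) (use c in auto)
  finally have 1: "M * S * (S * M') = 1\<^sub>m n" using SS MM' c by simp
  have 2: "S * M' * (M * S) = 1\<^sub>m n"
    by (rule mat_mult_left_right_inverse[OF _ _ 1]) (use c in auto)
  have 3: "col (M * S) 0 = v"
  proof (rule eq_vecI)
    fix x assume "x < dim_vec v"
    hence x: "x < n" using v by auto
    have "col (M * S) 0 $ x = (M * S) $$ (x, 0)" using c n x by auto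
    also have "\<dots> = (\<Sum>z<n. M $$ (x, z) * S $$ (z, 0))" by (rule mult_index[OF c(1,3) x n])
    also have "\<dots> = (\<Sum>z<n. if z = i then M $$ (x, z) else 0)"
      by (rule sum.cong) (use n i in \<open>auto simp: S_def swaprows_mat_def\<close>)
    also have "\<dots> = v $ x" using x i by (simp add: M_def)
    finally show "col (M * S) 0 $ x = v $ x" .
  qed (use c v in auto)
  show thesis by (rule that[OF _ _ 1 2 3]) (use c in auto)
qed

text \<open>The lower right block is the map on the quotient by the line spanned by the first basis
  vector, and a power of the whole matrix induces the power there. The first row is left
  unspecified.\<close>

lemma pow_four_block_upper_lower_right:
  fixes A :: "'a::semiring_1 mat"
  assumes "A \<in> carrier_mat 1 1" "B \<in> carrier_mat 1 m" "D \<in> carrier_mat m m"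
  shows "\<exists>A' B'. A' \<in> carrier_mat 1 1 \<and> B' \<in> carrier_mat 1 m \<and>
    four_block_mat A B (0\<^sub>m m 1) D ^\<^sub>m k = four_block_mat A' B' (0\<^sub>m m 1) (D ^\<^sub>m k)"
proof (induct k)
  case 0
  have "four_block_mat (1\<^sub>m 1) (0\<^sub>m 1 m) (0\<^sub>m m 1) (1\<^sub>m m) = (1\<^sub>m (1 + m) :: 'a mat)" by auto
  thus ?case using assms by (intro exI[of _ "1\<^sub>m 1"] exI[of _ "0\<^sub>m 1 m"]) auto
next
  case (Suc k)
  then obtain A' B' where *: "A' \<in> carrier_mat 1 1" "B' \<in> carrier_mat 1 m"
    "four_block_mat A B (0\<^sub>m m 1) D ^\<^sub>m k = four_block_mat A' B' (0\<^sub>m m 1) (D ^\<^sub>m k)" by auto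
  have "four_block_mat A' B' (0\<^sub>m m 1) (D ^\<^sub>m k) * four_block_mat A B (0\<^sub>m m 1) D =
     four_block_mat (A' * A + B' * 0\<^sub>m m 1) (A' * B + B' * D) (0\<^sub>m m 1 * A + D ^\<^sub>m k * 0\<^sub>m m 1)
       (0\<^sub>m m 1 * B + D ^\<^sub>m k * D)"
    by (rule mult_four_block_mat[OF *(1,2) _ _ assms(1,2)]) (use assms in auto)
  also have "0\<^sub>m m 1 * A + D ^\<^sub>m k * 0\<^sub>m m 1 = 0\<^sub>m m 1" using assms(1,3) by auto
  also have "0\<^sub>m m 1 * B + D ^\<^sub>m k * D = D ^\<^sub>m Suc k" using assms by auto
  finally show ?case using * assms
    by (intro exI[of _ "A' * A + B' * 0\<^sub>m m 1"] exI[of _ "A' * B + B' * D"]) auto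
qed

text \<open>Induction on the dimension with the exponent \<open>k\<close> fixed. The determinant
  vanishes, so there is a kernel vector; made the first basis vector, it gives a zero first column,
  and the quotient is nilpotent again.\<close>

lemma nilpotent_similar_strict_upper:
  fixes N :: "'a::field mat"
  assumes "N \<in> carrier_mat n n" "N ^\<^sub>m k = 0\<^sub>m n n"
  shows "\<exists>B P Q. similar_mat_wit N B P Q \<and> (\<forall>i<n. \<forall>j<n. B $$ (i, j) \<noteq> 0 \<longrightarrow> i < j)"
  using assms
proof (induct n arbitrary: N)
  case 0
  thus ?case using similar_mat_wit_refl[of N 0] by blast
next
  case (Suc m)
  note N = Suc.prems(1)
  have "det N = 0" by (rule nilpotent_det_0[OF Suc.prems]) simp
  then obtain v where v: "v \<in> carrier_vec (Suc m)" "v \<noteq> 0\<^sub>v (Suc m)" "N *\<^sub>v v = 0\<^sub>v (Suc m)"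
    using det_0_iff_vec_prod_zero[OF N] by auto
  obtain P Q where PQ: "P \<in> carrier_mat (Suc m) (Suc m)" "Q \<in> carrier_mat (Suc m) (Suc m)"
    "P * Q = 1\<^sub>m (Suc m)" "Q * P = 1\<^sub>m (Suc m)" "col P 0 = v"
    using exists_first_column[OF v(1,2)] by metis
  define W where "W = Q * N * P"
  have W: "W \<in> carrier_mat (Suc m) (Suc m)" using PQ N by (simp add: W_def)
  have sim: "similar_mat_wit W N Q P"
    by (rule similar_mat_witI[OF PQ(4,3) W_def W N PQ(2,1)])
  have W0: "W $$ (i, 0) = 0" if "i < Suc m" for i
  proof -
    have "col W 0 = (Q * N) *\<^sub>v col P 0" unfolding W_def
      by (rule col_mult2[of _ "Suc m" "Suc m" _ "Suc m"]) (use PQ N in auto)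
    also have "\<dots> = Q *\<^sub>v (N *\<^sub>v v)" unfolding PQ(5)
      by (rule assoc_mult_mat_vec) (use PQ N v in auto)
    also have "\<dots> = 0\<^sub>v (Suc m)" unfolding v(3)
      by (rule eq_vecI) (use PQ in auto)
    finally have "col W 0 $ i = 0" using that by simp
    thus ?thesis using W that by auto
  qed
  define A1 where "A1 = mat 1 1 (\<lambda>ij. W $$ (0, 0))"
  define A2 where "A2 = mat 1 m (\<lambda>(i, j). W $$ (0, Suc j))"
  define A3 where "A3 = mat m m (\<lambda>(i, j). W $$ (Suc i, Suc j))"
  have c: "A1 \<in> carrier_mat 1 1" "A2 \<in> carrier_mat 1 m" "A3 \<in> carrier_mat m m"
    by (auto simp: A1_def A2_def A3_def)
  have WB: "W = four_block_mat A1 A2 (0\<^sub>m m 1) A3"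
    by (rule eq_matI) (use W W0 in \<open>auto simp: A1_def A2_def A3_def\<close>)
  have "W ^\<^sub>m k = Q * N ^\<^sub>m k * P" using similar_mat_wit_pow_id[OF sim] .
  hence Wk: "W ^\<^sub>m k = 0\<^sub>m (Suc m) (Suc m)" using Suc.prems PQ by simp
  obtain A' B' where *: "A' \<in> carrier_mat 1 1" "B' \<in> carrier_mat 1 m"
    "W ^\<^sub>m k = four_block_mat A' B' (0\<^sub>m m 1) (A3 ^\<^sub>m k)"
    using pow_four_block_upper_lower_right[OF c] unfolding WB by blast
  have A3k: "A3 ^\<^sub>m k = 0\<^sub>m m m"
  proof (rule eq_matI)
    fix i j assume "i < dim_row (0\<^sub>m m m :: 'a mat)" "j < dim_col (0\<^sub>m m m :: 'a mat)"
    moreover from this have "(W ^\<^sub>m k) $$ (Suc i, Suc j) = 0" using Wk by simp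
    ultimately show "(A3 ^\<^sub>m k) $$ (i, j) = 0\<^sub>m m m $$ (i, j)" using *(1,2) c unfolding *(3) by auto
  qed (use c in auto)
  obtain B3 P3 Q3 where IH: "similar_mat_wit A3 B3 P3 Q3" "\<forall>i<m. \<forall>j<m. B3 $$ (i, j) \<noteq> 0 \<longrightarrow> i < j"
    using Suc.hyps[OF c(3) A3k] by blast
  have c3: "B3 \<in> carrier_mat m m" "P3 \<in> carrier_mat m m" "Q3 \<in> carrier_mat m m" "P3 * Q3 = 1\<^sub>m m"
    using similar_mat_witD2[OF c(3) IH(1)] by auto
  \<comment> \<open>Conjugation by the block matrix of 1 and \<open>P3\<close> multiplies the first
    row by \<open>P3\<close> on the right.\<close>
  define B2 where "B2 = A2 * P3"
  have A2': "A2 = 1\<^sub>m 1 * B2 * Q3"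
  proof -
    have "A2 * P3 * Q3 = A2 * (P3 * Q3)" by (rule assoc_mult_mat[OF c(2) c3(2,3)])
    thus ?thesis using c c3 by (simp add: B2_def)
  qed
  have "similar_mat_wit W (four_block_mat A1 B2 (0\<^sub>m m 1) B3)
      (four_block_mat (1\<^sub>m 1) (0\<^sub>m 1 m) (0\<^sub>m m 1) P3) (four_block_mat (1\<^sub>m 1) (0\<^sub>m 1 m) (0\<^sub>m m 1) Q3)"
    unfolding WB
    by (rule similar_mat_wit_four_block[OF similar_mat_wit_refl[OF c(1)] IH(1) A2' _ c(1,3)])
       (use c c3 in \<open>auto simp: B2_def\<close>)
  from similar_mat_wit_trans[OF similar_mat_wit_sym[OF sim] this]
  obtain P' Q' where sim': "similar_mat_wit N (four_block_mat A1 B2 (0\<^sub>m m 1) B3) P' Q'" by blast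
  have "four_block_mat A1 B2 (0\<^sub>m m 1) B3 $$ (i, j) \<noteq> 0 \<longrightarrow> i < j" if ij: "i < Suc m" "j < Suc m" for i j
  proof -
    have "W $$ (0, 0) = 0" using W0 by simp
    hence "A1 $$ (0, 0) = 0" by (simp add: A1_def)
    moreover have "B2 \<in> carrier_mat 1 m" using c c3 by (simp add: B2_def)
    moreover have "B3 $$ (i - 1, j - 1) \<noteq> 0 \<longrightarrow> i - 1 < j - 1" if "0 < i" "0 < j"
      using IH(2) that ij by auto
    ultimately show ?thesis using ij c c3 by (cases i; cases j) auto
  qed
  thus ?case using sim' by blast
qed

section \<open>The commutant of a nilpotent Jordan matrix\<close>

text \<open>The nilpotent Jordan matrix in coordinates that do not depend on the order of the
  blocks: every basis vector goes to the one directly below it in its block, a socle vector to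
  0.\<close>

definition shift_mat :: "nat \<Rightarrow> (nat \<Rightarrow> nat) \<Rightarrow> (nat \<Rightarrow> nat) \<Rightarrow> (nat \<Rightarrow> nat) \<Rightarrow> 'a::{zero,one} mat" where
  "shift_mat n sz rk ht =
     mat n n (\<lambda>(x, y). if sz x = sz y \<and> rk x = rk y \<and> ht y = Suc (ht x) then 1 else 0)"

text \<open>An index \<open>x < n\<close> stands for the basis vector at position \<open>ht x\<close> (0 is the socle) of the
  block number \<open>rk x\<close> among the \<open>mu (sz x)\<close> blocks of size \<open>sz x\<close>; \<open>ix\<close> is the inverse coordinate
  map.  Indices with equal size and position form a layer.\<close>

locale jordan_frame =
  fixes n :: nat and mu :: "nat \<Rightarrow> nat" and sz rk ht :: "nat \<Rightarrow> nat"
    and ix :: "nat \<Rightarrow> nat \<Rightarrow> nat \<Rightarrow> nat"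
  assumes frame: "x < n \<Longrightarrow> rk x < mu (sz x) \<and> ht x < sz x \<and> ix (sz x) (rk x) (ht x) = x"
    and ix: "j < mu i \<Longrightarrow> c < i \<Longrightarrow>
      ix i j c < n \<and> sz (ix i j c) = i \<and> rk (ix i j c) = j \<and> ht (ix i j c) = c"

text \<open>Induction on the list of block sizes: the new block occupies the first \<open>s\<close>
  indices, is numbered last among the blocks of its size, and pushes the other indices up by
  \<open>s\<close>.\<close>

lemma jordan_frame_exists:
  "\<exists>sz rk ht ix. jordan_frame (sum_list xs) (count (mset xs)) sz rk ht ix \<and>
     jordan_matrix (map (\<lambda>s. (s, 0)) xs) = (shift_mat (sum_list xs) sz rk ht :: 'a::{zero,one} mat)"
proof (induct xs)
  case Nil
  have "jordan_frame 0 (count {#}) f f f (\<lambda>_ _ _. 0)" for f :: "nat \<Rightarrow> nat"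
    by unfold_locales simp_all
  moreover have "jordan_matrix [] = (shift_mat 0 f f f :: 'a mat)" for f
    by (rule eq_matI) (simp_all add: jordan_matrix_def shift_mat_def)
  ultimately have "jordan_frame 0 (count {#}) id id id (\<lambda>_ _ _. 0) \<and>
    jordan_matrix [] = (shift_mat 0 id id id :: 'a mat)" by blast
  thus ?case unfolding sum_list.Nil mset.simps list.map by blast
next
  case (Cons s xs)
  then obtain sz rk ht ix where "jordan_frame (sum_list xs) (count (mset xs)) sz rk ht ix"
    and J: "jordan_matrix (map (\<lambda>s. (s, 0)) xs) = (shift_mat (sum_list xs) sz rk ht :: 'a mat)" by blast
  then interpret jordan_frame "sum_list xs" "count (mset xs)" sz rk ht ix by simp
  let ?n = "sum_list xs"
  define sz' where "sz' x = (if x < s then s else sz (x - s))" for x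
  define rk' where "rk' x = (if x < s then count (mset xs) s else rk (x - s))" for x
  define ht' where "ht' x = (if x < s then x else ht (x - s))" for x
  define ix' where "ix' i j c = (if i = s \<and> j = count (mset xs) s then c else s + ix i j c)" for i j c
  note d = sz'_def rk'_def ht'_def ix'_def
  have "jordan_frame (s + ?n) (count (mset (s # xs))) sz' rk' ht' ix'"
  proof
    fix x assume "x < s + ?n"
    thus "rk' x < count (mset (s # xs)) (sz' x) \<and> ht' x < sz' x \<and> ix' (sz' x) (rk' x) (ht' x) = x"
    proof (cases "x < s")
      case False
      hence "x - s < ?n" using \<open>x < s + ?n\<close> by simp
      thus ?thesis using frame[of "x - s"] False by (auto simp: d)
    qed (simp add: d)
  next
    fix i j c assume *: "j < count (mset (s # xs)) i" "c < i"
    show "ix' i j c < s + ?n \<and> sz' (ix' i j c) = i \<and> rk' (ix' i j c) = j \<and> ht' (ix' i j c) = c"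
    proof (cases "i = s \<and> j = count (mset xs) s")
      case True
      thus ?thesis using * by (auto simp: d)
    next
      case False
      hence "j < count (mset xs) i" using * by (auto split: if_splits)
      thus ?thesis using ix[of j i c] *(2) False by (auto simp: d)
    qed
  qed
  moreover have "jordan_matrix (map (\<lambda>s. (s, 0)) (s # xs)) = (shift_mat (s + ?n) sz' rk' ht' :: 'a mat)"
  proof -
    let ?J = "shift_mat ?n sz rk ht :: 'a mat"
    have c: "?J \<in> carrier_mat ?n ?n" by (simp add: shift_mat_def)
    have "jordan_matrix (map (\<lambda>s. (s, 0)) (s # xs)) =
        four_block_mat (jordan_block s 0) (0\<^sub>m s ?n) (0\<^sub>m ?n s) ?J"
      using J c unfolding jordan_matrix_def by (simp add: Let_def)
    also have "\<dots> = shift_mat (s + ?n) sz' rk' ht'"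
    proof (rule eq_matI)
      fix x y assume "x < dim_row (shift_mat (s + ?n) sz' rk' ht' :: 'a mat)"
        "y < dim_col (shift_mat (s + ?n) sz' rk' ht' :: 'a mat)"
      hence xy: "x < s + ?n" "y < s + ?n" by (auto simp: shift_mat_def)
      show "four_block_mat (jordan_block s 0) (0\<^sub>m s ?n) (0\<^sub>m ?n s) ?J $$ (x, y)
          = shift_mat (s + ?n) sz' rk' ht' $$ (x, y)"
      proof -
        have "\<not> x < s \<Longrightarrow> x - s < ?n" "\<not> y < s \<Longrightarrow> y - s < ?n" using xy by simp_all
        thus ?thesis using xy c frame[of "x - s"] frame[of "y - s"]
          by (cases "x < s"; cases "y < s") (auto simp: shift_mat_def d)
      qed
    qed (auto simp: shift_mat_def)
    finally show ?thesis .
  qed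
  ultimately show ?case unfolding sum_list.Cons by blast
qed

section \<open>Entries of commuting matrices in terms of height and depth\<close>

context jordan_frame
begin

text \<open>The depth: how many steps \<open>x\<close> lies below the top of its block. Height and
  depth together determine the size, and they are the coordinates in which commuting matrices are
  monotone.\<close>

definition dp :: "nat \<Rightarrow> nat" where
  "dp x = sz x - Suc (ht x)"

lemma ht_less: "x < n \<Longrightarrow> ht x < sz x"
  and rk_less: "x < n \<Longrightarrow> rk x < mu (sz x)"
  and ix_self: "x < n \<Longrightarrow> ix (sz x) (rk x) (ht x) = x"
  using frame[of x] by simp_all

lemma sz_eq: "x < n \<Longrightarrow> sz x = ht x + dp x + 1"
  using ht_less[of x] by (simp add: dp_def)

lemma index_eqI:
  assumes "x < n" "y < n" "sz x = sz y" "rk x = rk y" "ht x = ht y"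
  shows "x = y"
proof -
  have "ix (sz x) (rk x) (ht x) = ix (sz y) (rk y) (ht y)" by (simp only: assms(3-5))
  thus ?thesis by (simp only: ix_self assms(1,2))
qed

text \<open>Truncated subtraction gives \<open>dn x = x\<close> for a socle vector, so
  \<open>dn x\<close> is a valid index without side condition; \<open>up x\<close> is meaningful
  only below the top.\<close>

definition dn :: "nat \<Rightarrow> nat" where
  "dn x = ix (sz x) (rk x) (ht x - 1)"

definition up :: "nat \<Rightarrow> nat" where
  "up x = ix (sz x) (rk x) (Suc (ht x))"

lemma dn:
  assumes "x < n"
  shows "dn x < n" "sz (dn x) = sz x" "rk (dn x) = rk x" "ht (dn x) = ht x - 1"
  using ix[of "rk x" "sz x" "ht x - 1"] ht_less[OF assms] rk_less[OF assms]
  unfolding dn_def by simp_all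

lemma up:
  assumes "x < n" "Suc (ht x) < sz x"
  shows "up x < n" "sz (up x) = sz x" "rk (up x) = rk x" "ht (up x) = Suc (ht x)"
  using ix[of "rk x" "sz x" "Suc (ht x)"] assms(2) rk_less[OF assms(1)]
  unfolding up_def by simp_all

lemma dn_up: "x < n \<Longrightarrow> Suc (ht x) < sz x \<Longrightarrow> dn (up x) = x"
  by (rule index_eqI) (simp_all add: dn up)

lemma up_dn: "x < n \<Longrightarrow> 0 < ht x \<Longrightarrow> up (dn x) = x"
  using ht_less[of x] by - (rule index_eqI, simp_all add: dn up)

abbreviation S :: "'a::comm_ring_1 mat" where
  "S \<equiv> shift_mat n sz rk ht"

lemma S_carrier [simp]: "shift_mat n sz rk ht \<in> carrier_mat n n"
  by (simp add: shift_mat_def)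

lemma S_index:
  assumes "x < n" "y < n"
  shows "S $$ (x, y) = (if 0 < ht y \<and> x = dn y then 1 else 0)"
proof (cases "0 < ht y \<and> x = dn y")
  case True
  thus ?thesis using assms dn[OF assms(2)] by (simp add: shift_mat_def)
next
  case False
  have "\<not> (sz x = sz y \<and> rk x = rk y \<and> ht y = Suc (ht x))"
  proof
    assume *: "sz x = sz y \<and> rk x = rk y \<and> ht y = Suc (ht x)"
    have "x = dn y" by (rule index_eqI) (use assms dn[OF assms(2)] * in simp_all)
    thus False using False * by simp
  qed
  thus ?thesis using assms False by (simp add: shift_mat_def)
qed

lemma S_index':
  assumes "x < n" "y < n"
  shows "S $$ (x, y) = (if Suc (ht x) < sz x \<and> y = up x then 1 else 0)"
proof -
  have "0 < ht y \<and> x = dn y \<longleftrightarrow> Suc (ht x) < sz x \<and> y = up x"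
  proof
    assume *: "0 < ht y \<and> x = dn y"
    hence "Suc (ht x) < sz x" using dn[OF assms(2)] ht_less[OF assms(2)] by simp
    moreover have "y = up x" using * up_dn[OF assms(2)] by simp
    ultimately show "Suc (ht x) < sz x \<and> y = up x" by simp
  next
    assume *: "Suc (ht x) < sz x \<and> y = up x"
    thus "0 < ht y \<and> x = dn y" using up[OF assms(1)] dn_up[OF assms(1)] by simp
  qed
  thus ?thesis unfolding S_index[OF assms] by (simp only:)
qed

lemma mult_S_index:
  fixes A :: "'a::comm_ring_1 mat"
  assumes A: "A \<in> carrier_mat n n" and xy: "x < n" "y < n"
  shows "(A * S) $$ (x, y) = (if ht y = 0 then 0 else A $$ (x, dn y))"
proof -
  have "(A * S) $$ (x, y) = (\<Sum>z<n. A $$ (x, z) * S $$ (z, y))" by (rule mult_index[OF A S_carrier xy])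
  also have "\<dots> = (\<Sum>z<n. if z = dn y then (if ht y = 0 then 0 else A $$ (x, z)) else 0)"
    by (rule sum.cong) (simp_all add: S_index xy)
  finally show ?thesis using dn[OF xy(2)] by simp
qed

lemma S_mult_index:
  fixes A :: "'a::comm_ring_1 mat"
  assumes A: "A \<in> carrier_mat n n" and xy: "x < n" "y < n"
  shows "(S * A) $$ (x, y) = (if Suc (ht x) < sz x then A $$ (up x, y) else 0)"
proof -
  have "(S * A) $$ (x, y) = (\<Sum>z<n. S $$ (x, z) * A $$ (z, y))" by (rule mult_index[OF S_carrier A xy])
  also have "\<dots> = (\<Sum>z<n. if z = up x then (if Suc (ht x) < sz x then A $$ (z, y) else 0) else 0)"
    by (rule sum.cong) (simp_all add: S_index' xy)
  finally show ?thesis using up[OF xy(1)] by simp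
qed

definition commutant :: "'a::comm_ring_1 mat set" where
  "commutant = {A \<in> carrier_mat n n. A * S = S * A}"

lemma comm_carrier: "A \<in> commutant \<Longrightarrow> A \<in> carrier_mat n n"
  by (simp add: commutant_def)

lemma commI:
  fixes A :: "'a::comm_ring_1 mat"
  assumes A: "A \<in> carrier_mat n n"
    and "\<And>x y. x < n \<Longrightarrow> y < n \<Longrightarrow>
      (if ht y = 0 then 0 else A $$ (x, dn y)) =
      (if Suc (ht x) < sz x then A $$ (up x, y) else 0)"
  shows "A \<in> commutant"
proof -
  have "A * S = S * A"
  proof (rule eq_matI)
    fix x y assume "x < dim_row (S * A)" "y < dim_col (S * A)"
    hence xy: "x < n" "y < n" using A by (simp_all add: shift_mat_def)
    show "(A * S) $$ (x, y) = (S * A) $$ (x, y)"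
      unfolding mult_S_index[OF A xy] S_mult_index[OF A xy] by (rule assms(2)[OF xy])
  qed (use A in \<open>simp_all add: shift_mat_def\<close>)
  thus ?thesis using A by (simp add: commutant_def)
qed

lemma commD:
  fixes A :: "'a::comm_ring_1 mat"
  assumes A: "A \<in> commutant" and xy: "x < n" "y < n"
  shows "(if ht y = 0 then 0 else A $$ (x, dn y)) =
      (if Suc (ht x) < sz x then A $$ (up x, y) else 0)"
  using mult_S_index[of A x y] S_mult_index[of A x y] A xy by (simp add: commutant_def)

lemma comm_mult:
  fixes A :: "'a::comm_ring_1 mat"
  assumes "A \<in> commutant" "B \<in> commutant"
  shows "A * B \<in> commutant"
proof -
  have c: "A \<in> carrier_mat n n" "B \<in> carrier_mat n n" and AB: "A * S = S * A" "B * S = S * B"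
    using assms by (auto simp: commutant_def)
  note assoc = assoc_mult_mat[of _ n n _ n _ n]
  have "A * B * S = A * (B * S)" using c by (intro assoc) auto
  also have "\<dots> = A * S * B" unfolding AB(2) using c by (intro assoc[symmetric]) auto
  also have "\<dots> = S * (A * B)" unfolding AB(1) using c by (intro assoc) auto
  finally show ?thesis using c by (simp add: commutant_def)
qed

lemma comm_add_smult:
  fixes A :: "'a::comm_ring_1 mat"
  assumes "A \<in> commutant" "B \<in> commutant"
  shows "A + c \<cdot>\<^sub>m B \<in> commutant"
proof (rule commI)
  fix x y assume xy: "x < n" "y < n"
  show "(if ht y = 0 then 0 else (A + c \<cdot>\<^sub>m B) $$ (x, dn y)) =
      (if Suc (ht x) < sz x then (A + c \<cdot>\<^sub>m B) $$ (up x, y) else 0)"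
    using commD[OF assms(1) xy] commD[OF assms(2) xy] comm_carrier[OF assms(1)] comm_carrier[OF assms(2)]
      xy dn(1)[OF xy(2)] up(1)[OF xy(1)] by (simp split: if_splits)
qed (use comm_carrier[OF assms(1)] comm_carrier[OF assms(2)] in auto)

lemma comm_one: "1\<^sub>m n \<in> commutant"
  by (simp add: commutant_def left_mult_one_mat[OF S_carrier] right_mult_one_mat[OF S_carrier])

lemma comm_pow:
  fixes A :: "'a::comm_ring_1 mat"
  assumes "A \<in> commutant"
  shows "A ^\<^sub>m k \<in> commutant"
proof (induct k)
  case 0
  show ?case using comm_one comm_carrier[OF assms] by simp
qed (use assms comm_mult in auto)

lemma comm_ht_le:
  fixes A :: "'a::comm_ring_1 mat"
  assumes A: "A \<in> commutant" and xy: "x < n" "y < n" "A $$ (x, y) \<noteq> 0"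
  shows "ht x \<le> ht y"
  using xy
proof (induct "ht x" arbitrary: x y)
  case (Suc h)
  have x: "0 < ht x" using Suc(2) by simp
  have "Suc (ht (dn x)) < sz (dn x)" using dn[OF Suc(3)] ht_less[OF Suc(3)] x by simp
  hence 3: "ht y \<noteq> 0" "A $$ (dn x, dn y) \<noteq> 0"
    using commD[OF A dn(1)[OF Suc(3)] Suc(4)] Suc(5) up_dn[OF Suc(3) x] by (simp_all split: if_splits)
  have "ht (dn x) \<le> ht (dn y)"
    by (rule Suc(1)) (use Suc(2) dn[OF Suc(3)] dn[OF Suc(4)] 3 in simp_all)
  thus ?case using dn[OF Suc(3)] dn[OF Suc(4)] 3 by simp
qed simp

text \<open>Dual to \<open>comm_ht_le\<close>, with the images of the powers of \<open>S\<close> in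
  place of the kernels; both indices move up.\<close>

lemma comm_dp_ge:
  fixes A :: "'a::comm_ring_1 mat"
  assumes A: "A \<in> commutant" and xy: "x < n" "y < n" "A $$ (x, y) \<noteq> 0"
  shows "dp y \<le> dp x"
  using xy
proof (induct "dp y" arbitrary: x y)
  case (Suc d)
  have y: "Suc (ht y) < sz y" using Suc(2) by (simp add: dp_def)
  note y' = up[OF Suc(4) y]
  have 3: "Suc (ht x) < sz x" "A $$ (up x, up y) \<noteq> 0"
    using commD[OF A Suc(3) y'(1)] Suc(5) y' dn_up[OF Suc(4) y] by (simp_all split: if_splits)
  note x' = up[OF Suc(3) 3(1)]
  have "dp (up y) \<le> dp (up x)" by (rule Suc(1)) (use x' y' 3 Suc(2) in \<open>simp_all add: dp_def\<close>)
  thus ?case using x' y' 3 y by (simp add: dp_def)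
qed simp

text \<open>Within a layer the entry is unchanged when both indices slide down to the socle, so one
  matrix for each block size describes all layers of that size.\<close>

lemma comm_layer:
  fixes A :: "'a::comm_ring_1 mat"
  assumes A: "A \<in> commutant" and xy: "x < n" "y < n" "sz x = sz y" "ht x = ht y"
  shows "A $$ (x, y) = A $$ (ix (sz x) (rk x) 0, ix (sz x) (rk y) 0)"
  using xy
proof (induct "ht x" arbitrary: x y)
  case 0
  have "ix (sz x) (rk x) 0 = x" using ix_self[OF 0(2)] by (simp only: 0(1)[symmetric])
  moreover have "ix (sz x) (rk y) 0 = y" using ix_self[OF 0(3)] by (simp only: 0(1)[symmetric] 0(4,5)[symmetric])
  ultimately show ?case by simp
next
  case (Suc h)
  have x: "0 < ht x" using Suc(2) by simp
  note x' = dn[OF Suc(3)] and y' = dn[OF Suc(4)]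
  have "Suc (ht (dn x)) < sz (dn x)" using x' ht_less[OF Suc(3)] x by simp
  hence "A $$ (dn x, dn y) = A $$ (x, y)"
    using commD[OF A dn(1)[OF Suc(3)] Suc(4)] up_dn[OF Suc(3) x] x Suc(6) by (simp split: if_splits)
  moreover have "A $$ (dn x, dn y) = A $$ (ix (sz (dn x)) (rk (dn x)) 0, ix (sz (dn x)) (rk (dn y)) 0)"
    by (rule Suc(1)) (use x' y' Suc(2,5,6) in simp_all)
  ultimately show ?case by (simp only: x' y')
qed

text \<open>A linear space of nilpotent matrices, every element of the nilpotent commutator being conjugate
  into it under the commutant.\<close>

definition adapted :: "'a::comm_ring_1 mat set" where
  "adapted = {A \<in> commutant. \<forall>x<n. \<forall>y<n. sz x = sz y \<and> ht x = ht y \<and> A $$ (x, y) \<noteq> 0 \<longrightarrow> rk y < rk x}"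

lemma adapted_comm: "A \<in> adapted \<Longrightarrow> A \<in> commutant"
  by (simp add: adapted_def)

lemma adapted_carrier: "A \<in> adapted \<Longrightarrow> A \<in> carrier_mat n n"
  by (simp add: adapted_def commutant_def)

lemma adapted_add_smult:
  fixes A :: "'a::comm_ring_1 mat"
  assumes "A \<in> adapted" "B \<in> adapted"
  shows "A + c \<cdot>\<^sub>m B \<in> adapted"
proof -
  have "rk y < rk x" if "x < n" "y < n" "sz x = sz y" "ht x = ht y" "(A + c \<cdot>\<^sub>m B) $$ (x, y) \<noteq> 0" for x y
  proof -
    have "A $$ (x, y) \<noteq> 0 \<or> B $$ (x, y) \<noteq> 0"
      using that adapted_carrier[OF assms(1)] adapted_carrier[OF assms(2)] by auto
    thus ?thesis using that assms by (auto simp: adapted_def)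
  qed
  thus ?thesis using comm_add_smult assms by (auto simp: adapted_def)
qed

end

section \<open>Upper bound for the nilpotency index\<close>

lemma pow_transpose_mat:
  fixes A :: "'a::comm_semiring_1 mat"
  assumes "A \<in> carrier_mat n n"
  shows "transpose_mat A ^\<^sub>m k = transpose_mat (A ^\<^sub>m k)"
proof (induct k)
  case 0
  show ?case using assms by simp
next
  case (Suc k)
  have "transpose_mat (A ^\<^sub>m Suc k) = transpose_mat (A * A ^\<^sub>m k)"
    by (simp only: pow_mat_Suc_left[OF assms])
  also have "\<dots> = transpose_mat (A ^\<^sub>m k) * transpose_mat A"
    by (rule transpose_mult[OF assms pow_carrier_mat[OF assms]])
  finally show ?case using Suc by simp
qed

text \<open>The transpose of \<open>nilpotent_similar_strict_upper\<close>. Lower triangular form is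
  wanted because a nonzero entry of an adapted matrix within a layer has its row at a larger rank
  than its column.\<close>

lemma nilpotent_conj_strict_lower:
  fixes N :: "'a::field mat"
  assumes N: "N \<in> carrier_mat n n" "N ^\<^sub>m k = 0\<^sub>m n n"
  shows "\<exists>G H. G \<in> carrier_mat n n \<and> H \<in> carrier_mat n n \<and> G * H = 1\<^sub>m n \<and> H * G = 1\<^sub>m n \<and>
    (\<forall>i<n. \<forall>j<n. (G * N * H) $$ (i, j) \<noteq> 0 \<longrightarrow> j < i)"
proof -
  let ?T = "transpose_mat :: 'a mat \<Rightarrow> 'a mat"
  have "?T N \<in> carrier_mat n n" "?T N ^\<^sub>m k = 0\<^sub>m n n"
    using N pow_transpose_mat[OF N(1), of k] by simp_all
  from nilpotent_similar_strict_upper[OF this]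
  obtain B P Q where sim: "similar_mat_wit (?T N) B P Q"
    and up: "\<forall>i<n. \<forall>j<n. B $$ (i, j) \<noteq> 0 \<longrightarrow> i < j" by blast
  have NT: "?T N \<in> carrier_mat n n" using N by simp
  note w = similar_mat_witD2[OF NT sim]
  note w' = similar_mat_witD2[OF w(5) similar_mat_wit_sym[OF sim]]
  have "?T B = ?T P * (?T (Q * ?T N))"
    unfolding w'(3) by (rule transpose_mult) (use w NT in auto)
  also have "?T (Q * ?T N) = N * ?T Q" using transpose_mult[OF w(7) NT] by simp
  also have "?T P * (N * ?T Q) = ?T P * N * ?T Q"
    by (rule assoc_mult_mat[symmetric]) (use w N in auto)
  finally have B: "?T P * N * ?T Q = ?T B" ..
  have "?T P * ?T Q = 1\<^sub>m n" "?T Q * ?T P = 1\<^sub>m n"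
    unfolding transpose_mult[OF w(7) w(6), symmetric] transpose_mult[OF w(6) w(7), symmetric] w(1,2)
    by simp_all
  moreover have "\<forall>i<n. \<forall>j<n. ?T B $$ (i, j) \<noteq> 0 \<longrightarrow> j < i" using up w(5) by auto
  ultimately show ?thesis using w(6,7) B by (intro exI[of _ "?T P"] exI[of _ "?T Q"]) simp
qed

text \<open>Nonzero entries of commuting matrices decrease the height \<open>h\<close> and increase the depth \<open>d\<close>.
  Refined to unit steps, a path from \<open>(h, d)\<close> is a walk on block sizes \<open>h + d + 1\<close> changing by one; if
  \<open>a\<close> is its smallest size, its weight is at most the bound below: every size between is crossed once
  on the way down and once on the way up, and the \<open>a - d - 1\<close> spare pairs of steps are best spent
  between two adjacent sizes \<open>b\<close>, \<open>b + 1\<close>.\<close>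

definition chain_bound :: "(nat \<Rightarrow> nat) \<Rightarrow> nat \<Rightarrow> nat \<Rightarrow> nat \<Rightarrow> nat \<Rightarrow> bool" where
  "chain_bound c N h d X \<longleftrightarrow> (\<exists>a b. d < a \<and> a \<le> h + d + 1 \<and> a \<le> b \<and>
     (\<forall>j\<ge>a. c j + c (Suc j) \<le> c b + c (Suc b)) \<and>
     X \<le> sum c {a<..h + d + 1} + c a + sum c {a<..N} + (a - Suc d) * (c b + c (Suc b)))"

text \<open>The length of the U-chain of Oblak through the blocks of size \<open>b\<close> and \<open>b + 1\<close>, where \<open>c i\<close> is
  the number of blocks of size \<open>i\<close> and all sizes are at most \<open>N\<close>.\<close>

definition uchain :: "(nat \<Rightarrow> nat) \<Rightarrow> nat \<Rightarrow> nat \<Rightarrow> nat" where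
  "uchain c N b = b * c b + Suc b * c (Suc b) + 2 * sum c {Suc b<..N}"

context
  fixes c :: "nat \<Rightarrow> nat" and N :: nat
  assumes c0: "\<And>i. N < i \<Longrightarrow> c i = 0"
begin

lemma sum_tail: "sum c {a<..N} = c (Suc a) + sum c {Suc a<..N}"
proof (cases "Suc a \<le> N")
  case True
  hence "{a<..N} = insert (Suc a) {Suc a<..N}" by auto
  thus ?thesis by simp
next
  case False
  thus ?thesis using c0 by simp
qed

lemma ex_argmax_pair: "\<exists>b\<ge>a. \<forall>j\<ge>a. c j + c (Suc j) \<le> c b + c (Suc b)"
proof -
  let ?f = "\<lambda>j. c j + c (Suc j)"
  have fin: "finite (?f ` {a..max a N})" "?f ` {a..max a N} \<noteq> {}" by auto
  from Max_in[OF this] obtain b where b: "Max (?f ` {a..max a N}) = ?f b" "b \<in> {a..max a N}"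
    by (rule imageE)
  have "?f j \<le> ?f b" if "a \<le> j" for j
  proof (cases "j \<le> max a N")
    case True
    thus ?thesis using Max_ge[OF fin(1), of "?f j"] b(1) that by simp
  next
    case False
    thus ?thesis using c0[of j] c0[of "Suc j"] by simp
  qed
  thus ?thesis using b by auto
qed

lemma chain_bound_base: "chain_bound c N h d (c (h + d + 1))"
proof -
  obtain b where "h + d + 1 \<le> b" "\<forall>j\<ge>h + d + 1. c j + c (Suc j) \<le> c b + c (Suc b)"
    using ex_argmax_pair by blast
  thus ?thesis unfolding chain_bound_def by (intro exI[of _ "h + d + 1"] exI[of _ b]) simp
qed

text \<open>A step up in height enlarges the size by one; the smallest size and the number of spare
  pairs stay as they are.\<close>

lemma chain_bound_Suc_height:
  assumes "chain_bound c N h d X"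
  shows "chain_bound c N (Suc h) d (X + c (Suc h + d + 1))"
proof -
  obtain a b where *: "d < a" "a \<le> h + d + 1" "a \<le> b" "\<forall>j\<ge>a. c j + c (Suc j) \<le> c b + c (Suc b)"
    "X \<le> sum c {a<..h + d + 1} + c a + sum c {a<..N} + (a - Suc d) * (c b + c (Suc b))"
    using assms unfolding chain_bound_def by blast
  have "{a<..Suc h + d + 1} = insert (Suc h + d + 1) {a<..h + d + 1}" using *(2) by auto
  hence "sum c {a<..Suc h + d + 1} = c (Suc h + d + 1) + sum c {a<..h + d + 1}" by simp
  thus ?thesis unfolding chain_bound_def using * by (intro exI[of _ a] exI[of _ b]) simp
qed

text \<open>Lowering the depth by one lowers the size by one. If the smallest size \<open>a\<close>
  stays, the bound gains one spare pair, which pays for the two sizes involved; otherwise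
  \<open>a\<close> itself drops by one and the best pair has to be chosen anew.\<close>

lemma chain_bound_pred_depth:
  assumes "chain_bound c N h (Suc d) X"
  shows "chain_bound c N h d (X + c (h + d + 1))"
proof -
  let ?w = "\<lambda>j. c j + c (Suc j)"
  define i where "i = h + d + 1"
  obtain a b where *: "Suc d < a" "a \<le> Suc i" "a \<le> b" "\<forall>j\<ge>a. ?w j \<le> ?w b"
    "X \<le> sum c {a<..Suc i} + c a + sum c {a<..N} + (a - Suc (Suc d)) * ?w b"
    using assms unfolding chain_bound_def i_def by auto
  show ?thesis
  proof (cases "a \<le> i")
    case True
    have "{a<..Suc i} = insert (Suc i) {a<..i}" using True by auto
    hence s: "sum c {a<..Suc i} = c (Suc i) + sum c {a<..i}" by simp
    have "a - Suc d = Suc (a - Suc (Suc d))" using *(1) by simp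
    hence "(a - Suc d) * ?w b = ?w b + (a - Suc (Suc d)) * ?w b" by simp
    moreover have "?w i \<le> ?w b" using *(4) True by blast
    ultimately have "X + c i \<le> sum c {a<..i} + c a + sum c {a<..N} + (a - Suc d) * ?w b"
      using *(5) s by linarith
    thus ?thesis unfolding chain_bound_def i_def[symmetric] using * True by (intro exI[of _ a] exI[of _ b]) simp
  next
    case False
    hence a: "a = Suc i" using * by simp
    obtain b' where b': "i \<le> b'" "\<forall>j\<ge>i. ?w j \<le> ?w b'" using ex_argmax_pair by blast
    have "?w b \<le> ?w b'" using b'(2) *(3) a by auto
    hence "(i - Suc d) * ?w b \<le> (i - Suc d) * ?w b'" by (rule mult_le_mono2)
    moreover have "X \<le> c (Suc i) + sum c {Suc i<..N} + (i - Suc d) * ?w b"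
      using *(5) unfolding a by simp
    ultimately have "X + c i \<le> c i + sum c {i<..N} + (i - Suc d) * ?w b'"
      using sum_tail[of i] by linarith
    hence "X + c i \<le> sum c {i<..i} + c i + sum c {i<..N} + (i - Suc d) * ?w b'" by simp
    thus ?thesis unfolding chain_bound_def i_def[symmetric] using * a b'
      by (intro exI[of _ i] exI[of _ b']) (simp add: i_def)
  qed
qed

lemma chain_bound_mono:
  assumes "chain_bound c N h' d' X" "h' \<le> h" "d \<le> d'"
  shows "chain_bound c N h d X"
proof -
  have drop: "chain_bound c N h d Y \<Longrightarrow> X \<le> Y \<Longrightarrow> chain_bound c N h d X" for h d X Y
    unfolding chain_bound_def by (meson order_trans)
  have "chain_bound c N h d' X" using assms(2,1)
  proof (induct rule: dec_induct)
    case (step k)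
    thus ?case using chain_bound_Suc_height[of k d' X] drop by (meson le_add1)
  qed
  with assms(3) show ?thesis
  proof (induct rule: inc_induct)
    case (step k)
    thus ?case using chain_bound_pred_depth[of h k X] drop by (meson le_add1)
  qed
qed

text \<open>Refine the step into unit steps and stop one unit short of the end: the last unit step
  enters the size h + d + 1 and adds its weight, while the earlier ones only enlarge the
  bound.\<close>

lemma chain_bound_step:
  assumes "chain_bound c N h' d' X" "h' \<le> h" "d \<le> d'" "h' \<noteq> h \<or> d' \<noteq> d"
  shows "chain_bound c N h d (X + c (h + d + 1))"
proof (cases "h' < h")
  case True
  hence "chain_bound c N (h - 1) d X" using chain_bound_mono[OF assms(1) _ assms(3)] by simp
  thus ?thesis using chain_bound_Suc_height[of "h - 1" d X] True by simp
next
  case False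
  hence "chain_bound c N h (Suc d) X" using chain_bound_mono[OF assms(1,2), of "Suc d"] assms by simp
  thus ?thesis by (rule chain_bound_pred_depth)
qed

text \<open>Prolong the path to height \<open>N - 1\<close> and depth 0. Then raise the smallest
  size from \<open>a\<close> to \<open>b\<close>: each size given up frees a pair of weight at most
  that of the best pair, so it can be exchanged for one more passage through b and b + 1.\<close>

lemma chain_bound_le_uchain:
  assumes "chain_bound c N h d X" "h + d + 1 \<le> N"
  shows "\<exists>b. X \<le> uchain c N b"
proof -
  let ?w = "\<lambda>j. c j + c (Suc j)"
  have "chain_bound c N (N - 1) 0 X" using chain_bound_mono[OF assms(1), of "N - 1" 0] assms(2) by simp
  then obtain a b where *: "0 < a" "a \<le> N" "a \<le> b" "\<forall>j\<ge>a. ?w j \<le> ?w b"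
    "X \<le> sum c {a<..N} + c a + sum c {a<..N} + (a - 1) * ?w b"
    unfolding chain_bound_def using assms(2) by auto
  have "c a + 2 * sum c {a<..N} \<le> c b + 2 * sum c {b<..N} + (b - a) * ?w b"
    using *(3,4)
  proof (induct rule: inc_induct)
    case (step k)
    have "c k + 2 * sum c {k<..N} = ?w k + (c (Suc k) + 2 * sum c {Suc k<..N})"
      using sum_tail[of k] by simp
    moreover have "?w k \<le> ?w b" using step by blast
    moreover have "c (Suc k) + 2 * sum c {Suc k<..N} \<le> c b + 2 * sum c {b<..N} + (b - Suc k) * ?w b"
      using step by simp
    moreover have "b - k = Suc (b - Suc k)" using step by simp
    ultimately show ?case by simp
  qed simp
  moreover have "(b - a) * ?w b + (a - 1) * ?w b = (b - 1) * ?w b"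
    using *(1,3) by (simp add: add_mult_distrib[symmetric])
  ultimately have "X \<le> c b + 2 * sum c {b<..N} + (b - 1) * ?w b" using *(5) by linarith
  also have "\<dots> = uchain c N b"
    using sum_tail[of b] *(1,3) by (cases b) (simp_all add: uchain_def algebra_simps)
  finally show ?thesis by blast
qed

end

context jordan_frame
begin

text \<open>A nonzero entry of a power yields a path of k + 1 basis vectors. In the invariant
  \<open>k + 1 + rk y \<le> X\<close> a layer is charged in full on entry; further steps inside it
  lower the rank, so the left side does not grow.\<close>

lemma adapted_pow_neq_0_imp:
  fixes A :: "'a::comm_ring_1 mat"
  assumes A: "A \<in> adapted" and xy: "x < n" "y < n" "(A ^\<^sub>m k) $$ (x, y) \<noteq> 0"
    and N: "\<And>i. N < i \<Longrightarrow> mu i = 0"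
  shows "\<exists>b. k < uchain mu N b"
proof -
  have "\<exists>X. chain_bound mu N (ht y) (dp y) X \<and> k + 1 + rk y \<le> X"
    using xy
  proof (induct k arbitrary: y)
    case 0
    have "chain_bound mu N (ht y) (dp y) (mu (sz y))"
      using chain_bound_base[of N mu "ht y" "dp y"] N sz_eq[OF 0(2)] by simp
    thus ?case using rk_less[OF 0(2)] by (intro exI[of _ "mu (sz y)"]) simp
  next
    case (Suc k)
    have "(A ^\<^sub>m k * A) $$ (x, y) \<noteq> 0" using Suc(4) by simp
    then obtain z where z: "z < n" "(A ^\<^sub>m k) $$ (x, z) \<noteq> 0" "A $$ (z, y) \<noteq> 0"
      by (rule mult_index_neq_0[OF pow_carrier_mat[OF adapted_carrier[OF A]] adapted_carrier[OF A] Suc(2,3)])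
    obtain X where X: "chain_bound mu N (ht z) (dp z) X" "k + 1 + rk z \<le> X"
      using Suc(1)[OF Suc(2) z(1,2)] by blast
    have le: "ht z \<le> ht y" "dp y \<le> dp z"
      using comm_ht_le[OF adapted_comm[OF A] z(1) Suc(3) z(3)]
        comm_dp_ge[OF adapted_comm[OF A] z(1) Suc(3) z(3)] by simp_all
    show ?case
    proof (cases "ht z = ht y \<and> dp z = dp y")
      case True
      hence "sz z = sz y" using sz_eq[OF z(1)] sz_eq[OF Suc(3)] by simp
      hence "rk y < rk z" using A z Suc(3) True unfolding adapted_def by blast
      thus ?thesis using X True by (intro exI[of _ X]) simp
    next
      case False
      have "chain_bound mu N (ht y) (dp y) (X + mu (ht y + dp y + 1))"
        by (rule chain_bound_step[OF _ X(1) le]) (use N False in auto)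
      thus ?thesis using X rk_less[OF Suc(3)] sz_eq[OF Suc(3)]
        by (intro exI[of _ "X + mu (sz y)"]) simp
    qed
  qed
  then obtain X where X: "chain_bound mu N (ht y) (dp y) X" "k + 1 + rk y \<le> X" by blast
  have "ht y + dp y + 1 \<le> N"
  proof (rule ccontr)
    assume "\<not> ht y + dp y + 1 \<le> N"
    hence "mu (sz y) = 0" using N sz_eq[OF xy(2)] by simp
    thus False using rk_less[OF xy(2)] by simp
  qed
  from chain_bound_le_uchain[OF _ X(1) this] N obtain b where "X \<le> uchain mu N b" by blast
  hence "k < uchain mu N b" using X(2) by simp
  thus ?thesis by blast
qed

end

section \<open>Conjugation into adapted form\<close>

context jordan_frame
begin

text \<open>Height and depth are monotone along nonzero entries, so a path that starts and ends in
  one layer cannot leave it. Restriction to a layer is therefore multiplicative.\<close>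

lemma layer_mult:
  fixes A B :: "'a::comm_ring_1 mat"
  assumes A: "A \<in> commutant" and B: "B \<in> commutant"
    and xy: "x < n" "y < n" "sz x = sz y" "ht x = ht y"
  shows "(A * B) $$ (x, y) =
    (\<Sum>j<mu (sz x). A $$ (x, ix (sz x) j (ht x)) * B $$ (ix (sz x) j (ht x), y))"
proof -
  let ?f = "\<lambda>z. A $$ (x, z) * B $$ (z, y)"
  let ?L = "(\<lambda>j. ix (sz x) j (ht x)) ` {..<mu (sz x)}"
  have L: "ix (sz x) j (ht x) < n" "rk (ix (sz x) j (ht x)) = j" if "j < mu (sz x)" for j
    using ix[OF that ht_less[OF xy(1)]] by simp_all
  have "(A * B) $$ (x, y) = sum ?f {..<n}"
    by (rule mult_index[OF comm_carrier[OF A] comm_carrier[OF B] xy(1,2)])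
  also have "\<dots> = sum ?f ?L"
  proof (rule sum.mono_neutral_right)
    show "?L \<subseteq> {..<n}" using L by auto
    show "\<forall>z\<in>{..<n} - ?L. ?f z = 0"
    proof (rule ballI, rule ccontr)
      fix z assume z: "z \<in> {..<n} - ?L" "?f z \<noteq> 0"
      hence z': "z < n" "A $$ (x, z) \<noteq> 0" "B $$ (z, y) \<noteq> 0" by auto
      have "ht x \<le> ht z" "ht z \<le> ht y" "dp z \<le> dp x" "dp y \<le> dp z"
        using comm_ht_le[OF A xy(1) z'(1,2)] comm_ht_le[OF B z'(1) xy(2) z'(3)]
          comm_dp_ge[OF A xy(1) z'(1,2)] comm_dp_ge[OF B z'(1) xy(2) z'(3)] by simp_all
      hence "ht z = ht x" "sz z = sz x"
        using xy(3,4) sz_eq[OF xy(1)] sz_eq[OF xy(2)] sz_eq[OF z'(1)] by linarith+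
      hence "z = ix (sz x) (rk z) (ht x)" "rk z < mu (sz x)"
        using ix_self[OF z'(1)] rk_less[OF z'(1)] by simp_all
      thus False using z(1) by blast
    qed
  qed simp
  also have "\<dots> = (\<Sum>j<mu (sz x). ?f (ix (sz x) j (ht x)))"
  proof (rule sum.reindex_cong[OF _ refl refl], rule inj_onI)
    fix j j' assume j: "j \<in> {..<mu (sz x)}" "j' \<in> {..<mu (sz x)}"
      and eq: "ix (sz x) j (ht x) = ix (sz x) j' (ht x)"
    have "j = rk (ix (sz x) j (ht x))" using L(2)[of j] j by simp
    also have "\<dots> = j'" unfolding eq using L(2)[of j'] j by simp
    finally show "j = j'" .
  qed
  finally show ?thesis .
qed

text \<open>The image of \<open>A\<close> in the i-th matrix algebra of the commutant modulo its
  radical, read off on the socles; by \<open>comm_layer\<close> every other height gives the same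
  matrix.\<close>

definition layer_mat :: "nat \<Rightarrow> 'a::comm_ring_1 mat \<Rightarrow> 'a mat" where
  "layer_mat i A = mat (mu i) (mu i) (\<lambda>(j, j'). A $$ (ix i j 0, ix i j' 0))"

lemma layer_mat_carrier [simp]: "layer_mat i A \<in> carrier_mat (mu i) (mu i)"
  by (simp add: layer_mat_def)

lemma layer_mat_index:
  fixes A :: "'a::comm_ring_1 mat"
  assumes "A \<in> commutant" "x < n" "y < n" "sz x = sz y" "ht x = ht y"
  shows "layer_mat (sz x) A $$ (rk x, rk y) = A $$ (x, y)"
  unfolding comm_layer[OF assms]
  using rk_less[OF assms(2)] rk_less[OF assms(3)] assms(4) by (simp add: layer_mat_def)

lemma layer_mat_mult:
  fixes A B :: "'a::comm_ring_1 mat"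
  assumes A: "A \<in> commutant" and B: "B \<in> commutant" and i: "0 < i"
  shows "layer_mat i (A * B) = layer_mat i A * layer_mat i B"
proof (rule eq_matI)
  fix j j' assume "j < dim_row (layer_mat i A * layer_mat i B)" "j' < dim_col (layer_mat i A * layer_mat i B)"
  hence j: "j < mu i" "j' < mu i" by (simp_all add: layer_mat_def)
  note x = ix[OF j(1) i] and y = ix[OF j(2) i]
  have "(layer_mat i A * layer_mat i B) $$ (j, j') =
      (\<Sum>l<mu i. layer_mat i A $$ (j, l) * layer_mat i B $$ (l, j'))"
    by (rule mult_index[OF layer_mat_carrier layer_mat_carrier j])
  also have "\<dots> = (\<Sum>l<mu i. A $$ (ix i j 0, ix i l 0) * B $$ (ix i l 0, ix i j' 0))"
    by (rule sum.cong) (use j in \<open>simp_all add: layer_mat_def\<close>)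
  also have "\<dots> = (A * B) $$ (ix i j 0, ix i j' 0)"
    using layer_mult[OF A B, of "ix i j 0" "ix i j' 0"] x y by simp
  finally show "layer_mat i (A * B) $$ (j, j') = (layer_mat i A * layer_mat i B) $$ (j, j')"
    using j by (simp add: layer_mat_def)
qed (simp_all add: layer_mat_def)

lemma layer_mat_pow:
  fixes A :: "'a::comm_ring_1 mat"
  assumes A: "A \<in> commutant" and i: "0 < i"
  shows "layer_mat i (A ^\<^sub>m k) = layer_mat i A ^\<^sub>m k"
proof (induct k)
  case 0
  have "layer_mat i (1\<^sub>m n :: 'a mat) = 1\<^sub>m (mu i)"
  proof (rule eq_matI)
    fix j j' assume "j < dim_row (1\<^sub>m (mu i) :: 'a mat)" "j' < dim_col (1\<^sub>m (mu i) :: 'a mat)"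
    hence j: "j < mu i" "j' < mu i" by simp_all
    have "j = j'" if "ix i j 0 = ix i j' 0"
      using arg_cong[OF that, of rk] ix[OF j(1) i] ix[OF j(2) i] by (simp only:)
    hence "ix i j 0 = ix i j' 0 \<longleftrightarrow> j = j'" by blast
    thus "layer_mat i (1\<^sub>m n :: 'a mat) $$ (j, j') = 1\<^sub>m (mu i) $$ (j, j')"
      using j ix[OF j(1) i] ix[OF j(2) i] by (simp add: layer_mat_def)
  qed (simp_all add: layer_mat_def)
  moreover have "dim_row (layer_mat i A) = mu i" by (simp add: layer_mat_def)
  ultimately show ?case using comm_carrier[OF A] by simp
next
  case (Suc k)
  thus ?case using layer_mat_mult[OF comm_pow[OF A, of k] A i] by simp
qed

text \<open>The commuting matrix with prescribed images in these matrix algebras and no entries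
  between different layers; it serves to lift conjugations to the commutant.\<close>

definition lift_layers :: "(nat \<Rightarrow> 'a::comm_ring_1 mat) \<Rightarrow> 'a mat" where
  "lift_layers G = mat n n (\<lambda>(x, y). if sz x = sz y \<and> ht x = ht y then G (sz x) $$ (rk x, rk y) else 0)"

lemma lift_layers_comm: "lift_layers G \<in> commutant"
proof (rule commI)
  fix x y assume xy: "x < n" "y < n"
  show "(if ht y = 0 then 0 else lift_layers G $$ (x, dn y)) =
      (if Suc (ht x) < sz x then lift_layers G $$ (up x, y) else 0)"
    using xy dn[OF xy(2)] up[OF xy(1)] ht_less[OF xy(2)] by (auto simp: lift_layers_def)
qed (simp add: lift_layers_def)

lemma lift_layers_mult_one:
  fixes G H :: "nat \<Rightarrow> 'a::comm_ring_1 mat"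
  assumes "\<And>i. 0 < i \<Longrightarrow> G i \<in> carrier_mat (mu i) (mu i)" "\<And>i. 0 < i \<Longrightarrow> H i \<in> carrier_mat (mu i) (mu i)"
    and "\<And>i. 0 < i \<Longrightarrow> G i * H i = 1\<^sub>m (mu i)"
  shows "lift_layers G * lift_layers H = 1\<^sub>m n"
proof (rule eq_matI)
  fix x y assume "x < dim_row (1\<^sub>m n :: 'a mat)" "y < dim_col (1\<^sub>m n :: 'a mat)"
  hence xy: "x < n" "y < n" by simp_all
  let ?P = "lift_layers G * lift_layers H"
  have c: "lift_layers G \<in> carrier_mat n n" "lift_layers H \<in> carrier_mat n n"
    by (simp_all add: lift_layers_def)
  have i: "0 < sz x" using ht_less[OF xy(1)] by simp
  show "?P $$ (x, y) = 1\<^sub>m n $$ (x, y)"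
  proof (cases "sz x = sz y \<and> ht x = ht y")
    case True
    let ?i = "sz x"
    have r: "rk x < mu ?i" "rk y < mu ?i" using rk_less[OF xy(1)] rk_less[OF xy(2)] True by simp_all
    have "?P $$ (x, y) = (\<Sum>j<mu ?i. lift_layers G $$ (x, ix ?i j (ht x)) * lift_layers H $$ (ix ?i j (ht x), y))"
      by (rule layer_mult[OF lift_layers_comm lift_layers_comm xy]) (use True in auto)
    also have "\<dots> = (\<Sum>j<mu ?i. G ?i $$ (rk x, j) * H ?i $$ (j, rk y))"
    proof (rule sum.cong)
      fix j assume "j \<in> {..<mu ?i}"
      hence "ix ?i j (ht x) < n \<and> sz (ix ?i j (ht x)) = ?i \<and> rk (ix ?i j (ht x)) = j \<and> ht (ix ?i j (ht x)) = ht x"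
        using ix[OF _ ht_less[OF xy(1)], of j] by simp
      thus "lift_layers G $$ (x, ix ?i j (ht x)) * lift_layers H $$ (ix ?i j (ht x), y) =
          G ?i $$ (rk x, j) * H ?i $$ (j, rk y)"
        using xy True by (simp add: lift_layers_def)
    qed simp
    also have "\<dots> = (G ?i * H ?i) $$ (rk x, rk y)"
      by (rule mult_index[symmetric, OF assms(1,2)[OF i] r])
    also have "\<dots> = (if rk x = rk y then 1 else 0)" unfolding assms(3)[OF i] using r by simp
    also have "\<dots> = 1\<^sub>m n $$ (x, y)"
      using xy True index_eqI[OF xy] by auto
    finally show ?thesis .
  next
    case False
    have "?P $$ (x, y) = 0"
    proof (rule ccontr)
      assume "?P $$ (x, y) \<noteq> 0"
      then obtain z where "z < n" "lift_layers G $$ (x, z) \<noteq> 0" "lift_layers H $$ (z, y) \<noteq> 0"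
        by (rule mult_index_neq_0[OF c xy])
      thus False using False xy by (auto simp: lift_layers_def split: if_splits)
    qed
    thus ?thesis using False xy by auto
  qed
qed (simp_all add: lift_layers_def)

text \<open>Each \<open>layer_mat i A\<close> is nilpotent, hence conjugate to strictly lower
  triangular form; lifting all these conjugations at once treats every layer. Entries between
  different layers only have to respect commutation.\<close>

lemma nilpotent_conj_adapted:
  fixes A :: "'a::field mat"
  assumes A: "A \<in> commutant" "A ^\<^sub>m k = 0\<^sub>m n n"
  obtains g h where "g \<in> commutant" "h \<in> commutant" "g * h = 1\<^sub>m n" "h * g = 1\<^sub>m n" "g * A * h \<in> adapted"
proof -
  define P where "P i G H \<longleftrightarrow> G \<in> carrier_mat (mu i) (mu i) \<and> H \<in> carrier_mat (mu i) (mu i) \<and>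
    G * H = 1\<^sub>m (mu i) \<and> H * G = 1\<^sub>m (mu i) \<and>
    (\<forall>j<mu i. \<forall>j'<mu i. (G * layer_mat i A * H) $$ (j, j') \<noteq> 0 \<longrightarrow> j' < j)" for i G H
  have ex: "\<exists>G H. P i G H" if i: "0 < i" for i
    unfolding P_def
  proof (rule nilpotent_conj_strict_lower[OF layer_mat_carrier])
    have "layer_mat i (0\<^sub>m n n) = (0\<^sub>m (mu i) (mu i) :: 'a mat)"
    proof (rule eq_matI)
      fix j j' assume "j < dim_row (0\<^sub>m (mu i) (mu i) :: 'a mat)" "j' < dim_col (0\<^sub>m (mu i) (mu i) :: 'a mat)"
      hence j: "j < mu i" "j' < mu i" by simp_all
      thus "layer_mat i (0\<^sub>m n n) $$ (j, j') = (0\<^sub>m (mu i) (mu i) :: 'a mat) $$ (j, j')"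
        using ix[OF j(1) i] ix[OF j(2) i] by (simp add: layer_mat_def)
    qed (simp_all add: layer_mat_def)
    thus "layer_mat i A ^\<^sub>m k = 0\<^sub>m (mu i) (mu i)"
      using layer_mat_pow[OF A(1) i, of k] A(2) by simp
  qed
  define G where "G i = (SOME G. \<exists>H. P i G H)" for i
  define H where "H i = (SOME H. P i (G i) H)" for i
  have "P i (G i) (H i)" if "0 < i" for i
  proof -
    have "\<exists>H. P i (G i) H" unfolding G_def by (rule someI_ex[OF ex[OF that]])
    thus ?thesis unfolding H_def by (rule someI_ex)
  qed
  hence GH: "G i \<in> carrier_mat (mu i) (mu i)" "H i \<in> carrier_mat (mu i) (mu i)"
    "G i * H i = 1\<^sub>m (mu i)" "H i * G i = 1\<^sub>m (mu i)"
    "j < mu i \<Longrightarrow> j' < mu i \<Longrightarrow> (G i * layer_mat i A * H i) $$ (j, j') \<noteq> 0 \<Longrightarrow> j' < j"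
    if "0 < i" for i j j' using that unfolding P_def by blast+
  define g where "g = lift_layers G"
  define h where "h = lift_layers H"
  have gh: "g \<in> commutant" "h \<in> commutant" by (simp_all add: g_def h_def lift_layers_comm)
  have layer: "layer_mat i (lift_layers K) = K i" if "0 < i" "K i \<in> carrier_mat (mu i) (mu i)"
    for i and K :: "nat \<Rightarrow> 'a mat"
  proof (rule eq_matI)
    fix j j' assume "j < dim_row (K i)" "j' < dim_col (K i)"
    hence j: "j < mu i" "j' < mu i" using that by simp_all
    thus "layer_mat i (lift_layers K) $$ (j, j') = K i $$ (j, j')"
      using ix[OF j(1) that(1)] ix[OF j(2) that(1)] by (simp add: layer_mat_def lift_layers_def)
  qed (use that in \<open>simp_all add: layer_mat_def\<close>)
  have "rk y < rk x" if xy: "x < n" "y < n" "sz x = sz y" "ht x = ht y" "(g * A * h) $$ (x, y) \<noteq> 0" for x y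
  proof -
    let ?i = "sz x"
    have i: "0 < ?i" using ht_less[OF xy(1)] by simp
    have gA: "g * A \<in> commutant" and gAh: "g * A * h \<in> commutant" using gh A(1) comm_mult by blast+
    have "layer_mat ?i (g * A * h) = G ?i * layer_mat ?i A * H ?i"
      unfolding layer_mat_mult[OF gA gh(2) i] layer_mat_mult[OF gh(1) A(1) i]
      unfolding g_def h_def layer[of ?i G, OF i GH(1)[OF i]] layer[of ?i H, OF i GH(2)[OF i]] ..
    hence "(G ?i * layer_mat ?i A * H ?i) $$ (rk x, rk y) \<noteq> 0"
      using layer_mat_index[OF gAh xy(1-4)] xy(5) by simp
    moreover have "rk y < mu ?i" using rk_less[OF xy(2)] xy(3) by simp
    ultimately show ?thesis using GH(5)[OF i rk_less[OF xy(1)]] by blast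
  qed
  hence "g * A * h \<in> adapted" using gh A(1) comm_mult unfolding adapted_def by blast
  moreover have "g * h = 1\<^sub>m n" "h * g = 1\<^sub>m n"
    unfolding g_def h_def
    by (rule lift_layers_mult_one; rule GH; assumption)+
  ultimately show thesis by (intro that[OF gh])
qed

text \<open>The heights and depths \<open>(2, s - 3)\<close>, \<open>(1, q - 2)\<close>, \<open>(0, p - 1)\<close> form an antichain.  The span of
  their down-set is mapped by \<open>A\<close> into the span of its non-maximal part, so the kernel has dimension at
  least 3 and meets the kernels of any two functionals.\<close>

lemma kernel_of_three_separated_sizes:
  fixes A :: "'a::field mat" and f g :: "nat \<Rightarrow> 'a"
  assumes A: "A \<in> adapted"
    and s: "0 < p" "p + 2 \<le> q" "q + 2 \<le> s" and mu: "0 < mu p" "0 < mu q" "0 < mu s"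
  shows "\<exists>v\<in>carrier_vec n. v \<noteq> 0\<^sub>v n \<and> A *\<^sub>v v = 0\<^sub>v n \<and>
    (\<Sum>x<n. f x * v $ x) = 0 \<and> (\<Sum>x<n. g x * v $ x) = 0"
proof -
  define x1 where "x1 = ix s 0 2"
  define x2 where "x2 = ix q 0 1"
  define x3 where "x3 = ix p 0 0"
  have x1: "x1 < n" "sz x1 = s" "rk x1 = 0" "ht x1 = 2" using ix[OF mu(3), of 2] s by (simp_all add: x1_def)
  have x2: "x2 < n" "sz x2 = q" "rk x2 = 0" "ht x2 = 1" using ix[OF mu(2), of 1] s by (simp_all add: x2_def)
  have x3: "x3 < n" "sz x3 = p" "rk x3 = 0" "ht x3 = 0" using ix[OF mu(1), of 0] s by (simp_all add: x3_def)
  \<comment> \<open>The gaps of 2 between the sizes make the depths grow with the heights, so none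
    of the three vectors lies below another.\<close>
  have d: "dp x1 = s - 3" "dp x2 = q - 2" "dp x3 = p - 1" using x1 x2 x3 by (simp_all add: dp_def)
  have ne: "x1 \<noteq> x2" "x1 \<noteq> x3" "x2 \<noteq> x3" using x1(4) x2(4) x3(4) by auto
  define D where "D = {x. x < n \<and> (ht x \<le> 2 \<and> s - 3 \<le> dp x \<or> ht x \<le> 1 \<and> q - 2 \<le> dp x \<or> ht x \<le> 0 \<and> p - 1 \<le> dp x)}"
  note Ac = adapted_comm[OF A] and A_carr = adapted_carrier[OF A]
  have closed: "A $$ (x, y) = 0" if "x < n" "x \<notin> D" "y \<in> D" for x y
  proof (rule ccontr)
    assume a: "A $$ (x, y) \<noteq> 0"
    have y: "y < n" using that by (simp add: D_def)
    have "ht x \<le> ht y" "dp y \<le> dp x" using comm_ht_le[OF Ac that(1) y a] comm_dp_ge[OF Ac that(1) y a] .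
    thus False using that unfolding D_def by auto
  qed
  \<comment> \<open>By the antichain property a nonzero entry from \<open>D\<close> into one of the
    three vectors stays in its layer, where the row must have larger rank than the column; but the
    rank of the row is 0.\<close>
  have top: "A $$ (x, y) = 0" if x: "x = x1 \<or> x = x2 \<or> x = x3" and y: "y \<in> D" for x y
  proof (rule ccontr)
    assume a: "A $$ (x, y) \<noteq> 0"
    have xn: "x < n" "rk x = 0" using x x1 x2 x3 by auto
    have y': "y < n" using y by (simp add: D_def)
    have 1: "ht x \<le> ht y" "dp y \<le> dp x" using comm_ht_le[OF Ac xn(1) y' a] comm_dp_ge[OF Ac xn(1) y' a] .
    have 2: "ht y \<le> 2 \<and> s - 3 \<le> dp y \<or> ht y \<le> 1 \<and> q - 2 \<le> dp y \<or> ht y \<le> 0 \<and> p - 1 \<le> dp y"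
      using y by (simp add: D_def)
    have "ht x = ht y \<and> dp x = dp y"
      using x
    proof (elim disjE)
      assume "x = x1"
      thus ?thesis using 1 2 s x1 d by auto
    next
      assume "x = x2"
      thus ?thesis using 1 2 s x2 d by auto
    next
      assume "x = x3"
      thus ?thesis using 1 2 s x3 d by auto
    qed
    hence "sz x = sz y" "ht x = ht y" using sz_eq[OF xn(1)] sz_eq[OF y'] by simp_all
    hence "rk y < rk x" using A a xn(1) y' unfolding adapted_def by blast
    thus False using xn(2) by simp
  qed
  \<comment> \<open>One singular square matrix encodes all conditions: the unit rows outside
    \<open>D\<close> force the support of \<open>v\<close> into \<open>D\<close>, the rows of
    \<open>A\<close> inside \<open>D\<close> are kept, and the three rows of \<open>A\<close> that
    vanish on \<open>D\<close> make room for \<open>f\<close>, \<open>g\<close> and a zero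
    row.\<close>
  define M where "M = mat n n (\<lambda>(x, y). if x = x1 then f y else if x = x2 then g y else if x = x3 then 0
    else if x \<in> D then A $$ (x, y) else if x = y then 1 else 0)"
  have M: "M \<in> carrier_mat n n" by (simp add: M_def)
  have "transpose_mat M *\<^sub>v unit_vec n x3 = 0\<^sub>v n"
  proof (rule eq_vecI)
    fix i assume "i < dim_vec (0\<^sub>v n :: 'a vec)"
    hence i: "i < n" by simp
    have "(transpose_mat M *\<^sub>v unit_vec n x3) $ i = M $$ (x3, i)" using M i x3(1) by simp
    thus "(transpose_mat M *\<^sub>v unit_vec n x3) $ i = 0\<^sub>v n $ i" using i x3(1) ne by (simp add: M_def)
  qed (use M in simp)
  moreover have "unit_vec n x3 \<noteq> (0\<^sub>v n :: 'a vec)" using x3(1) by simp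
  ultimately have "det (transpose_mat M) = 0"
    using det_0_iff_vec_prod_zero[of "transpose_mat M" n] M by (metis transpose_carrier_mat unit_vec_carrier)
  hence "det M = 0" using det_transpose[OF M] by simp
  then obtain v where v: "v \<in> carrier_vec n" "v \<noteq> 0\<^sub>v n" "M *\<^sub>v v = 0\<^sub>v n"
    using det_0_iff_vec_prod_zero[OF M] by blast
  have row: "(\<Sum>y<n. M $$ (x, y) * v $ y) = 0" if x: "x < n" for x
  proof -
    have "(M *\<^sub>v v) $ x = (\<Sum>y<n. M $$ (x, y) * v $ y)"
      using x M v(1) by (simp add: scalar_prod_def lessThan_atLeast0)
    thus ?thesis using v(3) x by simp
  qed
  have f0: "(\<Sum>x<n. f x * v $ x) = 0" using row[OF x1(1)] x1(1) by (simp add: M_def)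
  have g0: "(\<Sum>x<n. g x * v $ x) = 0" using row[OF x2(1)] x2(1) ne by (simp add: M_def)
  have supp: "v $ x = 0" if x: "x < n" "x \<notin> D" for x
  proof -
    have "x1 \<in> D" "x2 \<in> D" "x3 \<in> D" using x1 x2 x3 d by (simp_all add: D_def)
    hence "x \<noteq> x1" "x \<noteq> x2" "x \<noteq> x3" using x by blast+
    hence "(\<Sum>y<n. M $$ (x, y) * v $ y) = (\<Sum>y<n. if y = x then v $ y else 0)"
      by (intro sum.cong) (use x in \<open>auto simp: M_def\<close>)
    thus ?thesis using row[OF x(1)] x(1) by simp
  qed
  have "A *\<^sub>v v = 0\<^sub>v n"
  proof (rule eq_vecI)
    fix x assume "x < dim_vec (0\<^sub>v n :: 'a vec)"
    hence x: "x < n" by simp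
    have "(A *\<^sub>v v) $ x = (\<Sum>y<n. A $$ (x, y) * v $ y)"
      using x A_carr v(1) by (simp add: scalar_prod_def lessThan_atLeast0)
    also have "\<dots> = 0"
    proof (cases "x \<in> D \<and> x \<noteq> x1 \<and> x \<noteq> x2 \<and> x \<noteq> x3")
      case True
      thus ?thesis using row[OF x] x by (simp add: M_def)
    next
      case False
      show ?thesis
      proof (rule sum.neutral, rule ballI)
        fix y assume "y \<in> {..<n}"
        hence y: "y < n" by simp
        have "A $$ (x, y) = 0" if "y \<in> D"
          using closed[OF x _ that] top[OF _ that, of x] False by blast
        thus "A $$ (x, y) * v $ y = 0" using supp[OF y] by (cases "y \<in> D") simp_all
      qed
    qed
    finally show "(A *\<^sub>v v) $ x = 0\<^sub>v n $ x" using x by simp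
  qed (use A_carr in simp)
  thus ?thesis using v f0 g0 by blast
qed

end

section \<open>Generic elements\<close>

definition poly_fun :: "('a::comm_ring_1 \<Rightarrow> 'a) \<Rightarrow> bool" where
  "poly_fun f \<longleftrightarrow> (\<exists>p. \<forall>s. f s = poly p s)"

lemma poly_fun_const: "poly_fun (\<lambda>s. c)"
  unfolding poly_fun_def by (rule exI[of _ "[:c:]"]) simp

lemma poly_fun_id: "poly_fun (\<lambda>s. s)"
  unfolding poly_fun_def by (rule exI[of _ "[:0, 1:]"]) simp

lemma poly_fun_add: "poly_fun f \<Longrightarrow> poly_fun g \<Longrightarrow> poly_fun (\<lambda>s. f s + g s)"
  unfolding poly_fun_def by (metis poly_add)

lemma poly_fun_mult: "poly_fun f \<Longrightarrow> poly_fun g \<Longrightarrow> poly_fun (\<lambda>s. f s * g s)"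
  unfolding poly_fun_def by (metis poly_mult)

lemma poly_fun_sum:
  "finite I \<Longrightarrow> (\<And>i. i \<in> I \<Longrightarrow> poly_fun (f i)) \<Longrightarrow> poly_fun (\<lambda>s. \<Sum>i\<in>I. f i s)"
  by (induct I rule: finite_induct) (simp_all add: poly_fun_const poly_fun_add)

text \<open>The product of the two polynomials vanishes everywhere, so it is the zero polynomial
  over an infinite field. This is the density of a nonempty open subset of a line.\<close>

lemma poly_fun_mult_eq_0:
  fixes f g :: "'a::field \<Rightarrow> 'a"
  assumes inf: "infinite (UNIV :: 'a set)" and f: "poly_fun f" "f a \<noteq> 0" and g: "poly_fun g"
    and 0: "\<And>s. f s \<noteq> 0 \<Longrightarrow> g s = 0"
  shows "g s = 0"
proof -
  obtain p q where p: "\<And>s. f s = poly p s" and q: "\<And>s. g s = poly q s"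
    using f(1) g unfolding poly_fun_def by blast
  have "poly (p * q) s = 0" for s using 0[of s] by (cases "f s = 0") (simp_all add: p q)
  hence "p * q = 0" using poly_roots_finite[of "p * q"] inf by (cases "p * q = 0") simp_all
  moreover have "p \<noteq> 0" using f(2) p by auto
  ultimately show ?thesis using q by simp
qed

lemma mat_polys_poly_fun:
  assumes "f \<in> mat_polys n" and "\<And>i j. i < n \<Longrightarrow> j < n \<Longrightarrow> poly_fun (\<lambda>s. M s $$ (i, j))"
  shows "poly_fun (\<lambda>s. f (M s))"
  using assms(1) by induct (simp_all add: assms(2) poly_fun_const poly_fun_add poly_fun_mult)

lemma mult_mat_poly_fun:
  assumes "\<And>s. M s \<in> carrier_mat n n" "\<And>s. M' s \<in> carrier_mat n n"
    and "\<And>i j. i < n \<Longrightarrow> j < n \<Longrightarrow> poly_fun (\<lambda>s. M s $$ (i, j))"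
    and "\<And>i j. i < n \<Longrightarrow> j < n \<Longrightarrow> poly_fun (\<lambda>s. M' s $$ (i, j))"
    and "i < n" "j < n"
  shows "poly_fun (\<lambda>s. (M s * M' s) $$ (i, j))"
  unfolding mult_index[OF assms(1,2,5,6)]
  by (intro poly_fun_sum poly_fun_mult) (use assms in simp_all)

lemma pow_mat_poly_fun:
  assumes M: "\<And>s. M s \<in> carrier_mat n n"
    and p: "\<And>i j. i < n \<Longrightarrow> j < n \<Longrightarrow> poly_fun (\<lambda>s. M s $$ (i, j))"
  shows "i < n \<Longrightarrow> j < n \<Longrightarrow> poly_fun (\<lambda>s. (M s ^\<^sub>m k) $$ (i, j))"
proof (induct k arbitrary: i j)
  case 0
  have "(M s ^\<^sub>m 0) $$ (i, j) = (if i = j then 1 else 0)" for s using M[of s] 0 by simp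
  thus ?case by (simp add: poly_fun_const)
next
  case (Suc k)
  show ?case unfolding pow_mat.simps
    by (rule mult_mat_poly_fun[OF pow_carrier_mat[OF M] M Suc(1) p Suc(2,3)])
qed

context jordan_frame
begin

text \<open>The sum of the U-chain lengths over b \<le> N bounds all of them, the length being 0 for
  larger b, and no path is longer. Hence lines in \<open>adapted\<close> stay among the nilpotent
  matrices.\<close>

lemma adapted_nilpotent:
  fixes A :: "'a::comm_ring_1 mat"
  assumes A: "A \<in> adapted" and N: "\<And>i. N < i \<Longrightarrow> mu i = 0"
  shows "\<exists>m. A ^\<^sub>m m = 0\<^sub>m n n"
proof -
  define m where "m = (\<Sum>b\<le>N. uchain mu N b)"
  have m: "uchain mu N b \<le> m" for b
  proof (cases "b \<le> N")
    case True
    thus ?thesis unfolding m_def by (intro member_le_sum) simp_all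
  next
    case False
    thus ?thesis using N[of b] N[of "Suc b"] by (simp add: uchain_def)
  qed
  have "A ^\<^sub>m m = 0\<^sub>m n n"
  proof (rule eq_matI)
    fix x y assume "x < dim_row (0\<^sub>m n n :: 'a mat)" "y < dim_col (0\<^sub>m n n :: 'a mat)"
    hence xy: "x < n" "y < n" by simp_all
    have "(A ^\<^sub>m m) $$ (x, y) = 0"
      using adapted_pow_neq_0_imp[OF A xy _ N] m by (meson not_le)
    thus "(A ^\<^sub>m m) $$ (x, y) = 0\<^sub>m n n $$ (x, y)" using xy by simp
  qed (use adapted_carrier[OF A] in \<open>simp_all add: pow_carrier_mat\<close>)
  thus ?thesis by blast
qed

text \<open>Irreducibility of the nilpotent commutator enters only through the lines joining two
  elements of the same conjugate of the linear space \<^term>\<open>adapted\<close>.\<close>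

lemma generic_pow_0_imp_adapted_pow_0:
  fixes A B :: "'a::field mat" and U :: "'a mat set"
  assumes inf: "infinite (UNIV :: 'a set)" and N: "\<And>i. N < i \<Longrightarrow> mu i = 0"
    and U: "zariski_open_in n (nilpotent_commutator n S) U" "A \<in> U"
    and pow: "\<And>A. A \<in> U \<Longrightarrow> A ^\<^sub>m u = 0\<^sub>m n n"
    and B: "B \<in> adapted"
  shows "B ^\<^sub>m u = 0\<^sub>m n n"
proof -
  obtain F where F: "F \<subseteq> mat_polys n" "U = nilpotent_commutator n S - {A. \<forall>f\<in>F. f A = 0}"
    using U(1) unfolding zariski_open_in_def by blast
  obtain f where f: "f \<in> F" "f A \<noteq> 0" using U(2) F by blast
  have A: "A \<in> commutant" using U(2) F by (simp add: commutant_def nilpotent_commutator_def)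
  obtain m where m: "A ^\<^sub>m m = 0\<^sub>m n n" using U(2) F by (auto simp: nilpotent_commutator_def)
  obtain g h where gh: "g \<in> commutant" "h \<in> commutant" "g * h = 1\<^sub>m n" "h * g = 1\<^sub>m n" "g * A * h \<in> adapted"
    by (rule nilpotent_conj_adapted[OF A m])
  note cA = comm_carrier[OF A] and cg = comm_carrier[OF gh(1)] and ch = comm_carrier[OF gh(2)]
  define A' where "A' = g * A * h"
  have cA': "A' \<in> carrier_mat n n" and cB: "B \<in> carrier_mat n n"
    using gh(5) B adapted_carrier by (simp_all add: A'_def)
  \<comment> \<open>The line in \<open>adapted\<close> through \<open>A'\<close> at 0 and
    \<open>B\<close> at 1.\<close>
  define C where "C s = A' + s \<cdot>\<^sub>m (B + (- 1) \<cdot>\<^sub>m A')" for s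
  have C: "C s \<in> adapted" for s
    unfolding C_def A'_def using gh(5) B by (intro adapted_add_smult)
  have cC: "C s \<in> carrier_mat n n" for s by (rule adapted_carrier[OF C])
  have C_index: "C s $$ (i, j) = A' $$ (i, j) + s * (B $$ (i, j) + (- 1) * A' $$ (i, j))"
    if "i < n" "j < n" for s i j
    using that cA' cB by (simp add: C_def)
  have C_poly: "poly_fun (\<lambda>s. C s $$ (i, j))" if "i < n" "j < n" for i j
    unfolding C_index[OF that]
    by (intro poly_fun_add poly_fun_mult poly_fun_const poly_fun_id)
  have const: "poly_fun (\<lambda>s. X $$ (i, j))" for X :: "'a mat" and i j by (rule poly_fun_const)
  \<comment> \<open>Conjugating back makes the line pass through \<open>A\<close> itself, where
    \<open>f\<close> does not vanish; \<open>g\<close> and \<open>h\<close> are constant, so the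
    entries remain polynomial in s.\<close>
  define D where "D s = h * C s * g" for s
  have cD: "D s \<in> carrier_mat n n" for s
    unfolding D_def by (rule mult_carrier_mat[OF mult_carrier_mat[OF ch cC] cg])
  have D_poly: "poly_fun (\<lambda>s. D s $$ (i, j))" if "i < n" "j < n" for i j
    unfolding D_def
    by (rule mult_mat_poly_fun[OF _ cg _ const that], rule mult_carrier_mat[OF ch cC],
        rule mult_mat_poly_fun[OF ch cC const C_poly])
  have C0: "C 0 = A'" and C1: "C 1 = B"
    by (rule eq_matI; use cA' cB in \<open>simp add: C_def\<close>)+
  have sim: "similar_mat_wit (D s) (C s) h g" for s
    by (rule similar_mat_witI[OF gh(4,3) D_def cD cC ch cg])
  have D0: "D 0 = A"
  proof -
    have "similar_mat_wit A' A g h"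
      by (rule similar_mat_witI[OF gh(3,4) A'_def cA' cA cg ch])
    from similar_mat_witD2(3)[OF cA similar_mat_wit_sym[OF this]] show ?thesis by (simp add: D_def C0)
  qed
  have D_mem: "D s \<in> nilpotent_commutator n S" for s
  proof -
    have "D s \<in> commutant" unfolding D_def
      by (intro comm_mult gh(1,2) adapted_comm[OF C])
    moreover obtain k where "C s ^\<^sub>m k = 0\<^sub>m n n" using adapted_nilpotent[OF C N] by blast
    hence "D s ^\<^sub>m k = 0\<^sub>m n n" using similar_mat_wit_pow_id[OF sim, of s k] ch cg by simp
    ultimately show ?thesis by (auto simp: nilpotent_commutator_def commutant_def)
  qed
  have Cu: "C s ^\<^sub>m u = 0\<^sub>m n n" if "f (D s) \<noteq> 0" for s
  proof -
    have "D s \<in> U" using D_mem f(1) that F(2) by blast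
    hence "D s ^\<^sub>m u = 0\<^sub>m n n" by (rule pow)
    thus ?thesis using similar_mat_wit_pow_id[OF similar_mat_wit_sym[OF sim], of s u] ch cg by simp
  qed
  have fD: "poly_fun (\<lambda>s. f (D s))"
    by (rule mat_polys_poly_fun[OF subsetD[OF F(1) f(1)] D_poly])
  show ?thesis
  proof (rule eq_matI)
    fix x y assume "x < dim_row (0\<^sub>m n n :: 'a mat)" "y < dim_col (0\<^sub>m n n :: 'a mat)"
    hence xy: "x < n" "y < n" by simp_all
    have "(C 1 ^\<^sub>m u) $$ (x, y) = 0"
    proof (rule poly_fun_mult_eq_0[OF inf fD, where g = "\<lambda>s. (C s ^\<^sub>m u) $$ (x, y)"])
      show "f (D 0) \<noteq> 0" using f(2) D0 by simp
      show "poly_fun (\<lambda>s. (C s ^\<^sub>m u) $$ (x, y))" by (rule pow_mat_poly_fun[OF cC C_poly xy])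
    qed (use Cu xy in simp)
    thus "(B ^\<^sub>m u) $$ (x, y) = 0\<^sub>m n n $$ (x, y)" using xy C1 by simp
  qed (use cB in \<open>simp_all add: pow_carrier_mat\<close>)
qed

end

section \<open>Lower bound for the generic nilpotency index\<close>

text \<open>The derivative of \<open>(X + s R)\<^sup>k\<close> with respect to \<open>s\<close> at \<open>s = 0\<close>.\<close>

fun pow_deriv :: "nat \<Rightarrow> 'a::comm_ring_1 mat \<Rightarrow> 'a mat \<Rightarrow> nat \<Rightarrow> 'a mat" where
  "pow_deriv n X R 0 = 0\<^sub>m n n"
| "pow_deriv n X R (Suc k) = X * pow_deriv n X R k + R * X ^\<^sub>m k"

lemma pow_deriv_carrier:
  "X \<in> carrier_mat n n \<Longrightarrow> R \<in> carrier_mat n n \<Longrightarrow> pow_deriv n X R k \<in> carrier_mat n n"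
  by (induct k) (simp_all add: pow_carrier_mat)

lemma pow_deriv_Suc_index:
  assumes X: "X \<in> carrier_mat n n" and R: "R \<in> carrier_mat n n" and xy: "x < n" "y < n"
  shows "pow_deriv n X R (Suc k) $$ (x, y) =
    (\<Sum>z<n. X $$ (x, z) * pow_deriv n X R k $$ (z, y)) + (\<Sum>z<n. R $$ (x, z) * (X ^\<^sub>m k) $$ (z, y))"
proof -
  have c: "pow_deriv n X R k \<in> carrier_mat n n" "X ^\<^sub>m k \<in> carrier_mat n n"
    using pow_deriv_carrier[OF X R] pow_carrier_mat[OF X] by simp_all
  have "pow_deriv n X R (Suc k) $$ (x, y) = (X * pow_deriv n X R k) $$ (x, y) + (R * X ^\<^sub>m k) $$ (x, y)"
    using X R xy c by simp
  thus ?thesis by (simp only: mult_index[OF X c(1) xy] mult_index[OF R c(2) xy])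
qed

lemma pow_add_smult_expand:
  fixes X R :: "'a::comm_ring_1 mat"
  assumes X: "X \<in> carrier_mat n n" and R: "R \<in> carrier_mat n n"
  shows "\<exists>q. (\<forall>x y. poly_fun (q x y)) \<and> (\<forall>x<n. \<forall>y<n. \<forall>s. ((X + s \<cdot>\<^sub>m R) ^\<^sub>m k) $$ (x, y) =
    (X ^\<^sub>m k) $$ (x, y) + s * pow_deriv n X R k $$ (x, y) + s * s * q x y s)"
proof (induct k)
  case 0
  show ?case using X R by (intro exI[of _ "\<lambda>x y s. 0"]) (simp add: poly_fun_const)
next
  case (Suc k)
  then obtain q where q: "\<And>x y. poly_fun (q x y)"
    "\<And>x y s. x < n \<Longrightarrow> y < n \<Longrightarrow> ((X + s \<cdot>\<^sub>m R) ^\<^sub>m k) $$ (x, y) =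
      (X ^\<^sub>m k) $$ (x, y) + s * pow_deriv n X R k $$ (x, y) + s * s * q x y s" by blast
  \<comment> \<open>The second-order remainder has two sources: \<open>X\<close> times the old
    remainder, and \<open>R\<close> times the old terms of order at least 1.\<close>
  let ?q = "\<lambda>x y s. (\<Sum>z<n. X $$ (x, z) * q z y s) + ((\<Sum>z<n. R $$ (x, z) * pow_deriv n X R k $$ (z, y))
    + s * (\<Sum>z<n. R $$ (x, z) * q z y s))"
  have "poly_fun (?q x y)" for x y
    by (intro poly_fun_add poly_fun_sum poly_fun_mult poly_fun_const poly_fun_id q) simp_all
  moreover have "((X + s \<cdot>\<^sub>m R) ^\<^sub>m Suc k) $$ (x, y) =
    (X ^\<^sub>m Suc k) $$ (x, y) + s * pow_deriv n X R (Suc k) $$ (x, y) + s * s * ?q x y s"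
    if xy: "x < n" "y < n" for x y s
  proof -
    have c: "X + s \<cdot>\<^sub>m R \<in> carrier_mat n n" using X R by simp
    have "((X + s \<cdot>\<^sub>m R) ^\<^sub>m Suc k) $$ (x, y) =
        (\<Sum>z<n. (X + s \<cdot>\<^sub>m R) $$ (x, z) * ((X + s \<cdot>\<^sub>m R) ^\<^sub>m k) $$ (z, y))"
      unfolding pow_mat_Suc_left[OF c] by (rule mult_index[OF c pow_carrier_mat[OF c] xy])
    also have "\<dots> = (\<Sum>z<n. X $$ (x, z) * (X ^\<^sub>m k) $$ (z, y)
        + s * (X $$ (x, z) * pow_deriv n X R k $$ (z, y)) + s * (R $$ (x, z) * (X ^\<^sub>m k) $$ (z, y))
        + s * s * (X $$ (x, z) * q z y s) + s * s * (R $$ (x, z) * pow_deriv n X R k $$ (z, y))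
        + s * s * s * (R $$ (x, z) * q z y s))"
    proof (rule sum.cong)
      fix z assume "z \<in> {..<n}"
      hence z: "z < n" by simp
      have e: "(X + s \<cdot>\<^sub>m R) $$ (x, z) = X $$ (x, z) + s * R $$ (x, z)" using X R xy z by simp
      show "(X + s \<cdot>\<^sub>m R) $$ (x, z) * ((X + s \<cdot>\<^sub>m R) ^\<^sub>m k) $$ (z, y) = X $$ (x, z) * (X ^\<^sub>m k) $$ (z, y)
        + s * (X $$ (x, z) * pow_deriv n X R k $$ (z, y)) + s * (R $$ (x, z) * (X ^\<^sub>m k) $$ (z, y))
        + s * s * (X $$ (x, z) * q z y s) + s * s * (R $$ (x, z) * pow_deriv n X R k $$ (z, y))
        + s * s * s * (R $$ (x, z) * q z y s)"
        unfolding q(2)[OF z xy(2)] e by (simp add: algebra_simps)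
    qed simp
    also have "\<dots> = (\<Sum>z<n. X $$ (x, z) * (X ^\<^sub>m k) $$ (z, y))
        + s * ((\<Sum>z<n. X $$ (x, z) * pow_deriv n X R k $$ (z, y)) + (\<Sum>z<n. R $$ (x, z) * (X ^\<^sub>m k) $$ (z, y)))
        + s * s * ?q x y s"
      by (simp add: sum.distrib sum_distrib_left[symmetric] algebra_simps)
    also have "(\<Sum>z<n. X $$ (x, z) * (X ^\<^sub>m k) $$ (z, y)) = (X ^\<^sub>m Suc k) $$ (x, y)"
      unfolding pow_mat_Suc_left[OF X] by (rule mult_index[OF X pow_carrier_mat[OF X] xy, symmetric])
    finally show ?thesis unfolding pow_deriv_Suc_index[OF X R xy] .
  qed
  ultimately show ?case by (intro exI[of _ ?q]) blast
qed

text \<open>The entry is a polynomial in s whose linear coefficient is nonzero, so over an infinite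
  field some s keeps it from vanishing, whatever the other coefficients are.\<close>

lemma exists_pow_add_smult_neq_0:
  fixes X R :: "'a::field mat"
  assumes inf: "infinite (UNIV :: 'a set)"
    and X: "X \<in> carrier_mat n n" and R: "R \<in> carrier_mat n n" and xy: "x < n" "y < n"
    and d: "pow_deriv n X R k $$ (x, y) \<noteq> 0"
  shows "\<exists>s. ((X + s \<cdot>\<^sub>m R) ^\<^sub>m k) $$ (x, y) \<noteq> 0"
proof (rule ccontr)
  assume a: "\<not> ?thesis"
  from pow_add_smult_expand[OF X R, of k]
  obtain q where "\<forall>x y. poly_fun (q x y)" "\<forall>x<n. \<forall>y<n. \<forall>s. ((X + s \<cdot>\<^sub>m R) ^\<^sub>m k) $$ (x, y) =
      (X ^\<^sub>m k) $$ (x, y) + s * pow_deriv n X R k $$ (x, y) + s * s * q x y s" by (elim exE conjE)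
  hence q: "poly_fun (q x y)" "((X + s \<cdot>\<^sub>m R) ^\<^sub>m k) $$ (x, y) =
      (X ^\<^sub>m k) $$ (x, y) + s * pow_deriv n X R k $$ (x, y) + s * s * q x y s" for s
    using xy by simp_all
  obtain p where p: "\<And>s. q x y s = poly p s" using q(1) unfolding poly_fun_def by blast
  let ?p = "pCons ((X ^\<^sub>m k) $$ (x, y)) (pCons (pow_deriv n X R k $$ (x, y)) p)"
  have "poly ?p s = 0" for s
  proof -
    have "((X + s \<cdot>\<^sub>m R) ^\<^sub>m k) $$ (x, y) = 0" using a by blast
    hence "(X ^\<^sub>m k) $$ (x, y) + s * pow_deriv n X R k $$ (x, y) + s * s * poly p s = 0"
      using q(2)[of s] p[of s] by (simp only:)
    moreover have "poly ?p s = (X ^\<^sub>m k) $$ (x, y) + s * pow_deriv n X R k $$ (x, y) + s * s * poly p s"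
      by (simp add: distrib_left mult.assoc add.assoc)
    ultimately show ?thesis by (simp only:)
  qed
  hence all: "{s. poly ?p s = 0} = UNIV" by blast
  have "?p = 0"
  proof (rule ccontr)
    assume "?p \<noteq> 0"
    from poly_roots_finite[OF this] show False unfolding all using inf by blast
  qed
  thus False using d by simp
qed

section \<open>An adapted matrix realizing a given U-chain\<close>

context jordan_frame
begin

lemma dp_up: "x < n \<Longrightarrow> Suc (ht x) < sz x \<Longrightarrow> dp (up x) = dp x - 1"
  by (simp add: dp_def up)

lemma dp_dn: "x < n \<Longrightarrow> 0 < ht x \<Longrightarrow> dp (dn x) = Suc (dp x)"
  using ht_less[of x] by (simp add: dp_def dn)

lemma dp_pos_iff: "x < n \<Longrightarrow> Suc (ht x) < sz x \<longleftrightarrow> 0 < dp x"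
  by (auto simp: dp_def)

lemma index_eqI':
  assumes "x < n" "y < n" "sz x = sz y" "rk x = rk y" "dp x = dp y"
  shows "x = y"
  by (rule index_eqI[OF assms(1-4)]) (use sz_eq[OF assms(1)] sz_eq[OF assms(2)] assms in linarith)

text \<open>The blocks of sizes \<open>a\<close> and \<open>a + 1\<close> are permuted cyclically; \<open>p z\<close> is the position of the basis
  vector \<open>z\<close> on the resulting single chain.\<close>

lemma cyclic_chain:
  assumes a: "0 < a" and w: "0 < mu a + mu (Suc a)"
  defines "m \<equiv> a * mu a + Suc a * mu (Suc a)"
  shows "\<exists>T\<in>adapted. \<exists>x<n. \<exists>y<n. ht x = 0 \<and> dp y = 0 \<and> sz x \<le> Suc a \<and> sz y \<le> Suc a \<and>
    (\<forall>x<n. \<forall>y<n. T $$ (x, y) \<noteq> 0 \<longrightarrow> sz x \<le> Suc a \<and> sz y \<le> Suc a) \<and>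
    (T ^\<^sub>m (m - 1)) $$ (x, y) \<noteq> (0 :: 'a::comm_ring_1)"
proof -
  define w where "w = mu a + mu (Suc a)"
  define G where "G z \<longleftrightarrow> z < n \<and> (sz z = a \<or> sz z = Suc a)" for z
  \<comment> \<open>One round of the chain visits the blocks of size a + 1 and then those of size a;
    round number d passes through the vectors of depth d.\<close>
  define e where "e z = (if sz z = Suc a then rk z else mu (Suc a) + rk z)" for z
  define p where "p z = dp z * w + e z" for z
  have w0: "0 < w" using w by (simp add: w_def)
  have e: "e z < w" if "G z" for z
    using that rk_less[of z] by (auto simp: G_def e_def w_def)
  have m: "m = a * w + mu (Suc a)" by (simp add: m_def w_def algebra_simps)
  have p_less: "p z < m" if "G z" for z
  proof (cases "sz z = Suc a")
    case True
    hence "dp z \<le> a" "rk z < mu (Suc a)" using that rk_less[of z] by (auto simp: G_def dp_def)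
    hence "dp z * w + rk z < a * w + mu (Suc a)" by (intro add_le_less_mono mult_le_mono1)
    thus ?thesis using True by (simp add: p_def e_def m)
  next
    case False
    hence "Suc (dp z) \<le> a" using that a by (auto simp: G_def dp_def)
    hence "Suc (dp z) * w \<le> a * w" by (rule mult_le_mono1)
    thus ?thesis using e[OF that] by (simp add: p_def m)
  qed
  \<comment> \<open>Socle vectors lie in the last w positions, so a shift by w leaves the
    chain.\<close>
  have p_end: "m \<le> p z + w" if "G z" "ht z = 0" for z
  proof (cases "sz z = Suc a")
    case True
    hence "dp z = a" using that by (simp add: dp_def)
    thus ?thesis by (simp add: p_def m w_def)
  next
    case False
    hence *: "Suc (dp z) = a" and ez: "e z = mu (Suc a) + rk z" using that a by (auto simp: G_def dp_def e_def)
    have "a * w = dp z * w + w" unfolding *[symmetric] by simp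
    thus ?thesis using ez by (simp add: p_def m)
  qed
  have p_inj: "z = z'" if "G z" "G z'" "p z = p z'" for z z'
  proof -
    have pd: "p u div w = dp u" "p u mod w = e u" if "G u" for u
      using e[OF that] w0 by (simp_all add: p_def)
    have dp: "dp z = dp z'"
      unfolding pd(1)[OF that(1), symmetric] pd(1)[OF that(2), symmetric] that(3) ..
    have ee: "e z = e z'"
      unfolding pd(2)[OF that(1), symmetric] pd(2)[OF that(2), symmetric] that(3) ..
    have e_iff: "e u < mu (Suc a) \<longleftrightarrow> sz u = Suc a" if "G u" for u
      using that rk_less[of u] by (cases "sz u = Suc a") (simp_all add: G_def e_def)
    have "sz z = Suc a \<longleftrightarrow> sz z' = Suc a" using e_iff[OF that(1)] e_iff[OF that(2)] ee by (simp only:)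
    hence "sz z = sz z'" using that(1,2) unfolding G_def by metis
    moreover have "rk z = rk z'" using ee calculation unfolding e_def by (simp split: if_splits)
    ultimately show ?thesis using that(1,2) dp index_eqI' unfolding G_def by blast
  qed
  have p_surj: "\<exists>z. G z \<and> p z = j" if j: "j < m" for j
  proof -
    define d where "d = j div w"
    define r where "r = j mod w"
    have jdr: "j = d * w + r" and r: "r < w" using w0 by (simp_all add: d_def r_def)
    show ?thesis
    proof (cases "r < mu (Suc a)")
      case True
      have "d * w < Suc a * w" using j jdr True m w_def by simp
      hence d: "d \<le> a" unfolding mult_less_cancel2 by simp
      note z = ix[OF True, of "a - d"]
      show ?thesis
        by (rule exI[of _ "ix (Suc a) r (a - d)"])
           (use z d jdr in \<open>simp add: G_def p_def e_def dp_def\<close>)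
    next
      case False
      have "d * w + r < a * w + mu (Suc a)" using j jdr m by (simp only:)
      hence "d * w < a * w" using False by linarith
      hence d: "d < a" unfolding mult_less_cancel2 by simp
      have r': "r - mu (Suc a) < mu a" using r False by (simp add: w_def)
      note z = ix[OF r', of "a - Suc d"]
      show ?thesis
        by (rule exI[of _ "ix a (r - mu (Suc a)) (a - Suc d)"])
           (use z d jdr False in \<open>simp add: G_def p_def e_def dp_def\<close>)
    qed
  qed
  define T where "T = mat n n (\<lambda>(x, y). if G x \<and> G y \<and> p x = Suc (p y) then 1 else (0::'a))"
  have T: "T \<in> carrier_mat n n" by (simp add: T_def)
  have Gdn: "G (dn z) = G z" if "z < n" for z using dn[OF that] that by (simp add: G_def)
  have Gup: "G (up z) = G z" if "z < n" "Suc (ht z) < sz z" for z using up[OF that] that by (simp add: G_def)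
  have pdn: "p (dn z) = p z + w" if "z < n" "0 < ht z" for z
    using dn[OF that(1)] dp_dn[OF that] by (simp add: p_def e_def)
  have pup: "p (up z) + w = p z" if "z < n" "Suc (ht z) < sz z" for z
  proof -
    have "0 < dp z" using dp_pos_iff[OF that(1)] that(2) by simp
    from gr0_implies_Suc[OF this] obtain d where "dp z = Suc d" by (rule exE)
    thus ?thesis using up[OF that] dp_up[OF that] by (simp add: p_def e_def)
  qed
  \<comment> \<open>In terms of the position \<open>p\<close>, \<open>T\<close> shifts by 1 and
    \<open>S\<close> by w, and both run out at the ends of the same range; this is why they
    commute.\<close>
  have "T \<in> commutant"
  proof (rule commI[OF T])
    fix x y assume xy: "x < n" "y < n"
    show "(if ht y = 0 then 0 else T $$ (x, dn y)) = (if Suc (ht x) < sz x then T $$ (up x, y) else 0)"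
    proof (cases "G x \<and> G y")
      case False
      thus ?thesis using xy dn(1)[OF xy(2)] up(1)[OF xy(1)] Gdn[OF xy(2)] Gup[OF xy(1)]
        by (auto simp: T_def)
    next
      case True
      show ?thesis
      proof (cases "0 < ht y"; cases "Suc (ht x) < sz x")
        assume *: "0 < ht y" "Suc (ht x) < sz x"
        thus ?thesis using xy dn(1)[OF xy(2)] up(1)[OF xy(1) *(2)] Gdn[OF xy(2)] Gup[OF xy(1) *(2)]
            pdn[OF xy(2) *(1)] pup[OF xy(1) *(2)] by (auto simp: T_def)
      next
        assume *: "0 < ht y" "\<not> Suc (ht x) < sz x"
        hence "p x < w" using dp_pos_iff[OF xy(1)] e True by (simp add: p_def)
        thus ?thesis using * xy dn(1)[OF xy(2)] pdn[OF xy(2) *(1)] by (simp add: T_def)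
      next
        assume *: "\<not> 0 < ht y" "Suc (ht x) < sz x"
        have "p x < m" "m \<le> p y + w" using True p_less p_end * by simp_all
        thus ?thesis using * xy up(1)[OF xy(1) *(2)] pup[OF xy(1) *(2)] by (simp add: T_def)
      qed simp
    qed
  qed
  moreover have "rk y < rk x" if "x < n" "y < n" "sz x = sz y" "ht x = ht y" "T $$ (x, y) \<noteq> 0" for x y
  proof -
    have "dp x = dp y" using that by (simp add: dp_def)
    thus ?thesis using that by (auto simp: T_def p_def e_def split: if_splits)
  qed
  ultimately have T_ad: "T \<in> adapted" by (auto simp: adapted_def)
  have m0: "0 < m" using a w by (auto simp: m_def)
  obtain y where y: "G y" "p y = 0" using p_surj[OF m0] by blast
  obtain x where x: "G x" "p x = m - 1" using p_surj[of "m - 1"] m0 by auto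
  have pow: "(T ^\<^sub>m k) $$ (x, y) = (if G x \<and> p x = k then 1 else 0)" if "k < m" "x < n" for k x
    using that
  proof (induct k arbitrary: x)
    case 0
    have "y < n" using y by (simp add: G_def)
    moreover have "x = y \<longleftrightarrow> G x \<and> p x = 0" using y p_inj[of x y] by auto
    ultimately show ?case using T 0 by simp
  next
    case (Suc k)
    have yn: "y < n" using y by (simp add: G_def)
    obtain z where z: "G z" "p z = k" using p_surj[of k] Suc(2) by auto
    have zn: "z < n" using z by (simp add: G_def)
    have "(T ^\<^sub>m Suc k) $$ (x, y) = (\<Sum>z'<n. T $$ (x, z') * (T ^\<^sub>m k) $$ (z', y))"
      unfolding pow_mat_Suc_left[OF T] by (rule mult_index[OF T pow_carrier_mat[OF T] Suc(3) yn])
    also have "\<dots> = (\<Sum>z'<n. if z' = z then T $$ (x, z') else 0)"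
    proof (rule sum.cong)
      fix z' assume "z' \<in> {..<n}"
      hence "(T ^\<^sub>m k) $$ (z', y) = (if G z' \<and> p z' = k then 1 else 0)" using Suc(1)[of z'] Suc(2) by simp
      moreover have "G z' \<and> p z' = k \<longleftrightarrow> z' = z" using z p_inj[of z' z] by auto
      ultimately show "T $$ (x, z') * (T ^\<^sub>m k) $$ (z', y) = (if z' = z then T $$ (x, z') else 0)" by simp
    qed simp
    also have "\<dots> = T $$ (x, z)" using zn by simp
    also have "\<dots> = (if G x \<and> p x = Suc k then 1 else 0)" using zn Suc(3) z by (simp add: T_def)
    finally show ?case .
  qed
  have "ht x = 0"
  proof (rule ccontr)
    assume "ht x \<noteq> 0"
    hence "p (dn x) = p x + w" using x pdn by (simp add: G_def)
    moreover have "p (dn x) < m" using Gdn[of x] x p_less by (simp add: G_def)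
    ultimately show False using x w0 by simp
  qed
  moreover have "dp y = 0" using y w0 by (simp add: p_def)
  moreover have "(T ^\<^sub>m (m - 1)) $$ (x, y) \<noteq> 0" using pow[of "m - 1" x] x m0 by (simp add: G_def)
  moreover have "\<forall>x<n. \<forall>y<n. T $$ (x, y) \<noteq> 0 \<longrightarrow> sz x \<le> Suc a \<and> sz y \<le> Suc a"
    by (auto simp: T_def G_def)
  moreover have "x < n" "y < n" "sz x \<le> Suc a" "sz y \<le> Suc a" using x y by (auto simp: G_def)
  ultimately show ?thesis using T_ad by blast
qed

end

lemma pow_mat_add_exponent:
  fixes A :: "'a::semiring_1 mat"
  assumes A: "A \<in> carrier_mat n n"
  shows "A ^\<^sub>m (i + j) = A ^\<^sub>m i * A ^\<^sub>m j"
proof (induct j)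
  case 0
  show ?case using A right_mult_one_mat[OF pow_carrier_mat[OF A]] by simp
next
  case (Suc j)
  have "A ^\<^sub>m (i + Suc j) = A ^\<^sub>m i * A ^\<^sub>m j * A" using Suc by simp
  also have "\<dots> = A ^\<^sub>m i * (A ^\<^sub>m j * A)"
    by (rule assoc_mult_mat[OF pow_carrier_mat[OF A] pow_carrier_mat[OF A] A])
  finally show ?case by simp
qed

context jordan_frame
begin

text \<open>The new chain first runs through the tops of the blocks of the new size (\<open>E\<close>), enters the old chain
  (\<open>D\<close>), leaves it at its end (\<open>R\<close>) and runs through the socles of the new blocks (\<open>E\<close>).  Other paths
  of the same length could cancel it, but only this one uses \<open>R\<close> exactly once, so scaling \<open>R\<close> by a
  generic scalar prevents cancellation.\<close>

lemma extend_chain_by_class: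
  fixes T :: "'a::field mat"
  assumes inf: "infinite (UNIV :: 'a set)"
    and T: "T \<in> adapted" and x: "x < n" "ht x = 0" "sz x \<le> M" and y: "y < n" "dp y = 0" "sz y \<le> M"
    and supp: "\<And>x y. x < n \<Longrightarrow> y < n \<Longrightarrow> T $$ (x, y) \<noteq> 0 \<Longrightarrow> sz x \<le> M \<and> sz y \<le> M"
    and Tk: "(T ^\<^sub>m k) $$ (x, y) \<noteq> 0"
    and "0 < mu (Suc M)"
  shows "\<exists>T'\<in>adapted. \<exists>x'<n. \<exists>y'<n. ht x' = 0 \<and> dp y' = 0 \<and> sz x' \<le> Suc M \<and> sz y' \<le> Suc M \<and>
    (\<forall>x<n. \<forall>y<n. T' $$ (x, y) \<noteq> 0 \<longrightarrow> sz x \<le> Suc M \<and> sz y \<le> Suc M) \<and>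
    (T' ^\<^sub>m (k + 2 * mu (Suc M))) $$ (x', y') \<noteq> (0 :: 'a)"
proof -
  define s where "s = Suc M"
  define f where "f = mu s"
  have f0: "0 < f" using \<open>0 < mu (Suc M)\<close> by (simp add: f_def s_def)
  have s0: "0 < s" by (simp add: s_def)
  have cT: "T \<in> carrier_mat n n" by (rule adapted_carrier[OF T])
  define E where "E = mat n n (\<lambda>(u, v). if sz u = s \<and> sz v = s \<and> ht u = ht v \<and> rk u = Suc (rk v) then 1 else (0::'a))"
  \<comment> \<open>\<open>D\<close> is the quotient map from the last block of size
    \<open>s\<close> onto the block of \<open>y\<close>, matching depths; \<open>R\<close> is the
    embedding of the block of \<open>x\<close> into the first block of size \<open>s\<close>,
    matching heights.\<close>
  define D where "D = mat n n (\<lambda>(u, v). if sz v = s \<and> Suc (rk v) = f \<and> sz u = sz y \<and> rk u = rk y \<and> dp u = dp v then 1 else (0::'a))"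
  define R where "R = mat n n (\<lambda>(u, v). if sz v = sz x \<and> rk v = rk x \<and> sz u = s \<and> rk u = 0 \<and> ht u = ht v then 1 else (0::'a))"
  have cE: "E \<in> carrier_mat n n" and cD: "D \<in> carrier_mat n n" and cR: "R \<in> carrier_mat n n"
    by (simp_all add: E_def D_def R_def)
  have E_idx: "E $$ (u, v) = (if sz u = s \<and> sz v = s \<and> ht u = ht v \<and> rk u = Suc (rk v) then 1 else 0)"
    and D_idx: "D $$ (u, v) = (if sz v = s \<and> Suc (rk v) = f \<and> sz u = sz y \<and> rk u = rk y \<and> dp u = dp v then 1 else 0)"
    and R_idx: "R $$ (u, v) = (if sz v = sz x \<and> rk v = rk x \<and> sz u = s \<and> rk u = 0 \<and> ht u = ht v then 1 else 0)"
    if "u < n" "v < n" for u v using that by (simp_all add: E_def D_def R_def)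
  have ysz: "sz y < s" and xsz: "sz x < s" using x(3) y(3) by (simp_all add: s_def)
  have "E \<in> commutant"
  proof (rule commI[OF cE])
    fix u v assume uv: "u < n" "v < n"
    note dnv = dn[OF uv(2)] and upu = up[OF uv(1)]
    show "(if ht v = 0 then 0 else E $$ (u, dn v)) = (if Suc (ht u) < sz u then E $$ (up u, v) else 0)"
      using E_idx[OF uv(1) dnv(1)] E_idx[OF upu(1) uv(2)] dnv upu ht_less[OF uv(2)] ht_less[OF uv(1)]
      by (cases "ht v = 0"; cases "Suc (ht u) < sz u") auto
  qed
  have "D \<in> commutant"
  proof (rule commI[OF cD])
    fix u v assume uv: "u < n" "v < n"
    note dnv = dn[OF uv(2)] and upu = up[OF uv(1)]
    show "(if ht v = 0 then 0 else D $$ (u, dn v)) = (if Suc (ht u) < sz u then D $$ (up u, v) else 0)"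
    proof (cases "sz v = s \<and> Suc (rk v) = f \<and> sz u = sz y \<and> rk u = rk y")
      case True
      have "0 < ht v \<and> dp u = Suc (dp v) \<longleftrightarrow> 0 < dp u \<and> dp u - 1 = dp v"
        using sz_eq[OF uv(1)] sz_eq[OF uv(2)] True ysz by auto
      thus ?thesis
        using True D_idx[OF uv(1) dnv(1)] D_idx[OF upu(1) uv(2)] dnv upu dp_dn[OF uv(2)] dp_up[OF uv(1)]
          dp_pos_iff[OF uv(1)]
        by (cases "ht v = 0"; cases "Suc (ht u) < sz u") auto
    next
      case False
      thus ?thesis
        using D_idx[OF uv(1) dnv(1)] D_idx[OF upu(1) uv(2)] dnv upu
        by (cases "ht v = 0"; cases "Suc (ht u) < sz u") auto
    qed
  qed
  have "R \<in> commutant"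
  proof (rule commI[OF cR])
    fix u v assume uv: "u < n" "v < n"
    note dnv = dn[OF uv(2)] and upu = up[OF uv(1)]
    show "(if ht v = 0 then 0 else R $$ (u, dn v)) = (if Suc (ht u) < sz u then R $$ (up u, v) else 0)"
      using R_idx[OF uv(1) dnv(1)] R_idx[OF upu(1) uv(2)] dnv upu ht_less[OF uv(2)] ht_less[OF uv(1)] xsz
      by (cases "ht v = 0"; cases "Suc (ht u) < sz u") auto
  qed
  have E: "E \<in> adapted" using \<open>E \<in> commutant\<close> by (auto simp: adapted_def E_idx)
  have D: "D \<in> adapted" using \<open>D \<in> commutant\<close> ysz by (auto simp: adapted_def D_idx)
  have R: "R \<in> adapted" using \<open>R \<in> commutant\<close> xsz by (auto simp: adapted_def R_idx)
  define X where "X = T + 1 \<cdot>\<^sub>m (E + 1 \<cdot>\<^sub>m D)"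
  have X: "X \<in> adapted" unfolding X_def by (intro adapted_add_smult T E D)
  have cX: "X \<in> carrier_mat n n" by (rule adapted_carrier[OF X])
  have X_idx: "X $$ (u, v) = T $$ (u, v) + (E $$ (u, v) + D $$ (u, v))" if "u < n" "v < n" for u v
    using that cT cE cD by (simp add: X_def)
  have T0: "T $$ (u, v) = 0" if "u < n" "v < n" "M < sz u \<or> M < sz v" for u v
    using supp[OF that(1,2)] that(3) by (meson not_le)
  define lo where "lo j = ix s j 0" for j
  define hi where "hi j = ix s j (s - 1)" for j
  have lo: "lo j < n" "sz (lo j) = s" "rk (lo j) = j" "ht (lo j) = 0" if "j < f" for j
    using ix[of j s 0] that s0 by (simp_all add: lo_def f_def)
  have hi: "hi j < n" "sz (hi j) = s" "rk (hi j) = j" "dp (hi j) = 0" "ht (hi j) = s - 1" if "j < f" for j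
    using ix[of j s "s - 1"] that s0 by (simp_all add: hi_def f_def dp_def)
  \<comment> \<open>The nonzero columns of \<open>E\<close> and \<open>D\<close> belong to blocks of
    size \<open>s\<close>, so paths starting in smaller blocks use \<open>T\<close> alone.\<close>
  have X_T: "(X ^\<^sub>m i) $$ (u, v) = (T ^\<^sub>m i) $$ (u, v)" if "u < n" "v < n" "sz v \<le> M" for i u v
    using that
  proof (induct i arbitrary: v)
    case 0
    thus ?case using cX cT by simp
  next
    case (Suc i)
    have "(X ^\<^sub>m Suc i) $$ (u, v) = (\<Sum>z<n. (X ^\<^sub>m i) $$ (u, z) * X $$ (z, v))"
      unfolding pow_mat.simps by (rule mult_index[OF pow_carrier_mat[OF cX] cX Suc(2,3)])
    also have "\<dots> = (\<Sum>z<n. (T ^\<^sub>m i) $$ (u, z) * T $$ (z, v))"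
    proof (rule sum.cong)
      fix z assume "z \<in> {..<n}"
      hence z: "z < n" by simp
      have "X $$ (z, v) = T $$ (z, v)" using X_idx[OF z Suc(3)] E_idx[OF z Suc(3)] D_idx[OF z Suc(3)] Suc(4)
        by (simp add: s_def)
      thus "(X ^\<^sub>m i) $$ (u, z) * X $$ (z, v) = (T ^\<^sub>m i) $$ (u, z) * T $$ (z, v)"
        using Suc(1)[OF Suc(2) z] T0[OF z Suc(3)] by (cases "sz z \<le> M") simp_all
    qed simp
    also have "\<dots> = (T ^\<^sub>m Suc i) $$ (u, v)"
      unfolding pow_mat.simps by (rule mult_index[OF pow_carrier_mat[OF cT] cT Suc(2,3), symmetric])
    finally show ?case .
  qed
  \<comment> \<open>At the tops of the new blocks there is no choice: each column has a single
    nonzero entry, leading to the next top and from the last one to \<open>y\<close>.\<close>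
  have X_col: "X $$ (z, hi j) = (if Suc j < f then (if z = hi (Suc j) then 1 else 0) else (if z = y then 1 else 0))"
    if j: "j < f" and z: "z < n" for j z
  proof -
    note h = hi[OF j]
    have t: "T $$ (z, hi j) = 0" by (rule T0[OF z h(1)]) (simp add: h s_def)
    show ?thesis
    proof (cases "Suc j < f")
      case True
      have "sz z = s \<and> ht z = s - 1 \<and> rk z = Suc j \<longleftrightarrow> z = hi (Suc j)"
        using index_eqI[OF z hi(1)[OF True]] hi[OF True] by auto
      thus ?thesis using X_idx[OF z h(1)] E_idx[OF z h(1)] D_idx[OF z h(1)] h t True by auto
    next
      case False
      hence j': "Suc j = f" using j by simp
      have "sz z = sz y \<and> rk z = rk y \<and> dp z = 0 \<longleftrightarrow> z = y"
        using index_eqI'[OF z y(1)] y by auto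
      moreover have "\<not> (sz z = s \<and> rk z = Suc j)"
        using rk_less[OF z] j' by (auto simp: f_def)
      ultimately show ?thesis using X_idx[OF z h(1)] E_idx[OF z h(1)] D_idx[OF z h(1)] h t j' by auto
    qed
  qed
  have X_hi: "(X ^\<^sub>m (i + Suc l)) $$ (u, hi j) = (X ^\<^sub>m i) $$ (u, y)" if "j + Suc l = f" "u < n" for i j l u
    using that
  proof (induct l arbitrary: j)
    case 0
    have j: "j < f" using 0 by simp
    have "(X ^\<^sub>m (i + Suc 0)) $$ (u, hi j) = (\<Sum>z<n. (X ^\<^sub>m i) $$ (u, z) * X $$ (z, hi j))"
      using mult_index[OF pow_carrier_mat[OF cX] cX 0(2) hi(1)[OF j]] by simp
    also have "\<dots> = (\<Sum>z<n. if z = y then (X ^\<^sub>m i) $$ (u, z) else 0)"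
      by (rule sum.cong) (use X_col[OF j] 0 in simp_all)
    finally show ?case using y(1) by simp
  next
    case (Suc l)
    have j: "j < f" "Suc j < f" using Suc by simp_all
    have "(X ^\<^sub>m (i + Suc (Suc l))) $$ (u, hi j) = (\<Sum>z<n. (X ^\<^sub>m (i + Suc l)) $$ (u, z) * X $$ (z, hi j))"
      using mult_index[OF pow_carrier_mat[OF cX] cX Suc(3) hi(1)[OF j(1)], of "i + Suc l"] by simp
    also have "\<dots> = (\<Sum>z<n. if z = hi (Suc j) then (X ^\<^sub>m (i + Suc l)) $$ (u, z) else 0)"
      by (rule sum.cong) (use X_col[OF j(1)] j in simp_all)
    also have "\<dots> = (X ^\<^sub>m (i + Suc l)) $$ (u, hi (Suc j))" using hi(1)[OF j(2)] by simp
    also have "\<dots> = (X ^\<^sub>m i) $$ (u, y)" by (rule Suc(1)) (use Suc in simp_all)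
    finally show ?case .
  qed
  \<comment> \<open>Dually, the socle of a new block can be entered only from the socle of the
    preceding one, and row \<open>lo 0\<close> of \<open>X\<close> is zero: the chain of socles is
    reached through \<open>R\<close> alone.\<close>
  have X_row: "X $$ (lo j, z) = (if 0 < j \<and> z = lo (j - 1) then 1 else 0)" if j: "j < f" and z: "z < n" for j z
  proof -
    note l = lo[OF j]
    have "T $$ (lo j, z) = 0" by (rule T0[OF l(1) z]) (simp add: l s_def)
    moreover have "D $$ (lo j, z) = 0" using D_idx[OF l(1) z] l ysz by simp
    moreover have "E $$ (lo j, z) = (if 0 < j \<and> z = lo (j - 1) then 1 else 0)"
    proof (cases j)
      case 0
      thus ?thesis using E_idx[OF l(1) z] l by simp
    next
      case (Suc i)
      hence i: "i < f" using j by simp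
      have "sz z = s \<and> ht z = 0 \<and> rk z = i \<longleftrightarrow> z = lo i"
        using index_eqI[OF z lo(1)[OF i]] lo[OF i] by auto
      thus ?thesis using E_idx[OF l(1) z] l Suc by auto
    qed
    ultimately show ?thesis using X_idx[OF l(1) z] by simp
  qed
  have R_row: "R $$ (lo j, z) = (if j = 0 \<and> z = x then 1 else 0)" if j: "j < f" and z: "z < n" for j z
  proof -
    have "sz z = sz x \<and> rk z = rk x \<and> ht z = 0 \<longleftrightarrow> z = x" using index_eqI[OF z x(1)] x by auto
    thus ?thesis using R_idx[OF lo(1)[OF j] z] lo[OF j] by auto
  qed
  \<comment> \<open>Hence the one use of \<open>R\<close> counted by the derivative is the step from
    \<open>x\<close> to \<open>lo 0\<close>, and what precedes it is a plain power of
    \<open>X\<close>.\<close>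
  have deriv: "pow_deriv n X R (i + Suc j) $$ (lo j, v) = (X ^\<^sub>m i) $$ (x, v)" if "j < f" "v < n" for i j v
    using that
  proof (induct j)
    case 0
    have "pow_deriv n X R (Suc i) $$ (lo 0, v) =
        (\<Sum>z<n. X $$ (lo 0, z) * pow_deriv n X R i $$ (z, v)) + (\<Sum>z<n. R $$ (lo 0, z) * (X ^\<^sub>m i) $$ (z, v))"
      by (rule pow_deriv_Suc_index[OF cX cR lo(1)[OF 0(1)] 0(2)])
    also have "(\<Sum>z<n. X $$ (lo 0, z) * pow_deriv n X R i $$ (z, v)) = 0"
      by (rule sum.neutral) (use X_row[OF 0(1)] in simp)
    also have "(\<Sum>z<n. R $$ (lo 0, z) * (X ^\<^sub>m i) $$ (z, v)) = (\<Sum>z<n. if z = x then (X ^\<^sub>m i) $$ (z, v) else 0)"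
      by (rule sum.cong) (use R_row[OF 0(1)] in simp_all)
    finally show ?case using x(1) by simp
  next
    case (Suc j)
    have j: "j < f" using Suc by simp
    have "pow_deriv n X R (Suc (i + Suc j)) $$ (lo (Suc j), v) =
        (\<Sum>z<n. X $$ (lo (Suc j), z) * pow_deriv n X R (i + Suc j) $$ (z, v))
        + (\<Sum>z<n. R $$ (lo (Suc j), z) * (X ^\<^sub>m (i + Suc j)) $$ (z, v))"
      by (rule pow_deriv_Suc_index[OF cX cR lo(1)[OF Suc(2)] Suc(3)])
    also have "(\<Sum>z<n. R $$ (lo (Suc j), z) * (X ^\<^sub>m (i + Suc j)) $$ (z, v)) = 0"
      by (rule sum.neutral) (use R_row[OF Suc(2)] in simp)
    also have "(\<Sum>z<n. X $$ (lo (Suc j), z) * pow_deriv n X R (i + Suc j) $$ (z, v)) =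
        (\<Sum>z<n. if z = lo j then pow_deriv n X R (i + Suc j) $$ (z, v) else 0)"
      by (rule sum.cong) (use X_row[OF Suc(2)] in simp_all)
    finally show ?case using lo(1)[OF j] Suc(1)[OF j Suc(3)] by simp
  qed
  define x' where "x' = lo (f - 1)"
  define y' where "y' = hi 0"
  have x': "x' < n" "ht x' = 0" "sz x' = s" using lo[of "f - 1"] f0 by (simp_all add: x'_def)
  have y': "y' < n" "dp y' = 0" "sz y' = s" using hi[of 0] f0 by (simp_all add: y'_def)
  \<comment> \<open>Each of the two passages through the \<open>f\<close> new blocks costs
    \<open>f\<close> steps, counted with the step into or out of the old chain.\<close>
  have "pow_deriv n X R (k + 2 * f) $$ (x', y') = pow_deriv n X R ((k + f) + Suc (f - 1)) $$ (lo (f - 1), hi 0)"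
    using f0 by (simp add: x'_def y'_def mult_2 add.assoc)
  also have "\<dots> = (X ^\<^sub>m (k + f)) $$ (x, hi 0)" by (rule deriv) (use f0 hi[of 0] in simp_all)
  also have "\<dots> = (X ^\<^sub>m k) $$ (x, y)" using X_hi[of 0 "f - 1" x k] f0 x(1) by simp
  also have "\<dots> = (T ^\<^sub>m k) $$ (x, y)" by (rule X_T[OF x(1) y(1,3)])
  finally have "pow_deriv n X R (k + 2 * f) $$ (x', y') \<noteq> 0" using Tk by simp
  from exists_pow_add_smult_neq_0[OF inf cX cR x'(1) y'(1) this]
  obtain c where c: "((X + c \<cdot>\<^sub>m R) ^\<^sub>m (k + 2 * f)) $$ (x', y') \<noteq> 0" by blast
  define W where "W = X + c \<cdot>\<^sub>m R"
  have "W \<in> adapted" unfolding W_def by (rule adapted_add_smult[OF X R])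
  moreover have "sz u \<le> s \<and> sz v \<le> s" if uv: "u < n" "v < n" "W $$ (u, v) \<noteq> 0" for u v
  proof (rule ccontr)
    assume a: "\<not> (sz u \<le> s \<and> sz v \<le> s)"
    hence "T $$ (u, v) = 0" using T0[OF uv(1,2)] by (auto simp: s_def)
    moreover have "E $$ (u, v) = 0" using a E_idx[OF uv(1,2)] by auto
    moreover have "D $$ (u, v) = 0" using a D_idx[OF uv(1,2)] ysz by auto
    moreover have "R $$ (u, v) = 0" using a R_idx[OF uv(1,2)] xsz by auto
    ultimately have "W $$ (u, v) = 0" using X_idx[OF uv(1,2)] uv(1,2) cX cR by (simp add: W_def)
    thus False using uv(3) by simp
  qed
  ultimately show ?thesis using x' y' c unfolding W_def[symmetric] f_def s_def by (metis order_refl)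
qed

text \<open>The base is the cyclic chain through the sizes a and a + 1; every larger size that
  occurs is then added and lengthens the chain by twice its multiplicity. The exponent counts steps,
  one less than the number of vectors.\<close>

lemma chain_matrix_exists:
  assumes inf: "infinite (UNIV :: 'a::field set)" and a: "0 < a" "0 < mu a + mu (Suc a)" and M: "Suc a \<le> M"
  shows "\<exists>T\<in>adapted. \<exists>x<n. \<exists>y<n. ht x = 0 \<and> dp y = 0 \<and> sz x \<le> M \<and> sz y \<le> M \<and>
    (\<forall>x<n. \<forall>y<n. T $$ (x, y) \<noteq> 0 \<longrightarrow> sz x \<le> M \<and> sz y \<le> M) \<and>
    (T ^\<^sub>m (uchain mu M a - 1)) $$ (x, y) \<noteq> (0 :: 'a)"
  using M
proof (induct rule: dec_induct)
  case base
  show ?case using cyclic_chain[OF a, where ?'a = 'a] by (simp add: uchain_def)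
next
  case (step M)
  have eq: "{Suc a<..Suc M} = insert (Suc M) {Suc a<..M}" using step by auto
  have u: "uchain mu (Suc M) a = uchain mu M a + 2 * mu (Suc M)" unfolding uchain_def eq by simp
  have pos: "0 < uchain mu M a" using a unfolding uchain_def by auto
  obtain T x y where *: "T \<in> adapted" "x < n" "y < n" "ht x = 0" "dp y = 0" "sz x \<le> M" "sz y \<le> M"
    "\<And>x y. x < n \<Longrightarrow> y < n \<Longrightarrow> T $$ (x, y) \<noteq> 0 \<Longrightarrow> sz x \<le> M \<and> sz y \<le> M"
    "(T ^\<^sub>m (uchain mu M a - 1)) $$ (x, y) \<noteq> (0 :: 'a)" using step(3) by blast
  show ?case
  proof (cases "mu (Suc M) = 0")
    case True
    show ?thesis
      using * u True by (intro bexI[OF _ *(1)] exI[of _ x] conjI exI[of _ y]) (auto intro: le_SucI)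
  next
    case False
    have "uchain mu M a - 1 + 2 * mu (Suc M) = uchain mu (Suc M) a - 1" using u pos by simp
    thus ?thesis
      using extend_chain_by_class[OF inf *(1,2,4,6,3,5,7,8,9)] False by simp
  qed
qed

lemma generic_pow_0_imp_uchain_le:
  fixes A :: "'a::field mat" and U :: "'a mat set"
  assumes inf: "infinite (UNIV :: 'a set)" and N: "\<And>i. N < i \<Longrightarrow> mu i = 0"
    and U: "zariski_open_in n (nilpotent_commutator n S) U" "A \<in> U"
    and pow: "\<And>A. A \<in> U \<Longrightarrow> A ^\<^sub>m u = 0\<^sub>m n n"
    and a: "0 < a" "0 < mu a + mu (Suc a)"
  shows "uchain mu N a \<le> u"
proof (rule ccontr)
  assume not_le: "\<not> uchain mu N a \<le> u"
  \<comment> \<open>The construction wants a largest size of at least a + 1, also when a is the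
    largest part.\<close>
  define M where "M = max N (Suc a)"
  have "sum mu {Suc a<..M} = sum mu {Suc a<..N}"
    by (rule sum.mono_neutral_right) (use N in \<open>auto simp: M_def\<close>)
  hence u: "uchain mu M a = uchain mu N a" by (simp add: uchain_def)
  obtain T x y where T: "T \<in> adapted" "x < n" "y < n" "(T ^\<^sub>m (uchain mu M a - 1)) $$ (x, y) \<noteq> (0 :: 'a)"
    using chain_matrix_exists[OF inf a, of M] M_def by auto
  have cT: "T \<in> carrier_mat n n" by (rule adapted_carrier[OF T(1)])
  have "T ^\<^sub>m u = 0\<^sub>m n n" by (rule generic_pow_0_imp_adapted_pow_0[OF inf N U pow T(1)])
  moreover have "T ^\<^sub>m (u + j) = T ^\<^sub>m u * T ^\<^sub>m j" for j by (rule pow_mat_add_exponent[OF cT])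
  ultimately have "T ^\<^sub>m (u + j) = 0\<^sub>m n n" for j using cT by (simp add: pow_carrier_mat)
  moreover have "uchain mu M a - 1 = u + (uchain mu M a - 1 - u)" using u not_le by simp
  ultimately have "T ^\<^sub>m (uchain mu M a - 1) = 0\<^sub>m n n" by metis
  thus False using T by simp
qed

end

section \<open>Partitions whose generic Jordan type has two parts\<close>

context jordan_frame
begin

lemma S_pow_index:
  assumes "x < n" "y < n"
  shows "((S :: 'a::comm_ring_1 mat) ^\<^sub>m k) $$ (x, y) =
    (if sz x = sz y \<and> rk x = rk y \<and> ht y = ht x + k then 1 else 0)"
  using assms(2)
proof (induct k arbitrary: y)
  case 0
  have "x = y \<longleftrightarrow> sz x = sz y \<and> rk x = rk y \<and> ht y = ht x" using index_eqI[OF assms(1) 0] by auto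
  moreover have "dim_row (S :: 'a mat) = n" by (simp add: shift_mat_def)
  ultimately show ?case using assms(1) 0 by simp
next
  case (Suc k)
  note d = dn[OF Suc(2)]
  have "((S :: 'a mat) ^\<^sub>m Suc k) $$ (x, y) = (if ht y = 0 then 0 else ((S :: 'a mat) ^\<^sub>m k) $$ (x, dn y))"
    using mult_S_index[OF pow_carrier_mat[OF S_carrier] assms(1) Suc(2), of k, where ?'a = 'a] by simp
  also have "\<dots> = (if ht y = 0 then 0 else
      if sz x = sz (dn y) \<and> rk x = rk (dn y) \<and> ht (dn y) = ht x + k then 1 else 0)"
    by (simp only: Suc(1)[OF d(1)])
  also have "\<dots> = (if sz x = sz y \<and> rk x = rk y \<and> ht y = ht x + Suc k then 1 else 0)"
    unfolding d(2-4) by (cases "ht y") simp_all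
  finally show ?case .
qed

text \<open>The kernel of a Jordan matrix is spanned by the socle vectors; two blocks thus amount to
  two functionals, as many as \<open>kernel_of_three_separated_sizes\<close> can absorb.\<close>

lemma S_kernel:
  fixes w :: "'a::comm_ring_1 vec"
  assumes w: "w \<in> carrier_vec n" "S *\<^sub>v w = 0\<^sub>v n" and 0: "\<And>x. x < n \<Longrightarrow> ht x = 0 \<Longrightarrow> w $ x = 0"
  shows "w = 0\<^sub>v n"
proof (rule eq_vecI)
  fix y assume "y < dim_vec (0\<^sub>v n :: 'a vec)"
  hence y: "y < n" by simp
  have "w $ y = 0"
  proof (cases "ht y = 0")
    case False
    note d = dn[OF y]
    have u: "up (dn y) = y" using up_dn[OF y] False by simp
    have h: "Suc (ht (dn y)) < sz (dn y)" using d ht_less[OF y] False by simp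
    have dim: "dim_row (S :: 'a mat) = n" "dim_col (S :: 'a mat) = n" by (simp_all add: shift_mat_def)
    have "(S *\<^sub>v w) $ dn y = (\<Sum>z<n. S $$ (dn y, z) * w $ z)"
      using d(1) w(1) dim by (simp add: scalar_prod_def lessThan_atLeast0)
    also have "\<dots> = (\<Sum>z<n. if z = y then w $ z else 0)"
    proof (rule sum.cong)
      fix z assume "z \<in> {..<n}"
      hence "S $$ (dn y, z) = (if z = y then 1 else (0::'a))"
        using S_index'[OF d(1), of z] u h by simp
      thus "S $$ (dn y, z) * w $ z = (if z = y then w $ z else 0)" by simp
    qed simp
    also have "\<dots> = w $ y" using y by simp
    finally show ?thesis using w(2) d(1) by simp
  qed (use 0 y in simp)
  thus "w $ y = 0\<^sub>v n $ y" using y by simp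
qed (use w in simp)

end

lemma jordan_matrix_nilpotent_blocks:
  "\<exists>sz rk ht ix. jordan_frame (sum_mset P) (count P) sz rk ht ix \<and>
     jordan_matrix (nilpotent_blocks P) = (shift_mat (sum_mset P) sz rk ht :: 'a::{zero,one} mat)"
proof -
  define xs where "xs = rev (sorted_list_of_multiset P)"
  have "mset xs = P" by (simp add: xs_def)
  moreover from this have "sum_list xs = sum_mset P" by (metis sum_mset_sum_list)
  ultimately show ?thesis using jordan_frame_exists[of xs, where ?'a = 'a]
    unfolding nilpotent_blocks_def xs_def[symmetric] by simp
qed

text \<open>Besides the matrix size, two invariants of the Jordan type enter. The nilpotency index
  \<open>u\<close> of all elements of \<open>U\<close> bounds every chain by genericity, and its
  sharpness at one element, conjugated into \<open>adapted\<close>, yields a path of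
  \<open>u\<close> vectors. Two blocks mean nullity two, which three separated parts
  exclude.\<close>

lemma Q_inv_two_parts:
  assumes inf: "infinite (UNIV :: 'a::field set)" and uv: "0 < v" "v < u"
    and P: "P \<in> Q_inv TYPE('a) {#u, v#}"
  defines "c \<equiv> count P" and "N \<equiv> sum_mset P"
  shows "N = u + v"
    and "\<And>a. 0 < a \<Longrightarrow> 0 < c a + c (Suc a) \<Longrightarrow> uchain c N a \<le> u"
    and "\<exists>b. u \<le> uchain c N b"
    and "\<And>p q s. 0 < p \<Longrightarrow> p + 2 \<le> q \<Longrightarrow> q + 2 \<le> s \<Longrightarrow> p \<in># P \<Longrightarrow> q \<in># P \<Longrightarrow> s \<in># P \<Longrightarrow> False"
proof -
  obtain sz rk ht ix where fr: "jordan_frame N c sz rk ht ix"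
    and J: "J P = (shift_mat N sz rk ht :: 'a mat)"
    using jordan_matrix_nilpotent_blocks[of P, where ?'a = 'a] unfolding J_def c_def N_def by blast
  interpret jordan_frame N c sz rk ht ix by (rule fr)
  obtain sz' rk' ht' ix' where fr': "jordan_frame (u + v) (count {#u, v#}) sz' rk' ht' ix'"
    and J': "jordan_matrix (nilpotent_blocks {#u, v#}) = (shift_mat (u + v) sz' rk' ht' :: 'a mat)"
    using jordan_matrix_nilpotent_blocks[of "{#u, v#}", where ?'a = 'a] by auto
  interpret Q: jordan_frame "u + v" "count {#u, v#}" sz' rk' ht' ix' by (rule fr')
  define B where "B = (Q.S :: 'a mat)"
  have cN: "c i = 0" if "N < i" for i
  proof (rule ccontr)
    assume "c i \<noteq> 0"
    hence "i \<in># P" by (simp add: c_def)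
    then obtain P' where "P = add_mset i P'" by (metis multi_member_split)
    thus False using that by (simp add: N_def)
  qed
  obtain U :: "'a mat set" where U: "U \<noteq> {}" "zariski_open_in N (nilpotent_commutator N S) U"
    "\<And>A. A \<in> U \<Longrightarrow> has_jordan_type A {#u, v#}"
    using P J unfolding Q_inv_def generic_jordan_type_def N_def by auto
  have UN: "U \<subseteq> nilpotent_commutator N S" using U(2) unfolding zariski_open_in_def by blast
  have sim: "\<exists>X Y. similar_mat_wit A B X Y" if "A \<in> U" for A
    using U(3)[OF that] J' unfolding has_jordan_type_def jordan_nf_def similar_mat_def B_def by simp
  obtain A where A: "A \<in> U" using U(1) by blast
  have cA: "A \<in> carrier_mat N N" using A UN by (auto simp: nilpotent_commutator_def)
  show Nuv: "N = u + v"
  proof -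
    obtain X Y where "similar_mat_wit A B X Y" using sim[OF A] by blast
    hence "B \<in> carrier_mat N N" by (rule similar_mat_witD2(5)[OF cA])
    hence "dim_row B = N" by (rule carrier_matD)
    thus ?thesis by (simp add: B_def shift_mat_def)
  qed
  have cB: "B \<in> carrier_mat N N" by (simp add: B_def Nuv)
  have B_pow: "(B ^\<^sub>m k) $$ (x, y) = (if sz' x = sz' y \<and> rk' x = rk' y \<and> ht' y = ht' x + k then 1 else 0)"
    if "x < u + v" "y < u + v" for x y k
    unfolding B_def by (rule Q.S_pow_index[OF that])
  have size_le: "sz' x \<le> u" if "x < u + v" for x
    using Q.rk_less[OF that] uv by (auto split: if_splits)
  have Su: "B ^\<^sub>m u = (0\<^sub>m N N :: 'a mat)"
  proof (rule eq_matI)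
    fix x y assume "x < dim_row (0\<^sub>m N N :: 'a mat)" "y < dim_col (0\<^sub>m N N :: 'a mat)"
    hence xy: "x < u + v" "y < u + v" using Nuv by simp_all
    have "ht' y \<noteq> ht' x + u" using Q.ht_less[OF xy(2)] size_le[OF xy(2)] by simp
    thus "(B ^\<^sub>m u) $$ (x, y) = (0\<^sub>m N N :: 'a mat) $$ (x, y)"
      unfolding B_pow[OF xy] using xy Nuv by simp
  qed (use carrier_matD[OF pow_carrier_mat[OF cB, of u]] in simp_all)
  have Su1: "B ^\<^sub>m (u - 1) \<noteq> (0\<^sub>m N N :: 'a mat)"
  proof
    assume *: "B ^\<^sub>m (u - 1) = (0\<^sub>m N N :: 'a mat)"
    have 0: "0 < count {#u, v#} u" by simp
    note x = Q.ix[OF 0, of 0] and y = Q.ix[OF 0, of "u - 1"]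
    have "(B ^\<^sub>m (u - 1)) $$ (ix' u 0 0, ix' u 0 (u - 1)) = (1 :: 'a)"
      using B_pow[of "ix' u 0 0" "ix' u 0 (u - 1)" "u - 1"] x y uv by simp
    thus False using * x y uv Nuv by simp
  qed
  have Au: "A ^\<^sub>m u = 0\<^sub>m N N" if AU: "A \<in> U" for A
  proof -
    have cA: "A \<in> carrier_mat N N" using AU UN by (auto simp: nilpotent_commutator_def)
    obtain X Y where XY: "similar_mat_wit A B X Y" using sim[OF AU] by blast
    show ?thesis using similar_mat_wit_pow_id[OF XY, of u] similar_mat_witD2(6,7)[OF cA XY] Su by simp
  qed
  show "uchain c N a \<le> u" if "0 < a" "0 < c a + c (Suc a)" for a
    by (rule generic_pow_0_imp_uchain_le[OF inf cN U(2) A Au that])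
  obtain m where m: "A ^\<^sub>m m = 0\<^sub>m N N" and A_comm: "A \<in> commutant"
    using A UN by (auto simp: nilpotent_commutator_def commutant_def)
  obtain g h where gh: "g \<in> commutant" "h \<in> commutant" "g * h = 1\<^sub>m N" "h * g = 1\<^sub>m N" "g * A * h \<in> adapted"
    by (rule nilpotent_conj_adapted[OF A_comm m])
  define A' where "A' = g * A * h"
  have A': "A' \<in> adapted" using gh(5) by (simp add: A'_def)
  have cA': "A' \<in> carrier_mat N N" by (rule adapted_carrier[OF A'])
  have "similar_mat_wit A' A g h"
    by (rule similar_mat_witI[OF gh(3,4) A'_def cA' cA comm_carrier[OF gh(1)] comm_carrier[OF gh(2)]])
  moreover obtain X Y where "similar_mat_wit A B X Y" using sim[OF A] by blast
  ultimately obtain X Y where XY: "similar_mat_wit A' B X Y"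
    using similar_mat_wit_trans by blast
  note w = similar_mat_witD2[OF cA' XY]
  note w' = similar_mat_witD2[OF w(5) similar_mat_wit_sym[OF XY]]
  have "A' ^\<^sub>m (u - 1) \<noteq> 0\<^sub>m N N"
  proof
    assume *: "A' ^\<^sub>m (u - 1) = 0\<^sub>m N N"
    have "B ^\<^sub>m (u - 1) = Y * A' ^\<^sub>m (u - 1) * X"
      by (rule similar_mat_wit_pow_id[OF similar_mat_wit_sym[OF XY]])
    thus False using Su1 * w(6,7) by simp
  qed
  have "\<exists>x<N. \<exists>y<N. (A' ^\<^sub>m (u - 1)) $$ (x, y) \<noteq> 0"
  proof (rule ccontr)
    assume *: "\<not> ?thesis"
    have "A' ^\<^sub>m (u - 1) = 0\<^sub>m N N"
      by (rule eq_matI) (use * carrier_matD[OF pow_carrier_mat[OF cA', of "u - 1"]] in simp_all)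
    thus False using \<open>A' ^\<^sub>m (u - 1) \<noteq> 0\<^sub>m N N\<close> by blast
  qed
  then obtain x y where xy: "x < N" "y < N" "(A' ^\<^sub>m (u - 1)) $$ (x, y) \<noteq> 0" by blast
  have "\<exists>b. u - 1 < uchain c N b" by (rule adapted_pow_neq_0_imp[OF A' xy cN])
  thus "\<exists>b. u \<le> uchain c N b" using uv by (metis Suc_diff_1 Suc_leI less_trans)
  show False if s: "0 < p" "p + 2 \<le> q" "q + 2 \<le> s" "p \<in># P" "q \<in># P" "s \<in># P" for p q s
  proof -
    \<comment> \<open>The socles of the two blocks: rows \<open>i\<close> and \<open>j\<close> of
      \<open>Y\<close> are the functionals that cannot both annihilate a nonzero kernel vector of
      \<open>A'\<close>.\<close>
    define i where "i = ix' u 0 0"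
    define j where "j = ix' v 0 0"
    have ij: "i < N" "j < N" using Q.ix[of 0 u 0] Q.ix[of 0 v 0] uv Nuv by (simp_all add: i_def j_def)
    have mu: "0 < c p" "0 < c q" "0 < c s" using s by (simp_all add: c_def)
    obtain z where z: "z \<in> carrier_vec N" "z \<noteq> 0\<^sub>v N" "A' *\<^sub>v z = 0\<^sub>v N"
      "(\<Sum>x<N. Y $$ (i, x) * z $ x) = 0" "(\<Sum>x<N. Y $$ (j, x) * z $ x) = 0"
      using kernel_of_three_separated_sizes[OF A' s(1-3) mu, of "\<lambda>x. Y $$ (i, x)" "\<lambda>x. Y $$ (j, x)"] by blast
    have Yz: "(Y *\<^sub>v z) $ x = (\<Sum>y<N. Y $$ (x, y) * z $ y)" if "x < N" for x
      using that w(7) z(1) by (simp add: scalar_prod_def lessThan_atLeast0)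
    have "B *\<^sub>v (Y *\<^sub>v z) = 0\<^sub>v N"
    proof -
      have "B *\<^sub>v (Y *\<^sub>v z) = (B * Y) *\<^sub>v z" by (rule assoc_mult_mat_vec[symmetric, OF w(5,7) z(1)])
      also have "B * Y = Y * A' * X * Y" using w'(3) by simp
      also have "\<dots> = Y * A' * (X * Y)" by (rule assoc_mult_mat[OF mult_carrier_mat[OF w(7,4)] w(6,7)])
      also have "\<dots> = Y * A'" unfolding w(1) by (rule right_mult_one_mat[OF mult_carrier_mat[OF w(7,4)]])
      also have "Y * A' *\<^sub>v z = Y *\<^sub>v (A' *\<^sub>v z)" by (rule assoc_mult_mat_vec[OF w(7,4) z(1)])
      also have "\<dots> = 0\<^sub>v N" unfolding z(3) by (rule eq_vecI) (use w(7) in auto)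
      finally show ?thesis .
    qed
    moreover have "(Y *\<^sub>v z) $ x = 0" if x: "x < u + v" "ht' x = 0" for x
    proof -
      have "sz' x = u \<or> sz' x = v" "rk' x = 0"
        using Q.rk_less[OF x(1)] uv by (auto split: if_splits)
      hence "x = i \<or> x = j" using Q.ix_self[OF x(1)] x(2) by (auto simp: i_def j_def)
      thus ?thesis using Yz ij z(4,5) by auto
    qed
    ultimately have Yz0: "Y *\<^sub>v z = 0\<^sub>v N"
      using Q.S_kernel[of "Y *\<^sub>v z"] mult_mat_vec_carrier[OF w(7) z(1)] Nuv
      unfolding B_def by simp
    have "z = (X * Y) *\<^sub>v z" using w(1) z(1) by simp
    also have "\<dots> = X *\<^sub>v (Y *\<^sub>v z)" by (rule assoc_mult_mat_vec[OF w(6,7) z(1)])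
    also have "\<dots> = 0\<^sub>v N" unfolding Yz0 by (rule eq_vecI) (use w(6) in auto)
    finally show False using z(2) by simp
  qed
qed

section \<open>The table\<close>

text \<open>The adjunction that turns every ceiling of the table into a multiplication of natural
  numbers.\<close>

lemma nat_ceiling_divide_le_iff:
  assumes "0 < b"
  shows "nat \<lceil>real a / real b\<rceil> \<le> k \<longleftrightarrow> a \<le> k * b"
proof -
  have "nat \<lceil>real a / real b\<rceil> \<le> k \<longleftrightarrow> real a / real b \<le> real k"
    by (simp add: nat_le_iff ceiling_le_iff)
  also have "\<dots> \<longleftrightarrow> real a \<le> real (k * b)" using assms by (simp add: divide_le_eq)
  finally show ?thesis by (simp only: of_nat_le_iff)
qed

lemma qt_le_iff: "0 < t \<Longrightarrow> qt u r t \<le> q \<longleftrightarrow> u - r \<le> q * t"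
  unfolding qt_def by (rule nat_ceiling_divide_le_iff)

text \<open>Division of \<open>u - r\<close> by \<open>t\<close> with the quotient rounded up:
  [u-r]^t consists of t - d_t parts q_t and d_t parts q_t - 1.\<close>

lemma qt_dt:
  assumes "0 < t" "r < u"
  shows "t * qt u r t = u - r + dt u r t" "dt u r t < t" "0 < qt u r t"
proof -
  have 1: "u - r \<le> qt u r t * t" using qt_le_iff[OF assms(1)] by blast
  thus 2: "t * qt u r t = u - r + dt u r t" by (simp add: dt_def mult.commute)
  show 3: "0 < qt u r t" using 1 assms(2) by (cases "qt u r t") simp_all
  have "\<not> qt u r t \<le> qt u r t - 1" using 3 by simp
  hence "(qt u r t - 1) * t < u - r" using qt_le_iff[OF assms(1)] by (meson not_le)
  moreover have "qt u r t * t = (qt u r t - 1) * t + t" using 3 by (cases "qt u r t") simp_all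
  ultimately show "dt u r t < t" using 2 by (simp add: mult.commute)
qed

text \<open>Uniqueness in this division lets q_t and d_t be read off from the part sizes of a given
  partition.\<close>

lemma qt_dt_eqI:
  assumes "0 < t" "r < u" "t * q = u - r + d" "d < t"
  shows "qt u r t = q" "dt u r t = d"
proof -
  have "qt u r t \<le> q" using qt_le_iff[OF assms(1), of u r q] assms(3) by (simp add: mult.commute)
  moreover have "q \<le> qt u r t"
  proof (rule ccontr)
    assume "\<not> q \<le> qt u r t"
    hence "Suc (qt u r t) \<le> q" by simp
    hence "t * Suc (qt u r t) \<le> t * q" by (rule mult_le_mono2)
    thus False using qt_dt[OF assms(1,2)] assms(3,4) by simp
  qed
  ultimately show "qt u r t = q" by simp
  thus "dt u r t = d" using qt_dt(1)[OF assms(1,2)] assms(3) by simp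
qed

section \<open>The index sets of the table: thresholds, disjointness, covering\<close>

context
  fixes u r :: nat
  assumes r2: "2 \<le> r" and ru: "r < u"
begin

lemma le_tmax_iff: "t \<le> tmax u r \<longleftrightarrow> t \<le> u - r \<and> 2 * t < r"
  using r2 by (auto simp: tmax_def)

text \<open>The substitution u + d_t = t q_t + r clears the subtractions of natural numbers; the
  same is done for c_t below.\<close>

lemma kt_le_iff:
  assumes "0 < t" "t \<le> tmax u r"
  shows "kt u r t \<le> k \<longleftrightarrow> t * qt u r t + r + 1 \<le> k * Suc (qt u r t) + t"
proof -
  have t: "2 * t < r" using assms le_tmax_iff by blast
  have "kt u r t = nat \<lceil>real (u + 1 - t + dt u r t) / real (qt u r t + 1)\<rceil>"
    using assms(1) by (simp add: kt_def)
  moreover have "nat \<lceil>real (u + 1 - t + dt u r t) / real (qt u r t + 1)\<rceil> \<le> k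
      \<longleftrightarrow> u + 1 - t + dt u r t \<le> k * (qt u r t + 1)"
    by (rule nat_ceiling_divide_le_iff) simp
  ultimately have "kt u r t \<le> k \<longleftrightarrow> u + 1 - t + dt u r t \<le> k * (qt u r t + 1)" by (simp only:)
  moreover have "u + 1 - t + dt u r t + t = t * qt u r t + r + 1"
    using qt_dt(1)[OF assms(1) ru] t ru by simp
  ultimately show ?thesis unfolding Suc_eq_plus1 by linarith
qed

lemma ct_le_iff:
  assumes "0 < t" "t \<le> tmax u r" "0 < dt u r t"
  shows "ct u r t \<le> k \<longleftrightarrow> t * qt u r t + r \<le> k * qt u r t + 2 * t"
proof -
  have t: "2 * t < r" using assms le_tmax_iff by blast
  have "ct u r t = nat \<lceil>real (u - 2 * t + dt u r t) / real (qt u r t)\<rceil>"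
    using assms(3) by (simp add: ct_def)
  hence "ct u r t \<le> k \<longleftrightarrow> u - 2 * t + dt u r t \<le> k * qt u r t"
    by (simp only: nat_ceiling_divide_le_iff[OF qt_dt(3)[OF assms(1) ru]])
  moreover have "u - 2 * t + dt u r t + 2 * t = t * qt u r t + r"
    using qt_dt(1)[OF assms(1) ru] t ru by simp
  ultimately show ?thesis by linarith
qed

lemma kt_gt:
  assumes "0 < t" "t \<le> tmax u r"
  shows "t < kt u r t"
proof (rule ccontr)
  assume "\<not> t < kt u r t"
  hence "t * qt u r t + r + 1 \<le> t * Suc (qt u r t) + t" using kt_le_iff[OF assms, of t] by simp
  thus False using assms le_tmax_iff by simp
qed

lemma kt_le_ct:
  assumes "0 < t" "t \<le> tmax u r"
  shows "kt u r t \<le> ct u r t"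
proof (cases "dt u r t = 0")
  case False
  define k q where "k = ct u r t" and "q = qt u r t"
  have 1: "t * q + r \<le> k * q + 2 * t" using ct_le_iff[OF assms, of k] False by (simp add: k_def q_def)
  have t: "2 * t < r" using assms le_tmax_iff by blast
  have "t < k"
  proof (rule ccontr)
    assume "\<not> t < k"
    hence "k * q \<le> t * q" by simp
    thus False using 1 t by linarith
  qed
  hence "t * q + r + 1 \<le> k * Suc q + t" using 1 by simp
  thus ?thesis using kt_le_iff[OF assms, of k] by (simp add: k_def q_def)
qed (simp add: ct_def)

lemma ct_le:
  assumes "0 < t" "t \<le> tmax u r"
  shows "ct u r t \<le> r - t"
proof -
  define q where "q = qt u r t"
  have q: "0 < q" using qt_dt(3)[OF assms(1) ru] by (simp add: q_def)
  have t: "2 * t < r" using assms le_tmax_iff by blast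
  define s where "s = r - 2 * t"
  have s: "r - t = t + s" "r = 2 * t + s" "0 < s" using t by (simp_all add: s_def)
  have sq: "s \<le> s * q" using q by simp
  show ?thesis
  proof (cases "dt u r t = 0")
    case True
    have "t * q + r + 1 \<le> (r - t) * Suc q + t" unfolding s(1) using s(2,3) sq by (simp add: algebra_simps)
    thus ?thesis using kt_le_iff[OF assms, of "r - t"] True by (simp add: q_def ct_def)
  next
    case False
    have "t * q + r \<le> (r - t) * q + 2 * t" unfolding s(1) using s(2) sq by (simp add: algebra_simps)
    thus ?thesis using ct_le_iff[OF assms, of "r - t"] False by (simp add: q_def)
  qed
qed

text \<open>With k = t + m the condition k_t \<le> k reads r + 1 \<le> m (q_t + 1) + 2 t. Passing
  from t + 1 to t at the same k raises m by one and does not lower q_t, which makes up for the loss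
  of 2 because q_t + 1 is at least 2.\<close>

lemma kt_mono:
  assumes "t \<le> t'" "t' \<le> tmax u r"
  shows "kt u r t \<le> kt u r t'"
  using assms
proof (induct rule: dec_induct)
  case (step t')
  have "kt u r t' \<le> kt u r (Suc t')"
  proof (cases "t' = 0")
    case True
    have "0 < kt u r (Suc t')" using kt_gt[of "Suc t'"] step by simp
    moreover have "kt u r t' = 1" using True by (simp add: kt_def)
    ultimately show ?thesis by linarith
  next
    case False
    have t': "0 < t'" "t' \<le> tmax u r" using False step by simp_all
    define q q' where "q = qt u r t'" and "q' = qt u r (Suc t')"
    have "u - r \<le> q * t'" using qt_le_iff[OF t'(1)] by (auto simp: q_def)
    hence qq: "q' \<le> q" using qt_le_iff[of "Suc t'" u r q] by (simp add: q'_def)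
    have q': "0 < q'" using qt_dt(3)[OF _ ru] by (simp add: q'_def)
    define m where "m = kt u r (Suc t') - Suc t'"
    have k: "kt u r (Suc t') = Suc t' + m" using kt_gt[of "Suc t'"] step by (simp add: m_def)
    have "Suc t' * q' + r + 1 \<le> (Suc t' + m) * Suc q' + Suc t'"
      using kt_le_iff[of "Suc t'" "Suc t' + m"] step k by (simp add: q'_def)
    hence "r + 1 \<le> m * Suc q' + 2 * t' + 2" by (simp add: algebra_simps)
    moreover have "m * Suc q' \<le> m * Suc q" using qq by simp
    moreover have "(Suc t' + m) * Suc q = t' * q + t' + Suc q + m * Suc q" by (simp add: algebra_simps)
    ultimately have "t' * q + r + 1 \<le> (Suc t' + m) * Suc q + t'" using q' qq by linarith
    thus ?thesis using kt_le_iff[OF t', of "Suc t' + m"] k by (simp add: q_def)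
  qed
  thus ?case using step by simp
qed simp

lemma B_set_kt_le:
  assumes "(k, l) \<in> B_set u r t"
  shows "0 < t" "t \<le> tmax u r" "kt u r t \<le> k" "ct u r t \<le> k" "k \<le> r - t" "t \<le> l" "l = t \<or> k = r - t"
proof -
  show t: "0 < t" "t \<le> tmax u r" using assms by (auto simp: B_set_def split: if_splits)
  note kt_le_ct[OF t] ct_le[OF t]
  thus "kt u r t \<le> k" "ct u r t \<le> k" "k \<le> r - t" "t \<le> l" "l = t \<or> k = r - t"
    using assms t by (auto simp: B_set_def)
qed

lemma C_setD:
  assumes "(k, l) \<in> C_set u r t"
  shows "0 < t" "t \<le> tmax u r" "l = t" "kt u r t \<le> k" "k < ct u r t"
  using assms by (auto simp: C_set_def split: if_splits)

lemma A_setD: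
  assumes "(k, l) \<in> A_set u r t" "t \<le> tmax u r + 1"
  shows "t \<le> l" "t \<le> tmax u r \<Longrightarrow> kt u r (t - 1) \<le> k \<and> k < kt u r t"
    "\<not> t \<le> tmax u r \<Longrightarrow> t = Suc (tmax u r) \<and> k = r - t"
  using assms by (auto simp: A_set_def split: if_splits)

lemma A_set_kt_le_imp_less:
  assumes A: "(k, l) \<in> A_set u r t" "t \<le> tmax u r + 1" and t': "0 < t'" "t' \<le> tmax u r" "kt u r t' \<le> k"
  shows "t' < t"
proof (cases "t \<le> tmax u r")
  case True
  show ?thesis
  proof (rule ccontr)
    assume "\<not> t' < t"
    hence "kt u r t \<le> kt u r t'" using kt_mono[of t t'] t' by simp
    thus False using A_setD(2)[OF A True] t' by simp
  qed
qed (use t' in simp)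

text \<open>A common cell has t' < t \<le> l, hence lies in the part k = r - t' of the B-set; but
  the cells of the A-set satisfy k \<le> r - t.\<close>

lemma A_B_disjoint:
  assumes A: "(k, l) \<in> A_set u r t" "0 < t" "t \<le> tmax u r + 1" and B: "(k, l) \<in> B_set u r t'"
  shows False
proof -
  note b = B_set_kt_le[OF B]
  have less: "t' < t" by (rule A_set_kt_le_imp_less[OF A(1,3) b(1-3)])
  hence k: "k = r - t'" using b(7) A_setD(1)[OF A(1,3)] by auto
  have t'r: "2 * t' < r" using b(2) le_tmax_iff by blast
  show False
  proof (cases "t \<le> tmax u r")
    case True
    have "k < r - t" using A_setD(2)[OF A(1,3) True] kt_le_ct[OF A(2) True] ct_le[OF A(2) True] by simp
    thus False using k less by simp
  next
    case False
    hence "k = r - t" using A_setD(3)[OF A(1,3)] by simp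
    thus False using k less t'r by simp
  qed
qed

lemma A_C_disjoint:
  assumes A: "(k, l) \<in> A_set u r t" "0 < t" "t \<le> tmax u r + 1" and C: "(k, l) \<in> C_set u r t'"
  shows False
  using A_set_kt_le_imp_less[OF A(1,3) C_setD(1,2,4)[OF C]] A_setD(1)[OF A(1,3)] C_setD(3)[OF C] by simp

lemma B_C_disjoint:
  assumes B: "(k, l) \<in> B_set u r t" and C: "(k, l) \<in> C_set u r t'"
  shows False
proof -
  note b = B_set_kt_le[OF B] and c = C_setD[OF C]
  have k: "k < r - t'" using ct_le[OF c(1,2)] c(5) by simp
  show False
  proof (cases "l = t")
    case True
    thus False using b(4) c(3,5) by simp
  next
    case False
    thus False using b(6,7) c(3) k by simp
  qed
qed

lemma B_B_same:
  assumes B: "(k, l) \<in> B_set u r t" "(k, l) \<in> B_set u r t'"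
  shows "t = t'"
proof -
  have False if B: "(k, l) \<in> B_set u r t" "(k, l) \<in> B_set u r t'" and less: "t < t'" for t t'
  proof -
    note b = B_set_kt_le[OF B(1)] and b' = B_set_kt_le[OF B(2)]
    have "2 * t' < r" using b'(2) le_tmax_iff by blast
    thus False using b(6,7) b'(5,6) less by auto
  qed
  thus ?thesis using B by (meson nat_neq_iff)
qed

text \<open>The clause of \<open>table_entry\<close> for a single t, separated off because
  \<open>THE\<close> requires uniqueness across all t.\<close>

definition entry_at :: "nat \<Rightarrow> nat \<Rightarrow> nat \<Rightarrow> nat multiset \<Rightarrow> bool" where
  "entry_at k l t P \<longleftrightarrow>
     (k, l) \<in> A_set u r t \<and> P = almost_rect u k + almost_rect (u - r) l \<or>
     (k, l) \<in> B_set u r t \<and>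
       P = almost_rect (u - r + 2 * t) t + almost_rect (u - 2 * t) (k + l - t) \<or>
     (k, l) \<in> C_set u r t \<and>
       P = almost_rect (u - r + 2 * t) t
           + almost_rect (u - 2 * t - dt u r t * (qt u r t - 1)) (k - dt u r t)
           + replicate_mset (dt u r t) (qt u r t - 1)"

text \<open>The three kinds of sets are disjoint. The entry for an A-set does not mention t; for B
  and C the cell determines t.\<close>

lemma entry_at_unique:
  assumes "entry_at k l t P" "entry_at k l t' P'" "0 < t" "t \<le> tmax u r + 1" "0 < t'" "t' \<le> tmax u r + 1"
  shows "P = P'"
  using assms(1)[unfolded entry_at_def]
proof (elim disjE conjE)
  assume *: "(k, l) \<in> A_set u r t" "P = almost_rect u k + almost_rect (u - r) l"
  show ?thesis
    using assms(2)[unfolded entry_at_def] A_B_disjoint[OF *(1) assms(3,4)] A_C_disjoint[OF *(1) assms(3,4)] *(2)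
    by blast
next
  assume *: "(k, l) \<in> B_set u r t"
    "P = almost_rect (u - r + 2 * t) t + almost_rect (u - 2 * t) (k + l - t)"
  have "(k, l) \<in> B_set u r t'" "P' = almost_rect (u - r + 2 * t') t' + almost_rect (u - 2 * t') (k + l - t')"
    using assms(2)[unfolded entry_at_def] A_B_disjoint[OF _ assms(5,6) *(1)] B_C_disjoint[OF *(1)] by blast+
  thus ?thesis using B_B_same[OF *(1)] *(2) by blast
next
  assume *: "(k, l) \<in> C_set u r t" "P = almost_rect (u - r + 2 * t) t
           + almost_rect (u - 2 * t - dt u r t * (qt u r t - 1)) (k - dt u r t)
           + replicate_mset (dt u r t) (qt u r t - 1)"
  have "(k, l) \<in> C_set u r t'" "P' = almost_rect (u - r + 2 * t') t'
           + almost_rect (u - 2 * t' - dt u r t' * (qt u r t' - 1)) (k - dt u r t')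
           + replicate_mset (dt u r t') (qt u r t' - 1)"
    using assms(2)[unfolded entry_at_def] A_C_disjoint[OF _ assms(5,6) *(1)] B_C_disjoint[OF _ *(1)] by blast+
  moreover have "t' = t" using C_setD(3)[OF *(1)] C_setD(3)[OF calculation(1)] by simp
  ultimately show ?thesis using *(2) by blast
qed

lemma table_memI:
  assumes "entry_at k l t P" "0 < t" "t \<le> tmax u r + 1"
    and "1 \<le> k" "k \<le> r - 1" "1 \<le> l" "l \<le> u - r"
  shows "P \<in> table u r"
proof -
  have "table_entry u r k l = (THE P. \<exists>t. 1 \<le> t \<and> t \<le> tmax u r + 1 \<and> entry_at k l t P)"
    unfolding table_entry_def entry_at_def ..
  also have "\<dots> = P"
  proof (rule the_equality)
    show "\<exists>t. 1 \<le> t \<and> t \<le> tmax u r + 1 \<and> entry_at k l t P"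
      using assms(1-3) by (intro exI[of _ t]) simp
    show "P' = P" if "\<exists>t. 1 \<le> t \<and> t \<le> tmax u r + 1 \<and> entry_at k l t P'" for P'
      using that entry_at_unique[OF _ assms(1) _ _ assms(2,3)] by auto
  qed
  finally show ?thesis unfolding table_def using assms(4-7) by auto
qed

text \<open>Take the least t with k < k_t; were l < t, then k_l \<le> k_(t-1) \<le> k. If no
  threshold up to \<open>tmax u r\<close> exceeds k, then l is larger than \<open>tmax u r\<close>,
  which must therefore be (r - 1) div 2, and 2 k \<le> r leaves only the last A-set.\<close>

lemma A_set_exists:
  assumes k: "1 \<le> k" "2 * k \<le> r" and l: "1 \<le> l" "l \<le> u - r"
    and no: "\<not> (l \<le> tmax u r \<and> kt u r l \<le> k)"
  shows "\<exists>t>0. t \<le> tmax u r + 1 \<and> (k, l) \<in> A_set u r t"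
proof (cases "k < kt u r (tmax u r)")
  case True
  define t where "t = (LEAST t. k < kt u r t)"
  have t1: "k < kt u r t" unfolding t_def by (rule LeastI[of _ "tmax u r"]) (rule True)
  have t2: "t \<le> tmax u r" unfolding t_def by (rule Least_le) (rule True)
  have t0: "0 < t" using t1 k by (cases t) (simp_all add: kt_def)
  have t3: "kt u r (t - 1) \<le> k"
    using not_less_Least[of "t - 1" "\<lambda>t. k < kt u r t"] t0 unfolding t_def[symmetric] by simp
  have "t \<le> l"
  proof (rule ccontr)
    assume "\<not> t \<le> l"
    hence "kt u r l \<le> kt u r (t - 1)" using kt_mono[of l "t - 1"] t2 by simp
    thus False using no t3 t2 \<open>\<not> t \<le> l\<close> by simp
  qed
  hence "(k, l) \<in> A_set u r t" using t1 t2 t3 l by (simp add: A_set_def)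
  thus ?thesis using t0 t2 by auto
next
  case False
  define t where "t = tmax u r"
  have kt: "kt u r t \<le> k" using False by (simp add: t_def)
  have l1: "t < l"
  proof (rule ccontr)
    assume "\<not> t < l"
    hence "kt u r l \<le> kt u r t" using kt_mono[of l t] by (simp add: t_def)
    thus False using no kt \<open>\<not> t < l\<close> by (simp add: t_def)
  qed
  have "t = (r - 1) div 2" using l1 l(2) unfolding t_def tmax_def by simp
  hence "r \<le> 2 * t + 2" by linarith
  moreover have "Suc t \<le> kt u r t" using kt_gt[of t] by (cases "t = 0") (simp_all add: t_def kt_def)
  ultimately have "k = kt u r t" "k = r - Suc t" using kt k(2) by linarith+
  hence "(k, l) \<in> A_set u r (Suc t)" using l l1 by (simp add: A_set_def t_def)
  thus ?thesis by (auto simp: t_def)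
qed

end

lemma almost_rect_replicate:
  assumes "0 < p + q"
  shows "almost_rect (a * q + Suc a * p) (q + p) = replicate_mset q a + replicate_mset p (Suc a)"
proof (cases "q = 0")
  case True
  thus ?thesis using assms by (simp add: almost_rect_def)
next
  case False
  have eq: "a * q + Suc a * p = p + a * (q + p)" by (simp add: algebra_simps)
  have "(a * q + Suc a * p) mod (q + p) = p" "(a * q + Suc a * p) div (q + p) = a"
    unfolding eq using False by simp_all
  thus ?thesis by (simp add: almost_rect_def add.commute)
qed

section \<open>Partitions with a given longest chain\<close>

text \<open>\<open>uchain\<close> for the multiplicities of \<open>P\<close>, with the number of
  larger parts counted directly instead of by a sum up to a bound.\<close>

definition chain_len :: "nat multiset \<Rightarrow> nat \<Rightarrow> nat" where
  "chain_len P a = a * count P a + Suc a * count P (Suc a) + 2 * size {#x \<in># P. Suc a < x#}"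

lemma size_filter_replicate_mset: "size {#x \<in># replicate_mset n a. Q x#} = (if Q a then n else 0)"
  by (induct n) simp_all

lemmas chain_len_simps = chain_len_def size_filter_replicate_mset

context
  fixes u r :: nat and P :: "nat multiset"
  assumes r2: "2 \<le> r" and ru: "r < u"
    and le: "\<And>a. 0 < a \<Longrightarrow> a \<in># P \<or> Suc a \<in># P \<Longrightarrow> chain_len P a \<le> u"
begin

text \<open>With nothing above the chain, \<open>P\<close> is [u]^k together with [u-r]^l, so only
  membership of (k, l) in an A-set is at stake, that is, 2 k \<le> r and k < k_l whenever l \<le>
  \<open>tmax u r\<close>. If b = p + 1, the parts of size p + 1 all belong to the chain, whence the
  alternative \<open>c1 = 0\<close>.\<close>

lemma table_of_longest_chain_on_top:
  assumes P: "P = replicate_mset c0 p + replicate_mset c1 (Suc p) + replicate_mset e0 b + replicate_mset e1 (Suc b)"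
    and p: "0 < p" "p < b" "c1 = 0 \<or> Suc p < b" and c: "0 < c0" "0 < e0 + e1"
    and u: "u = b * e0 + Suc b * e1" and v: "u - r = p * c0 + Suc p * c1"
  shows "P \<in> table u r"
proof -
  define k where "k = e0 + e1"
  define l where "l = c0 + c1"
  have k: "0 < k" and l: "0 < l" using c by (simp_all add: k_def l_def)
  have v2k: "u - r + 2 * k \<le> u"
  \<comment> \<open>Compare with the chain through p and p + 1, which takes two vectors from all
    \<open>k\<close> larger parts. If b = p + 1, the chain through p - 1 and p serves instead; for p
    = 1 the parts of size 2 have weight 2 in any case.\<close>
  proof (cases "Suc p < b")
    case True
    have "chain_len P p = u - r + 2 * k"
      unfolding v k_def using True by (simp add: P chain_len_simps)
    moreover have "p \<in># P" using c by (simp add: P)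
    ultimately show ?thesis using le[OF p(1)] by simp
  next
    case False
    hence b: "b = Suc p" "c1 = 0" using p by simp_all
    show ?thesis
    proof (cases "p = 1")
      case True
      have "chain_len P 1 = u - r + 2 * k" unfolding v k_def b True by (simp add: P chain_len_simps b True)
      moreover have "1 \<in># P" using c by (simp add: P True)
      ultimately show ?thesis using le[of 1] by simp
    next
      case False
      then obtain p' where p': "p = Suc p'" "0 < p'" using p(1) by (cases p) auto
      have "chain_len P p' = u - r + 2 * k" unfolding v k_def b p'(1) by (simp add: P chain_len_simps b p'(1))
      moreover have "Suc p' \<in># P" using c by (simp add: P p'(1))
      ultimately show ?thesis using le[OF p'(2)] by simp
    qed
  qed
  have l_le: "l \<le> u - r" unfolding v l_def using p(1) by (cases p) simp_all
  have no: "\<not> (l \<le> tmax u r \<and> kt u r l \<le> k)"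
  proof
    assume *: "l \<le> tmax u r \<and> kt u r l \<le> k"
    \<comment> \<open>In [u-r]^l there are \<open>g\<close> parts of the larger size
      \<open>q\<close> and \<open>d\<close> parts of size q - 1.\<close>
    define q d g where "q = (if c1 = 0 then p else Suc p)" and "d = (if c1 = 0 then 0 else c0)"
      and "g = (if c1 = 0 then c0 else c1)"
    have "l * q = u - r + d" "d < l" "l = g + d"
      using c(1) unfolding v by (auto simp: q_def d_def g_def l_def algebra_simps)
    note qd = qt_dt_eqI[OF l ru this(1,2)] and lq = this
    have "l * q + r + 1 \<le> k * Suc q + l" using * kt_le_iff[OF r2 ru l] qd by simp
    hence 1: "u < k * Suc q + g" using lq ru by simp
    have qb: "q < b" "0 < q" using p c by (auto simp: q_def)
    have cq: "count P q = g + (if b = q then e0 else 0)" "q \<in># P"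
      using p c by (auto simp: P q_def g_def)
    show False
    proof (cases "b = Suc q")
      case True
      have "count P b = e0" using p True by (auto simp: P q_def split: if_splits)
      moreover have "size {#x \<in># P. Suc q < x#} = e1"
        using p True by (auto simp: P size_filter_replicate_mset q_def)
      ultimately have "chain_len P q = q * g + b * e0 + 2 * e1"
        using cq(1) True by (simp add: chain_len_def)
      hence "q * g + 2 * e1 \<le> Suc b * e1" using le[OF qb(2)] cq(2) u by simp
      hence "q * g \<le> q * e1" using True by simp
      hence "g \<le> e1" using qb(2) by simp
      thus False using 1 u True by (simp add: k_def algebra_simps)
    next
      case False
      hence "Suc (Suc q) \<le> b" using qb by simp
      hence "Suc (Suc q) * e0 \<le> b * e0" "Suc (Suc q) * e1 \<le> Suc b * e1" by (intro mult_le_mono1; simp)+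
      hence 2: "k * Suc (Suc q) \<le> u" unfolding u k_def by (simp add: algebra_simps)
      hence kg: "k < g" using 1 by simp
      hence kl: "k < l" using lq by simp
      have "l * q + 2 * k < k * Suc q + g + d" using 1 v2k lq(1) by linarith
      hence "l * q + k < k * q + l" using lq(3) by simp
      moreover obtain m where "l = k + m" "0 < m" using kl by (metis less_imp_add_positive)
      ultimately have "m * q < m" by (simp add: algebra_simps)
      thus False using qb(2) by simp
    qed
  qed
  have "2 * k \<le> r" using v2k ru by simp
  then obtain t where t: "0 < t" "t \<le> tmax u r + 1" "(k, l) \<in> A_set u r t"
    using A_set_exists[OF r2 ru _ _ _ l_le no] k l by auto
  have "P = almost_rect u k + almost_rect (u - r) l"
  proof -
    have "almost_rect u k = replicate_mset e0 b + replicate_mset e1 (Suc b)"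
      unfolding u k_def by (rule almost_rect_replicate) (use c in linarith)
    moreover have "almost_rect (u - r) l = replicate_mset c0 p + replicate_mset c1 (Suc p)"
      unfolding v l_def by (rule almost_rect_replicate) (use c in simp)
    ultimately show ?thesis by (simp add: P)
  qed
  hence "entry_at u r k l t P" using t(3) by (simp add: entry_at_def[OF r2 ru])
  thus ?thesis by (rule table_memI[OF r2 ru _ t(1,2)]) (use k l l_le \<open>2 * k \<le> r\<close> r2 in simp_all)
qed

text \<open>Lowered by 2, the t parts above the chain form [u-r]^t, so \<open>P\<close> is
  ([u-r+2t]^t, [u-2t]^k0). The cell is found from k + l - t = k0: it is (k0, t) as long as k0 \<le>
  r - t, and otherwise it lies in the part k = r - t. The main point is c_t \<le> k0.\<close>

lemma table_of_longest_chain_at_bottom: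
  assumes P: "P = replicate_mset c0 b + replicate_mset c1 (Suc b) + replicate_mset f0 m + replicate_mset f1 (Suc m)"
    and b: "0 < b" "Suc b < m" and c: "0 < c0 + c1" "0 < f0"
    and u: "u = b * c0 + Suc b * c1 + 2 * (f0 + f1)"
    and v: "m * f0 + Suc m * f1 = u - r + 2 * (f0 + f1)"
    and strict: "\<And>a. 0 < a \<Longrightarrow> a \<in># P \<or> Suc a \<in># P \<Longrightarrow> (\<And>x. x \<in># P \<Longrightarrow> x \<le> Suc a) \<Longrightarrow> chain_len P a < u"
  shows "P \<in> table u r"
proof -
  define t where "t = f0 + f1"
  define k0 where "k0 = c0 + c1"
  have t0: "0 < t" using c by (simp add: t_def)
  have m0: "0 < m" and mP: "m \<in># P" using b c by (simp_all add: P)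
  \<comment> \<open>The chain through the two top sizes has no part above it, so strictness applies;
    it will give 2 t < r.\<close>
  have "chain_len P m < u"
    by (rule strict[OF m0]) (use mP b in \<open>auto simp: P split: if_splits\<close>)
  moreover have "chain_len P m = m * f0 + Suc m * f1" using b by (simp add: P chain_len_simps)
  ultimately have vt: "u - r + 2 * t < u" using v by (simp add: t_def)
  hence tr: "2 * t < r" by simp
  have "3 * t \<le> m * t" using b by (intro mult_le_mono1) simp
  moreover have vt': "u - r + 2 * t = m * t + f1" using v by (simp add: t_def algebra_simps)
  ultimately have tv: "t \<le> u - r" by linarith
  have tmax: "t \<le> tmax u r" using le_tmax_iff[OF r2 ru] tr tv by blast
  define q d where "q = (if f1 = 0 then m - 2 else m - 1)" and "d = (if f1 = 0 then 0 else f0)"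
  have "t * q = u - r + d" "d < t"
  proof -
    define m' where "m' = m - 2"
    have m': "m = Suc (Suc m')" using b by (simp add: m'_def)
    have e: "u - r = t * m' + f1" using vt' unfolding m' by (simp add: mult.commute)
    show "t * q = u - r + d"
    proof (cases "f1 = 0")
      case True
      thus ?thesis using e by (simp add: q_def d_def m')
    next
      case False
      have "t * q = t + t * m'" using False by (simp add: q_def m')
      thus ?thesis using e False by (simp add: d_def t_def)
    qed
    show "d < t" using c by (auto simp: d_def t_def)
  qed
  note tq = this
  note qd = qt_dt_eqI[OF t0 ru tq]
  have uk: "u = b * k0 + c1 + 2 * t" using u by (simp add: k0_def t_def algebra_simps)
  \<comment> \<open>For d_t = 0 the rival chain runs through q + 1 and q + 2 = m and must be
    strictly shorter; for d_t > 0 it runs through q and q + 1 = m, with \<open>f1\<close> parts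
    above it, and may be equally long.\<close>
  have ct: "ct u r t \<le> k0"
  proof (cases "f1 = 0")
    case True
    have dd: "d = 0" "m = Suc (Suc q)" "f0 = t" using True b by (simp_all add: d_def q_def t_def)
    have "u + 1 \<le> k0 * Suc q + t"
    proof (cases "b = q")
      case True
      have "chain_len P (Suc q) < u"
        by (rule strict) (use mP b dd \<open>f1 = 0\<close> in \<open>auto simp: P split: if_splits\<close>)
      moreover have "chain_len P (Suc q) = Suc q * c1 + m * t"
        using \<open>f1 = 0\<close> dd True by (simp add: P chain_len_simps)
      ultimately have "m * t < q * c0 + 2 * t" using u dd \<open>f1 = 0\<close> True by simp
      hence "q * t < q * c0" using dd by simp
      hence "t < c0" by simp
      thus ?thesis using u True dd \<open>f1 = 0\<close> by (simp add: k0_def algebra_simps)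
    next
      case False
      hence bq: "Suc b \<le> q" using b dd by simp
      hence "Suc b * k0 \<le> q * k0" by (rule mult_le_mono1)
      moreover have "u \<le> Suc b * k0 + 2 * t" using uk by (simp add: k0_def)
      ultimately have uq: "u \<le> q * k0 + 2 * t" by linarith
      hence "t * q < q * k0" using vt tq dd by linarith
      hence "t < k0" by (simp add: mult.commute)
      thus ?thesis using uq by (simp add: mult.commute)
    qed
    hence "t * qt u r t + r + 1 \<le> k0 * Suc (qt u r t) + t" using qd tq(1) dd ru by simp
    hence "kt u r t \<le> k0" using kt_le_iff[OF r2 ru t0 tmax] by blast
    thus ?thesis using qd(2) dd by (simp add: ct_def)
  next
    case False
    have dd: "d = f0" "m = Suc q" using False b by (simp_all add: d_def q_def)
    have bq: "Suc b \<le> q" "0 < q" using b dd by simp_all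
    have sz: "size {#x \<in># P. Suc q < x#} = f1" using b dd by (simp add: P size_filter_replicate_mset)
    have chain: "chain_len P q \<le> u" by (rule le[OF bq(2)]) (use mP dd in simp)
    have "u + d \<le> k0 * q + 2 * t"
    proof (cases "Suc b = q")
      case True
      have m: "m = Suc (Suc b)" using dd(2) True by simp
      have "count P (Suc b) = c1" "count P m = f0" using b by (simp_all add: P)
      hence cq: "count P q = c1" "count P (Suc q) = f0" by (simp_all only: True dd(2))
      have "chain_len P q = q * c1 + m * f0 + 2 * f1" by (simp only: chain_len_def sz cq dd(2))
      hence "Suc b * c1 + m * f0 + 2 * f1 \<le> u" using chain unfolding True by simp
      hence "m * f0 \<le> b * c0 + 2 * f0" unfolding u by simp
      hence "b * f0 \<le> b * c0" unfolding m by simp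
      hence "d \<le> c0" using b(1) dd(1) by simp
      moreover have "k0 * q = b * k0 + c0 + c1" unfolding True[symmetric] k0_def by simp
      ultimately show ?thesis using uk by simp
    next
      case False
      hence bq': "Suc b \<le> q - 1" using bq by simp
      hence "Suc b * k0 \<le> (q - 1) * k0" by (rule mult_le_mono1)
      moreover have "u \<le> Suc b * k0 + 2 * t" using uk by (simp add: k0_def)
      ultimately have uq: "u \<le> (q - 1) * k0 + 2 * t" by linarith
      have "count P q = 0" "count P (Suc q) = f0" using bq' b dd by (auto simp: P)
      hence "chain_len P q = m * f0 + 2 * f1" using sz dd by (simp add: chain_len_def)
      hence "m * f0 \<le> (q - 1) * k0 + 2 * f0" using chain uq by (simp add: t_def)
      moreover have "m * f0 = (q - 1) * f0 + 2 * f0" using dd bq by (cases q) simp_all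
      ultimately have "(q - 1) * f0 \<le> (q - 1) * k0" by linarith
      hence "d \<le> k0" using bq' dd by simp
      moreover have "k0 * q = (q - 1) * k0 + k0" using bq by (cases q) simp_all
      ultimately show ?thesis using uq by linarith
    qed
    hence "t * qt u r t + r \<le> k0 * qt u r t + 2 * t" using qd tq(1) ru by simp
    moreover have "0 < dt u r t" using qd(2) dd c by simp
    ultimately show ?thesis using ct_le_iff[OF r2 ru t0 tmax] by blast
  qed
  have "k0 \<le> b * k0" using b(1) by simp
  hence k0_le: "k0 + 2 * t \<le> u" using uk by linarith
  have k0: "0 < k0" using c by (simp add: k0_def)
  have PP: "P = almost_rect (u - r + 2 * t) t + almost_rect (u - 2 * t) k0"
  proof -
    have "almost_rect (u - r + 2 * t) t = replicate_mset f0 m + replicate_mset f1 (Suc m)"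
      unfolding t_def v[symmetric] by (rule almost_rect_replicate) (use c in simp)
    moreover have "u - 2 * t = b * c0 + Suc b * c1" using u by (simp add: t_def)
    hence "almost_rect (u - 2 * t) k0 = replicate_mset c0 b + replicate_mset c1 (Suc b)"
      unfolding k0_def by (simp only:) (rule almost_rect_replicate, use c in linarith)
    ultimately show ?thesis by (simp add: P)
  qed
  show ?thesis
  proof (cases "k0 \<le> r - t")
    case True
    have "(k0, t) \<in> B_set u r t" using t0 tmax ct True by (simp add: B_set_def)
    hence "entry_at u r k0 t t P" using PP by (simp add: entry_at_def[OF r2 ru])
    thus ?thesis
      by (rule table_memI[OF r2 ru _ t0]) (use tmax k0 True t0 tv in auto)
  next
    case False
    define l where "l = k0 + 2 * t - r"
    have l: "t < l" "l \<le> u - r" "r - t + l - t = k0" using False tr k0_le by (simp_all add: l_def)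
    have "(r - t, l) \<in> B_set u r t" using t0 tmax l by (simp add: B_set_def)
    hence "entry_at u r (r - t) l t P" using PP l(3) by (simp add: entry_at_def[OF r2 ru])
    thus ?thesis
      by (rule table_memI[OF r2 ru _ t0]) (use tmax t0 tr l in auto)
  qed
qed

text \<open>Removing the chain leaves \<open>d\<close> parts b and \<open>f\<close> parts b + 1, so
  q_t = b + 1, d_t = d and t = f + d. The two rival chains, through b, b + 1 and through b + 2, b +
  3, are shorter exactly when d < c1 and f < c0, and these are the inequalities k < c_t and k_t
  \<le> k of the C-set.\<close>

lemma table_of_longest_chain_in_middle:
  assumes P: "P = replicate_mset d b + replicate_mset c0 (Suc b) + replicate_mset c1 (Suc (Suc b)) + replicate_mset f (Suc (Suc (Suc b)))"
    and b: "0 < b" and d: "0 < d" and f: "0 < f"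
    and u: "u = Suc b * c0 + Suc (Suc b) * c1 + 2 * f"
    and v: "b * d + Suc (Suc (Suc b)) * f = u - r + 2 * f"
    and strict1: "chain_len P b < u" and strict2: "chain_len P (Suc (Suc b)) < u"
  shows "P \<in> table u r"
proof -
  have "chain_len P b = b * d + Suc b * c0 + 2 * (c1 + f)" by (simp add: P chain_len_simps)
  hence "b * d < b * c1" using strict1 u by simp
  hence dc: "d < c1" by simp
  have "chain_len P (Suc (Suc b)) = Suc (Suc b) * c1 + Suc (Suc (Suc b)) * f" by (simp add: P chain_len_simps)
  hence "Suc b * f < Suc b * c0" using strict2 u by simp
  hence fc: "f < c0" using mult_less_cancel1 by blast
  define q t k where "q = Suc b" and "t = f + d" and "k = c0 + c1"
  have t0: "0 < t" using d by (simp add: t_def)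
  have vv: "u - r = b * d + Suc b * f" using v by simp
  have tq: "t * q = u - r + d" "d < t" using vv f by (simp_all add: t_def q_def algebra_simps)
  note qd = qt_dt_eqI[OF t0 ru tq]
  have tv: "t \<le> u - r"
  proof -
    have "d \<le> b * d" "f \<le> Suc b * f" using b by simp_all
    thus ?thesis unfolding vv t_def by linarith
  qed
  obtain x y where xy: "c0 = f + 1 + x" "c1 = d + 1 + y"
    using fc dc by (metis Suc_eq_plus1 add_Suc less_iff_Suc_add add.right_neutral add_Suc_right)
  have "u = (b * d + Suc b * f) + (Suc b * Suc x + Suc (Suc b) * Suc y + 2 * d + 2 * f)"
    unfolding u xy by (simp add: algebra_simps)
  hence "r = Suc b * Suc x + Suc (Suc b) * Suc y + 2 * d + 2 * f" using vv ru by linarith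
  hence tr: "2 * t < r" by (simp add: t_def)
  have tmax: "t \<le> tmax u r" using le_tmax_iff[OF r2 ru] tr tv by blast
  have uk: "k * Suc q = u - 2 * f + c0" using u by (simp add: k_def q_def algebra_simps)
  have f2: "2 * f \<le> u" using u by simp
  have "t * q + r + 1 \<le> k * Suc q + t" using uk f2 tq(1) fc ru by (simp add: t_def)
  hence kt: "kt u r t \<le> k" using kt_le_iff[OF r2 ru t0 tmax] qd by simp
  have "k * q + c1 = u - 2 * f" using u by (simp add: k_def q_def algebra_simps)
  hence "\<not> t * q + r \<le> k * q + 2 * t" using f2 tq(1) dc ru by (simp add: t_def)
  hence "\<not> ct u r t \<le> k" using ct_le_iff[OF r2 ru t0 tmax] qd d by simp
  hence ct: "k < ct u r t" by simp
  have C: "(k, t) \<in> C_set u r t" using t0 tmax kt ct by (simp add: C_set_def)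
  \<comment> \<open>In the table entry \<open>d\<close> of the parts b + 2 are grouped with the
    parts b + 3, and the remaining ones with the parts b + 1.\<close>
  have "almost_rect (u - r + 2 * t) t = replicate_mset d (Suc (Suc b)) + replicate_mset f (Suc (Suc (Suc b)))"
  proof -
    have "u - r + 2 * t = Suc (Suc b) * d + Suc (Suc (Suc b)) * f" unfolding vv t_def by (simp add: algebra_simps)
    moreover have "t = d + f" by (simp add: t_def)
    ultimately show ?thesis by (simp only:) (rule almost_rect_replicate, use d in simp)
  qed
  moreover have "almost_rect (u - 2 * t - d * (q - 1)) (k - d) =
      replicate_mset c0 (Suc b) + replicate_mset (c1 - d) (Suc (Suc b))"
  proof -
    obtain z where z: "c1 = d + z" using dc by (metis less_imp_add_positive)
    have "u - 2 * t - d * (q - 1) = Suc b * c0 + Suc (Suc b) * z"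
      unfolding u t_def q_def z by (simp add: algebra_simps)
    moreover have "k - d = c0 + z" by (simp add: k_def z)
    moreover have "c1 - d = z" by (simp add: z)
    ultimately show ?thesis by (simp only:) (rule almost_rect_replicate, use fc in simp)
  qed
  moreover have "replicate_mset c1 (Suc (Suc b)) = replicate_mset d (Suc (Suc b)) + replicate_mset (c1 - d) (Suc (Suc b))"
    by (rule multiset_eqI) (use dc in simp)
  ultimately have "P = almost_rect (u - r + 2 * t) t + almost_rect (u - 2 * t - d * (q - 1)) (k - d)
      + replicate_mset d (q - 1)" by (simp add: P q_def)
  hence "entry_at u r k t t P" using C qd by (simp add: entry_at_def[OF r2 ru])
  moreover have "k \<le> r - t" using ct ct_le[OF r2 ru t0 tmax] by simp
  moreover have "1 \<le> k" using fc by (simp add: k_def)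
  ultimately show ?thesis
    by (intro table_memI[OF r2 ru _ t0]) (use tmax t0 tv in auto)
qed

end

section \<open>From the chain conditions to the three shapes\<close>

lemma size_filter_Suc: "size {#x \<in># P. a < x#} = count P (Suc a) + size {#x \<in># P. Suc a < x#}"
  by (induct P) auto

lemma sum_count_eq_size_filter:
  fixes P :: "nat multiset"
  assumes "\<And>x. x \<in># P \<Longrightarrow> x \<le> N"
  shows "sum (count P) {a<..N} = size {#x \<in># P. a < x#}"
proof -
  have "size {#x \<in># P. a < x#} = (\<Sum>x\<in>set_mset {#x \<in># P. a < x#}. count {#x \<in># P. a < x#} x)"
    by (rule size_multiset_overloaded_eq)
  also have "\<dots> = (\<Sum>x\<in>{a<..N}. count {#x \<in># P. a < x#} x)"
    by (rule sum.mono_neutral_left) (use assms in \<open>auto simp: count_eq_zero_iff\<close>)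
  also have "\<dots> = sum (count P) {a<..N}" by (rule sum.cong) simp_all
  finally show ?thesis ..
qed

text \<open>The middle values \<open>b\<close> and \<open>c\<close> may coincide and are then
  counted once, as happens when the smallest part plus 1 is the lower size of the chain.\<close>

lemma multiset_eq_four_replicates:
  assumes "\<And>x. x \<in># P \<Longrightarrow> x = a \<or> x = b \<or> x = c \<or> x = d"
    and "a \<noteq> b" "a \<noteq> c" "a \<noteq> d" "b \<noteq> d" "c \<noteq> d"
  shows "P = replicate_mset (count P a) a + replicate_mset (if b = c then 0 else count P b) b
     + replicate_mset (count P c) c + replicate_mset (count P d) d"
proof (rule multiset_eqI)
  fix x
  show "count P x = count (replicate_mset (count P a) a + replicate_mset (if b = c then 0 else count P b) b
     + replicate_mset (count P c) c + replicate_mset (count P d) d) x"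
  proof (cases "x \<in># P")
    case True
    thus ?thesis using assms(1)[OF True] assms(2-6) by auto
  next
    case False
    hence "count P x = 0" by (simp add: not_in_iff)
    thus ?thesis by auto
  qed
qed

text \<open>The three cases of the proof, according to whether a longest chain of \<open>P\<close> can be chosen with no
  part above its two sizes, with no part below them, or neither, give the entries of the sets A, B
  and C respectively.\<close>

lemma partition_in_table:
  fixes P :: "nat multiset"
  assumes r2: "2 \<le> r" and ru: "r < u" and P0: "0 \<notin># P" and sum: "sum_mset P = u + (u - r)"
    and le: "\<And>a. 0 < a \<Longrightarrow> a \<in># P \<or> Suc a \<in># P \<Longrightarrow> chain_len P a \<le> u"
    and ge: "\<exists>b. u \<le> chain_len P b"
    and sep: "\<And>p q s. p \<in># P \<Longrightarrow> q \<in># P \<Longrightarrow> s \<in># P \<Longrightarrow> p + 2 \<le> q \<Longrightarrow> q + 2 \<le> s \<Longrightarrow> False"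
  shows "P \<in> table u r"
proof -
  have pos: "0 < x" if "x \<in># P" for x using P0 that by (cases x) auto
  define maxi where "maxi b \<longleftrightarrow> 0 < b \<and> (b \<in># P \<or> Suc b \<in># P) \<and> chain_len P b = u" for b
  have cnt: "0 < count P x" if "x \<in># P" for x using that by simp
  have cnt0: "count P x = 0" if "x \<notin># P" for x using that by (simp add: not_in_iff)
  have top0: "size {#x \<in># P. a < x#} = 0" if "\<And>x. x \<in># P \<Longrightarrow> x \<le> a" for a
  proof -
    have "set_mset {#x \<in># P. a < x#} = {}" using that by (auto simp: not_less)
    thus ?thesis by simp
  qed
  have "\<exists>b. maxi b"
  proof -
    obtain b0 where b0: "u \<le> chain_len P b0" using ge by blast
    \<comment> \<open>A chain starting at 0 is as long as the one starting at 1, so the lower size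
      may be taken positive.\<close>
    have "chain_len P 0 = chain_len P 1"
      using size_filter_Suc[of 1 P] by (simp add: chain_len_def)
    then obtain b where b: "0 < b" "u \<le> chain_len P b" using b0 by (cases b0) auto
    have "b \<in># P \<or> Suc b \<in># P"
    proof (rule ccontr)
      assume no: "\<not> ?thesis"
      hence cl: "chain_len P b = 2 * size {#x \<in># P. Suc b < x#}"
        by (simp add: chain_len_def not_in_iff)
      let ?F = "{x. x \<in># P \<and> Suc b < x}"
      have "size {#x \<in># P. Suc b < x#} \<noteq> 0" using b(2) cl ru by linarith
      hence "set_mset {#x \<in># P. Suc b < x#} \<noteq> {}" by simp
      hence F: "finite ?F" "?F \<noteq> {}" by simp_all
      \<comment> \<open>If neither size occurs, the chain starting at the smallest larger part
        \<open>m\<close> is strictly longer, since m exceeds 2.\<close>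
      define m where "m = Min ?F"
      have m: "m \<in># P" "Suc b < m" using Min_in[OF F] by (simp_all add: m_def)
      have m_le: "m \<le> x" if "x \<in># P" "Suc b < x" for x using Min_le[OF F(1)] that by (simp add: m_def)
      obtain m' where m': "m = Suc m'" using m by (cases m) auto
      have "{#x \<in># P. Suc b < x#} = {#x \<in># P. m' < x#}"
        by (rule filter_mset_cong) (use m m' m_le in \<open>auto simp: Suc_le_eq\<close>)
      hence "chain_len P b = 2 * (count P m + (count P (Suc m) + size {#x \<in># P. Suc m < x#}))"
        using cl size_filter_Suc[of m' P] size_filter_Suc[of m P] m' by simp
      also have "\<dots> < chain_len P m"
      proof -
        have "2 * count P m < m * count P m" using m b(1) by simp
        moreover have "2 * count P (Suc m) \<le> Suc m * count P (Suc m)" by (rule mult_le_mono1) (use m in simp)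
        ultimately show ?thesis unfolding chain_len_def distrib_left by linarith
      qed
      also have "\<dots> \<le> u" by (rule le) (use m in auto)
      finally show False using b(2) by simp
    qed
    moreover from this have "chain_len P b = u" using le[OF b(1)] b(2) by simp
    ultimately show ?thesis using b(1) by (auto simp: maxi_def)
  qed
  then obtain b0 where b0: "maxi b0" by blast
  show ?thesis
  proof (cases "\<exists>b. maxi b \<and> (\<forall>x. x \<in># P \<longrightarrow> x \<le> Suc b)")
    case True
    then obtain b where "maxi b" and top: "\<And>x. x \<in># P \<Longrightarrow> x \<le> Suc b" by blast
    hence b: "0 < b" "b \<in># P \<or> Suc b \<in># P" "chain_len P b = u" by (simp_all add: maxi_def)
    have u: "u = b * count P b + Suc b * count P (Suc b)"
      using b(3) top0[OF top] by (simp add: chain_len_def)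
    have "\<exists>x. x \<in># P \<and> x < b"
    proof (rule ccontr)
      assume no: "\<not> ?thesis"
      have "x = b \<or> x = Suc b" if "x \<in># P" for x using no top[OF that] that by (meson le_SucE le_less not_le)
      hence "P = replicate_mset (count P b) b + replicate_mset (count P (Suc b)) (Suc b)"
        by (intro multiset_eqI) (metis add.left_neutral add.right_neutral cnt0 count_replicate_mset count_union n_not_Suc_n)
      from arg_cong[OF this, of sum_mset] have "sum_mset P = b * count P b + Suc b * count P (Suc b)"
        by (simp add: mult.commute)
      thus False using sum u ru by simp
    qed
    then obtain x0 where x0: "x0 \<in># P" "x0 < b" by blast
    define p where "p = Min (set_mset P)"
    have p_le: "p \<le> x" if "x \<in># P" for x using that by (simp add: p_def)
    have "set_mset P \<noteq> {}" using x0 by auto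
    hence p: "p \<in># P" unfolding p_def by (intro Min_in) simp_all
    have pb: "p < b" using p_le[OF x0(1)] x0(2) by simp
    \<comment> \<open>Any other part x would lie between p + 1 and b; separation then excludes b + 1
      and forces x = b - 1, and the chain through x and b is longer than \<open>u\<close>.\<close>
    have shape: "x = p \<or> x = Suc p \<or> x = b \<or> x = Suc b" if x: "x \<in># P" for x
    proof (rule ccontr)
      assume no: "\<not> ?thesis"
      have px: "p + 2 \<le> x" using p_le[OF x] no by simp
      have xb: "x < b" using top[OF x] no by simp
      have Sb: "Suc b \<notin># P" using sep[OF p x _ px, of "Suc b"] xb by auto
      hence bP: "b \<in># P" using b by simp
      have "\<not> x + 2 \<le> b" using sep[OF p x bP px] by blast
      hence xb': "b = Suc x" using xb by simp
      have "size {#y \<in># P. b < y#} = 0"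
        using size_filter_Suc[of b P] top0[OF top] cnt0[OF Sb] by simp
      hence "chain_len P x = x * count P x + b * count P b" by (simp add: chain_len_def xb')
      moreover have "u = b * count P b" using u cnt0[OF Sb] by simp
      moreover have "0 < x * count P x" using cnt[OF x] px by simp
      moreover have "chain_len P x \<le> u" by (rule le) (use x px in auto)
      ultimately show False by linarith
    qed
    define c1 where "c1 = (if Suc p = b then 0 else count P (Suc p))"
    have PP: "P = replicate_mset (count P p) p + replicate_mset c1 (Suc p)
        + replicate_mset (count P b) b + replicate_mset (count P (Suc b)) (Suc b)"
      unfolding c1_def by (rule multiset_eq_four_replicates[OF shape]) (use pb in simp_all)
    have "sum_mset P = p * count P p + Suc p * c1 + (b * count P b + Suc b * count P (Suc b))"
      by (subst PP) (simp add: algebra_simps)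
    hence v: "u - r = p * count P p + Suc p * c1" using sum u by simp
    show ?thesis
      by (rule table_of_longest_chain_on_top[OF r2 ru le PP pos[OF p] pb _ cnt[OF p] _ u v])
         (use b(2) pb in \<open>auto simp: c1_def\<close>)
  next
    case notA: False
    have strict: "chain_len P a < u" if "0 < a" "a \<in># P \<or> Suc a \<in># P" "\<And>x. x \<in># P \<Longrightarrow> x \<le> Suc a" for a
      using notA le[OF that(1,2)] that by (auto simp: maxi_def le_less)
    show ?thesis
    proof (cases "\<exists>b. maxi b \<and> (\<forall>x. x \<in># P \<longrightarrow> b \<le> x)")
      case True
      then obtain b where "maxi b" and bot: "\<And>x. x \<in># P \<Longrightarrow> b \<le> x" by blast
      hence b: "0 < b" "b \<in># P \<or> Suc b \<in># P" "chain_len P b = u" by (simp_all add: maxi_def)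
      let ?F = "{x. x \<in># P \<and> Suc b < x}"
      have "?F \<noteq> {}" using notA \<open>maxi b\<close> by (auto simp: not_le)
      hence F: "finite ?F" "?F \<noteq> {}" by auto
      define m where "m = Min ?F"
      have m: "m \<in># P" "Suc b < m" using Min_in[OF F] by (simp_all add: m_def)
      have m_le: "m \<le> x" if "x \<in># P" "Suc b < x" for x using Min_le[OF F(1)] that by (simp add: m_def)
      \<comment> \<open>Mirror image: a further part above m + 1 excludes b and forces m = b + 2,
        and then the chain through b + 1 and m is longer than \<open>u\<close>.\<close>
      have shape: "x = b \<or> x = Suc b \<or> x = m \<or> x = Suc m" if x: "x \<in># P" for x
      proof (rule ccontr)
        assume no: "\<not> ?thesis"
        have xb: "Suc b < x" using bot[OF x] no by simp
        have mx: "m + 2 \<le> x" using m_le[OF x xb] no by simp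
        have bP: "b \<notin># P" using sep[OF _ m(1) x _ mx, of b] m(2) by auto
        hence Sb: "Suc b \<in># P" using b by simp
        have "\<not> Suc b + 2 \<le> m" using sep[OF Sb m(1) x _ mx] by blast
        hence mb: "m = Suc (Suc b)" using m(2) by simp
        define X Y Z where "X = Suc b * count P (Suc b)" and "Y = b * count P m"
          and "Z = size {#x \<in># P. m < x#}"
        have "chain_len P b = X + 2 * (count P m + Z)"
          unfolding X_def Z_def using cnt0[OF bP] size_filter_Suc[of "Suc b" P] mb by (simp add: chain_len_def)
        moreover have "chain_len P (Suc b) = X + (Y + 2 * count P m) + 2 * Z"
          unfolding X_def Y_def Z_def by (simp add: chain_len_def mb)
        moreover have "0 < Y" using b(1) cnt[OF m(1)] by (simp add: Y_def)
        moreover have "chain_len P (Suc b) \<le> u" by (rule le) (use Sb in auto)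
        ultimately show False using b(3) by presburger
      qed
      have PP: "P = replicate_mset (count P b) b + replicate_mset (count P (Suc b)) (Suc b)
          + replicate_mset (count P m) m + replicate_mset (count P (Suc m)) (Suc m)"
        using multiset_eq_four_replicates[of P b "Suc b" m "Suc m", OF shape] m(2) by simp
      have "size {#x \<in># P. Suc b < x#} = count P m + count P (Suc m)"
        by (subst PP) (use m(2) in \<open>simp add: size_filter_replicate_mset\<close>)
      hence u: "u = b * count P b + Suc b * count P (Suc b) + 2 * (count P m + count P (Suc m))"
        using b(3) by (simp add: chain_len_def)
      have "sum_mset P = (b * count P b + Suc b * count P (Suc b)) + (m * count P m + Suc m * count P (Suc m))"
        by (subst PP) (simp add: algebra_simps)
      hence v: "m * count P m + Suc m * count P (Suc m) = u - r + 2 * (count P m + count P (Suc m))"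
        using sum u by linarith
      have c: "0 < count P b + count P (Suc b)" using b(2) by auto
      show ?thesis
        by (rule table_of_longest_chain_at_bottom[OF r2 ru le PP b(1) m(2) c cnt[OF m(1)] u v strict])
    next
      case notB: False
      define b where "b = b0"
      have b: "0 < b" "b \<in># P \<or> Suc b \<in># P" "chain_len P b = u" using b0 by (simp_all add: maxi_def b_def)
      obtain p where p: "p \<in># P" "p < b" using notB b0 by (auto simp: b_def not_le)
      obtain f where f: "f \<in># P" "Suc b < f" using notA b0 by (auto simp: b_def not_le)
      \<comment> \<open>With a part p below the chain and a part f above it, separation admits only
        b - 1 below when b occurs, and only b + 2 above when b + 1 occurs.\<close>
      have below: "Suc x = b" if "b \<in># P" "x \<in># P" "x < b" for x
      proof (rule ccontr)
        assume "Suc x \<noteq> b"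
        hence "x + 2 \<le> b" "b + 2 \<le> f" using that(3) f(2) by simp_all
        thus False by (rule sep[OF that(2,1) f(1)])
      qed
      have above: "x = Suc (Suc b)" if "Suc b \<in># P" "x \<in># P" "Suc b < x" for x
      proof (rule ccontr)
        assume "x \<noteq> Suc (Suc b)"
        hence "p + 2 \<le> Suc b" "Suc b + 2 \<le> x" using that(3) p(2) by simp_all
        thus False by (rule sep[OF p(1) that(1,2)])
      qed
      \<comment> \<open>If one of the two sizes of the chain were missing, shifting the chain by one
        so as to include the parts \<open>p\<close> or \<open>f\<close> would lengthen it.\<close>
      have Sb: "Suc b \<in># P"
      proof (rule ccontr)
        assume no: "Suc b \<notin># P"
        hence bP: "b \<in># P" using b by simp
        have pb: "b = Suc p" using below[OF bP p] by simp
        have "chain_len P p = p * count P p + b * count P b + 2 * size {#x \<in># P. Suc b < x#}"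
          using size_filter_Suc[of b P] cnt0[OF no] by (simp add: chain_len_def pb)
        moreover have "u = b * count P b + 2 * size {#x \<in># P. Suc b < x#}"
          using b(3) cnt0[OF no] by (simp add: chain_len_def)
        moreover have "0 < p * count P p" using cnt[OF p(1)] pos[OF p(1)] by simp
        moreover have "chain_len P p \<le> u" by (rule le[OF pos[OF p(1)]]) (use p in auto)
        ultimately show False by linarith
      qed
      have fb: "f = Suc (Suc b)" by (rule above[OF Sb f])
      have bP: "b \<in># P"
      proof (rule ccontr)
        assume no: "b \<notin># P"
        define X Y Z where "X = Suc b * count P (Suc b)" and "Y = b * count P f"
          and "Z = size {#x \<in># P. f < x#}"
        have "u = X + 2 * (count P f + Z)"
          unfolding X_def Z_def using b(3) cnt0[OF no] size_filter_Suc[of "Suc b" P] by (simp add: chain_len_def fb)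
        moreover have "chain_len P (Suc b) = X + (Y + 2 * count P f) + 2 * Z"
          unfolding X_def Y_def Z_def by (simp add: chain_len_def fb)
        moreover have "0 < Y" using b(1) cnt[OF f(1)] by (simp add: Y_def)
        moreover have "chain_len P (Suc b) \<le> u" by (rule le) (use Sb in auto)
        ultimately show False by presburger
      qed
      have pb: "b = Suc p" using below[OF bP p] by simp
      have shape: "x = p \<or> x = b \<or> x = Suc b \<or> x = f" if x: "x \<in># P" for x
        using below[OF bP x] above[OF Sb x] pb fb by (cases "x < b"; cases "Suc b < x") auto
      have PP: "P = replicate_mset (count P p) p + replicate_mset (count P (Suc p)) (Suc p)
          + replicate_mset (count P (Suc (Suc p))) (Suc (Suc p))
          + replicate_mset (count P (Suc (Suc (Suc p)))) (Suc (Suc (Suc p)))"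
        using multiset_eq_four_replicates[of P p b "Suc b" f, OF shape] pb fb by simp
      have "x \<le> Suc (Suc b)" if "x \<in># P" for x using above[OF Sb that] by (cases "Suc b < x") simp_all
      hence "size {#x \<in># P. Suc b < x#} = count P f"
        using size_filter_Suc[of "Suc b" P] top0[of "Suc (Suc b)"] fb by simp
      hence u: "u = Suc p * count P (Suc p) + Suc (Suc p) * count P (Suc (Suc p)) + 2 * count P (Suc (Suc (Suc p)))"
        using b(3) by (simp add: chain_len_def pb fb)
      have "sum_mset P = p * count P p + Suc (Suc (Suc p)) * count P (Suc (Suc (Suc p)))
          + (Suc p * count P (Suc p) + Suc (Suc p) * count P (Suc (Suc p)))"
        by (subst PP) (simp add: algebra_simps)
      hence v: "p * count P p + Suc (Suc (Suc p)) * count P (Suc (Suc (Suc p))) = u - r + 2 * count P (Suc (Suc (Suc p)))"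
        using sum u by linarith
      have "\<not> maxi p" using notB shape pb fb by force
      hence s1: "chain_len P p < u"
        using le[OF pos[OF p(1)]] p(1) pos[OF p(1)] by (auto simp: maxi_def le_less)
      have s2: "chain_len P (Suc (Suc p)) < u"
        by (rule strict) (use Sb pb fb shape in force)+
      have fP: "0 < count P (Suc (Suc (Suc p)))" using cnt[OF f(1)] pb fb by simp
      show ?thesis
        by (rule table_of_longest_chain_in_middle[OF r2 ru le PP pos[OF p(1)] cnt[OF p(1)] fP u v s1 s2])
    qed
  qed
qed

theorem theorem3p19:
  fixes u r :: nat
  assumes "infinite (UNIV :: 'a::field set)"
    and "2 \<le> r" and "r < u"
  shows "Q_inv TYPE('a) {#u, u - r#} \<subseteq> table u r"
proof
  fix P assume P: "P \<in> Q_inv TYPE('a) {#u, u - r#}"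
  have uv: "0 < u - r" "u - r < u" using assms by simp_all
  note Q = Q_inv_two_parts[OF assms(1) uv P]
  have P0: "0 \<notin># P" using P by (simp add: Q_inv_def is_partition_def)
  have "x \<le> sum_mset P" if "x \<in># P" for x
    using that by (metis le_add1 multi_member_split sum_mset.add_mset)
  hence chain: "uchain (count P) (sum_mset P) a = chain_len P a" for a
    unfolding uchain_def chain_len_def by (subst sum_count_eq_size_filter) auto
  show "P \<in> table u r"
  proof (rule partition_in_table[OF assms(2,3) P0 Q(1)])
    show "chain_len P a \<le> u" if "0 < a" "a \<in># P \<or> Suc a \<in># P" for a
      using Q(2)[of a] that by (auto simp: chain)
    show "\<exists>b. u \<le> chain_len P b" using Q(3) by (simp add: chain)
    show False if "p \<in># P" "q \<in># P" "s \<in># P" "p + 2 \<le> q" "q + 2 \<le> s" for p q s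
      using Q(4)[of p q s] that P0 by (cases p) auto
  qed
qed

end
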